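(* Let $H$ be a bull or a hammer, and let $G$ be a connected $(C_4, P_7, H)$-free graph without clique cutsets or universal cliques. Then $G\in\mathfrak{F}$ (up to isomorphism) if $H$ is a hammer, and $G$ is a nonempty clique blowup of a graph in $\mathfrak{F}$ if $H$ is a bull.
   Context: All graphs are finite and simple. $C_k$ is the cycle on $k$ vertices and $P_k$ the path on $k$ vertices. A graph is $(H_1,H_2,\dots)$-free if it has no induced subgraph isomorphic to any $H_i$. A bull is a triangle with two disjoint pendant edges (attached at two different vertices of the triangle). A hammer is obtained by identifying an end of $P_3$ with a vertex of a triangle. A clique cutset of $G$ is a clique $K$ such that $G-K$ has more components than $G$. A universal clique of $G$ is a nonempty clique $K$ such that every vertex of $K$ is adjacent to every vertex of $V(G)\setminus K$ (in particular, a complete graph has a universal clique). A clique blowup of a graph $F$ with $V(F)=\{v_1,\dots,v_n\}$ is a graph $G$ whose vertex set can be partitioned into $n$ cliques $A_1,\dots,A_n$ (possibly empty) such that, for $i\neq j$, all edges between $A_i$ and $A_j$ are present if $v_iv_j\in E(F)$, and none are present if $v_iv_j\notin E(F)$. It is a nonempty clique blowup if $A_i\neq\emptyset$ for all $i$. The family $\mathfrak{F}=\{F_0,F_0',F_1,F_2,\dots,F_{12}\}$, where $F_0'$ and $F_2$ stand for all graphs obtained for positive integer parameters $t'$ and $t$ respectively, is as follows. $F_0=C_6$. $F_0'$ (parameter $t'\ge1$): a 6-cycle $v_1v_2\cdots v_6v_1$ plus vertices $y_1,\dots,y_{t'},z_1,\dots,z_{t'}$ with added edges $v_1y_j$, $y_jz_j$,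 $z_jv_4$ for $1\le j\le t'$. For $F_1,\dots,F_4$ let $v_1v_2v_3v_4v_5v_1$ be a 5-cycle. $F_1=C_5$. $F_2$ (parameter $t\ge1$): the 5-cycle plus vertices $y_1,\dots,y_t,z_1,\dots,z_t$ with added edges $v_1y_j$, $y_jz_j$, $z_jv_3$ for $1\le j\le t$. $F_3$: the 5-cycle plus $a_1,a_3,a_4$ with added edges $a_iv_i$ $(i=1,3,4)$, $a_1a_3$, $a_1a_4$. $F_4$: the 5-cycle plus $a_1,a_3,a_4,a_5$ with added edges $a_iv_i$ $(i=1,3,4,5)$, $a_1a_3$, $a_1a_4$, $a_3a_5$. $F_5$ is the Petersen graph. For $F_6,\dots,F_{12}$ let $x_1x_2\cdots x_7x_1$ be a 7-cycle, let $x_8$ be a vertex adjacent to $x_2,x_6$, let $x_9$ be adjacent to $x_3,x_7$, let $x_{10}$ be adjacent to $x_8,x_9$, and let $x_{11}$ be adjacent to $x_3,x_6$, with no other edges. $F_{12}$ is this whole graph on $\{x_1,\dots,x_{11}\}$, and, as induced subgraphs of $F_{12}$: $F_6=C_7$ is induced by $\{x_1,\dots,x_7\}$; $F_7$ by $\{x_1,\dots,x_7,x_8\}$; $F_8$ by $\{x_1,\dots,x_9\}$; $F_9$ by $\{x_1,\dots,x_{10}\}$; $F_{10}$ by $\{x_1,\dots,x_7,x_9,x_{11}\}$; $F_{11}$ by $\{x_1,\dots,x_9,x_{11}\}$. *)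

theory Defs
  imports "Graph_Theory.Graph_Theory"
begin

text \<open>
  Finite simple graphs are the symmetric loop-free pair digraphs of locale
  \<^locale>\<open>pair_graph\<close>; an edge $uv$ is the pair of arcs $(u,v)$ and $(v,u)$.
\<close>

definition graph_iso :: "'a pair_pre_digraph \<Rightarrow> 'b pair_pre_digraph \<Rightarrow> bool" where
  "graph_iso G H \<longleftrightarrow> digraph_iso (with_proj G) (with_proj H)"

definition induced_free :: "'b pair_pre_digraph \<Rightarrow> 'a pair_pre_digraph \<Rightarrow> bool" where
  "induced_free H G \<longleftrightarrow>
     \<not> (\<exists>G'. induced_subgraph (with_proj G') (with_proj G) \<and> graph_iso G' H)"

definition clique :: "'a pair_pre_digraph \<Rightarrow> 'a set \<Rightarrow> bool" where
  "clique G K \<longleftrightarrow> K \<subseteq> pverts G \<and> (\<forall>u\<in>K. \<forall>v\<in>K. u \<noteq> v \<longrightarrow> (u, v) \<in> parcs G)"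

text \<open>For a symmetric digraph the strong components \<^const>\<open>pre_digraph.sccs\<close> are the usual components.\<close>

definition clique_cutset :: "'a pair_pre_digraph \<Rightarrow> 'a set \<Rightarrow> bool" where
  "clique_cutset G K \<longleftrightarrow> clique G K \<and>
     card (pre_digraph.sccs (with_proj G)) <
     card (pre_digraph.sccs (with_proj G \<restriction> (pverts G - K)))"

definition universal_clique :: "'a pair_pre_digraph \<Rightarrow> 'a set \<Rightarrow> bool" where
  "universal_clique G K \<longleftrightarrow> clique G K \<and> K \<noteq> {} \<and>
     (\<forall>u\<in>K. \<forall>v\<in>pverts G - K. (u, v) \<in> parcs G)"

definition clique_blowup_parts ::
    "'a pair_pre_digraph \<Rightarrow> 'b pair_pre_digraph \<Rightarrow> ('b \<Rightarrow> 'a set) \<Rightarrow> bool" where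
  "clique_blowup_parts G F A \<longleftrightarrow>
     (\<Union>v\<in>pverts F. A v) = pverts G \<and>
     disjoint_family_on A (pverts F) \<and>
     (\<forall>v\<in>pverts F. clique G (A v)) \<and>
     (\<forall>u\<in>pverts F. \<forall>v\<in>pverts F. u \<noteq> v \<longrightarrow>
        (if (u, v) \<in> parcs F then A u \<times> A v \<subseteq> parcs G else A u \<times> A v \<inter> parcs G = {}))"

definition nonempty_clique_blowup :: "'a pair_pre_digraph \<Rightarrow> 'b pair_pre_digraph \<Rightarrow> bool" where
  "nonempty_clique_blowup G F \<longleftrightarrow>
     (\<exists>A. clique_blowup_parts G F A \<and> (\<forall>v\<in>pverts F. A v \<noteq> {}))"

text \<open>Vertex names for the concrete graphs: $v_i$ or $x_i$ is \<open>V i\<close>, $a_i$ is \<open>A i\<close>,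
  $y_j$ is \<open>Y j\<close> and $z_j$ is \<open>Z j\<close>.\<close>

datatype vertex = V nat | A nat | Y nat | Z nat

definition graph_of :: "vertex set \<Rightarrow> vertex rel \<Rightarrow> vertex pair_pre_digraph" where
  "graph_of S E = \<lparr> pverts = S, parcs = E \<union> E\<inverse> \<rparr>"

definition path_edges :: "nat \<Rightarrow> vertex rel" where
  "path_edges k = (\<lambda>i. (V i, V (i + 1))) ` {1..<k}"

definition cycle_edges :: "nat \<Rightarrow> vertex rel" where
  "cycle_edges k = insert (V k, V 1) (path_edges k)"

definition path_graph :: "nat \<Rightarrow> vertex pair_pre_digraph" where
  "path_graph k = graph_of (V ` {1..k}) (path_edges k)"

text \<open>A cycle only for \<open>k \<ge> 3\<close>.\<close>

definition cycle_graph :: "nat \<Rightarrow> vertex pair_pre_digraph" where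
  "cycle_graph k = graph_of (V ` {1..k}) (cycle_edges k)"

definition bull :: "vertex pair_pre_digraph" where
  "bull = graph_of (V ` {1..5}) (cycle_edges 3 \<union> {(V 1, V 4), (V 2, V 5)})"

definition hammer :: "vertex pair_pre_digraph" where
  "hammer = graph_of (V ` {1..5}) (cycle_edges 3 \<union> {(V 3, V 4), (V 4, V 5)})"

definition F0 :: "vertex pair_pre_digraph" where
  "F0 = cycle_graph 6"

definition F0' :: "nat \<Rightarrow> vertex pair_pre_digraph" where
  "F0' t = graph_of (V ` {1..6} \<union> Y ` {1..t} \<union> Z ` {1..t})
     (cycle_edges 6 \<union> (\<Union>j\<in>{1..t}. {(V 1, Y j), (Y j, Z j), (Z j, V 4)}))"

definition F1 :: "vertex pair_pre_digraph" where
  "F1 = cycle_graph 5"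

definition F2 :: "nat \<Rightarrow> vertex pair_pre_digraph" where
  "F2 t = graph_of (V ` {1..5} \<union> Y ` {1..t} \<union> Z ` {1..t})
     (cycle_edges 5 \<union> (\<Union>j\<in>{1..t}. {(V 1, Y j), (Y j, Z j), (Z j, V 3)}))"

definition F3 :: "vertex pair_pre_digraph" where
  "F3 = graph_of (V ` {1..5} \<union> A ` {1, 3, 4})
     (cycle_edges 5 \<union> (\<lambda>i. (A i, V i)) ` {1, 3, 4} \<union> {(A 1, A 3), (A 1, A 4)})"

definition F4 :: "vertex pair_pre_digraph" where
  "F4 = graph_of (V ` {1..5} \<union> A ` {1, 3, 4, 5})
     (cycle_edges 5 \<union> (\<lambda>i. (A i, V i)) ` {1, 3, 4, 5} \<union>
      {(A 1, A 3), (A 1, A 4), (A 3, A 5)})"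

text \<open>The Petersen graph: outer 5-cycle, spokes, inner pentagram.\<close>

definition F5 :: "vertex pair_pre_digraph" where
  "F5 = graph_of (V ` {1..5} \<union> A ` {1..5})
     (cycle_edges 5 \<union> (\<lambda>i. (A i, V i)) ` {1..5} \<union>
      {(A 1, A 3), (A 2, A 4), (A 3, A 5), (A 4, A 1), (A 5, A 2)})"

definition F12 :: "vertex pair_pre_digraph" where
  "F12 = graph_of (V ` {1..11})
     (cycle_edges 7 \<union>
      {(V 8, V 2), (V 8, V 6), (V 9, V 3), (V 9, V 7),
       (V 10, V 8), (V 10, V 9), (V 11, V 3), (V 11, V 6)})"

definition F12_induced :: "nat set \<Rightarrow> vertex pair_pre_digraph" where
  "F12_induced I = \<lparr> pverts = V ` I, parcs = parcs F12 \<inter> (V ` I \<times> V ` I) \<rparr>"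

definition F6 :: "vertex pair_pre_digraph" where
  "F6 = F12_induced {1..7}"

definition F7 :: "vertex pair_pre_digraph" where
  "F7 = F12_induced {1..8}"

definition F8 :: "vertex pair_pre_digraph" where
  "F8 = F12_induced {1..9}"

definition F9 :: "vertex pair_pre_digraph" where
  "F9 = F12_induced {1..10}"

definition F10 :: "vertex pair_pre_digraph" where
  "F10 = F12_induced ({1..7} \<union> {9, 11})"

definition F11 :: "vertex pair_pre_digraph" where
  "F11 = F12_induced ({1..9} \<union> {11})"

definition family_F :: "vertex pair_pre_digraph set" where
  "family_F = {F0, F1, F3, F4, F5, F6, F7, F8, F9, F10, F11, F12}
     \<union> F0' ` {1..} \<union> F2 ` {1..}"

end

theory Submission
  imports Defs
begin

text \<open>
  Call a connected graph without clique cutsets and without universal cliques an \<^emph>\<open>atom\<close>. A hole is an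
  induced cycle of length at least five. The proof passes through triangle-free graphs: if \<open>H\<close> is a
  hammer, then \<open>G\<close> itself is triangle-free; if \<open>H\<close> is a bull, then \<open>G\<close> is a clique blowup of a
  triangle-free induced subgraph, which is again an atom.
  
  Three observations lead there. Every vertex \<open>v\<close> of a \<open>C\<^sub>4\<close>-free atom lies on a hole
  (\<open>every_vertex_in_hole\<close>): for a component \<open>B\<close> of what is left after deleting \<open>v\<close> and its neighbours,
  the neighbourhood of \<open>B\<close> is not a clique, because it separates \<open>v\<close> from \<open>B\<close>; two nonadjacent vertices
  in it, joined by a shortest path through \<open>B\<close> and by \<open>v\<close>, give the hole. Secondly, no vertex is
  complete to a hole (\<open>no_complete\<close>): the vertices complete to it form a clique \<open>K\<close>, some vertex outside
  \<open>K\<close> is nonadjacent to some \<open>u\<close> in \<open>K\<close>, and on a walk that leads from the hole to that vertex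
  without meeting \<open>K\<close>, the step that leaves the neighbourhood of \<open>u\<close> creates a hammer and a bull. Thirdly, a
  vertex that sees two consecutive vertices of a hole, but not all of them, gives a hammer at once;
  if there is no bull, it sees exactly three consecutive vertices, and then it is a true twin of the
  middle one (\<open>clones_are_twins\<close>).
  
  In the hammer case a triangle through a vertex of a hole therefore extends along the hole to a
  hammer. In the bull case one keeps one vertex of each class of true twins. In the graph that
  remains, a triangle on a vertex \<open>x\<close> forces \<open>x\<close> to be a cut vertex, which an atom does not have.
  
  A triangle-free, \<open>C\<^sub>4\<close>-free and \<open>P\<^sub>7\<close>-free atom has holes of lengths 5, 6 and 7 only. Fix one
  of length 7 if there is one, otherwise one of length 5 if there is one, otherwise one of length 6.
  An outside vertex sees very few vertices of it, and the absence of \<open>P\<^sub>7\<close> and of the lengths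
  excluded by the choice determines all other adjacencies; reading off the possibilities gives the family
  (\<open>heptagon_classification\<close>, \<open>pentagon_classification\<close>, \<open>hexagon_classification\<close>).
\<close>

section \<open>Graphs as adjacency relations, induced paths and holes\<close>

text \<open>
  An adjacency relation on a carrier set. The bull case passes to an induced subgraph and applies the
  same results to it, so they are stated for a vertex set and a relation.
\<close>
locale sgraph =
  fixes U :: "'a set" and adj :: "'a \<Rightarrow> 'a \<Rightarrow> bool" (infix "\<sim>" 50)
  assumes finite_U: "finite U"
    and adj_in: "u \<sim> v \<Longrightarrow> u \<in> U"
    and adj_sym: "u \<sim> v \<Longrightarrow> v \<sim> u"
    and adj_irrefl [simp]: "\<not> u \<sim> u"
begin

abbreviation nonadj (infix "\<nsim>" 50) where "u \<nsim> v \<equiv> \<not> u \<sim> v"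

lemma adj_commute: "u \<sim> v \<longleftrightarrow> v \<sim> u"
  using adj_sym by blast

lemma adj_in2: "u \<sim> v \<Longrightarrow> v \<in> U"
  using adj_in adj_sym by blast

definition edges_within :: "'a set \<Rightarrow> 'a rel" where
  "edges_within S = {(x, y). x \<sim> y \<and> x \<in> S \<and> y \<in> S}"

definition cliq :: "'a set \<Rightarrow> bool" where
  "cliq K \<longleftrightarrow> K \<subseteq> U \<and> (\<forall>u\<in>K. \<forall>v\<in>K. u \<noteq> v \<longrightarrow> u \<sim> v)"

lemma edges_within_sym: "(x, y) \<in> (edges_within S)\<^sup>* \<Longrightarrow> (y, x) \<in> (edges_within S)\<^sup>*"
proof -
  have "sym (edges_within S)"
    unfolding sym_def edges_within_def using adj_sym by blast
  then show "(x, y) \<in> (edges_within S)\<^sup>* \<Longrightarrow> (y, x) \<in> (edges_within S)\<^sup>*"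
    using sym_rtrancl symD by metis
qed

text \<open>
  A chord, or a repeated vertex, would allow a shortcut.
\<close>
lemma shortest_path_is_induced:
  assumes ab: "(a, b) \<in> (edges_within S)\<^sup>*" and "a \<in> S"
  obtains p and k :: nat where "p 0 = a" "p k = b" "\<And>i. i \<le> k \<Longrightarrow> p i \<in> S"
    "\<And>i j. i \<le> k \<Longrightarrow> j \<le> k \<Longrightarrow> p i \<sim> p j \<longleftrightarrow> j = i + 1 \<or> i = j + 1"
    "inj_on p {..k}"
proof -
  define walk where "walk p k \<longleftrightarrow> p 0 = a \<and> p k = b \<and> (\<forall>i<k. (p i, p (Suc i)) \<in> edges_within S)"
    for p :: "nat \<Rightarrow> 'a" and k
  have "\<exists>k p. walk p k"
  proof -
    obtain k where "(a, b) \<in> edges_within S ^^ k"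
      using ab rtrancl_power by metis
    then show ?thesis unfolding relpow_fun_conv walk_def by blast
  qed
  then obtain k where k: "\<exists>p. walk p k" and least: "\<And>l. l < k \<Longrightarrow> \<not> (\<exists>p. walk p l)"
    using exists_least_iff[of "\<lambda>k. \<exists>p. walk p k"] by blast
  then obtain p where p: "walk p k" by blast
  have p0: "p 0 = a" and pk: "p k = b" and step: "\<And>i. i < k \<Longrightarrow> (p i, p (Suc i)) \<in> edges_within S"
    using p by (auto simp: walk_def)
  have inS: "p i \<in> S" if "i \<le> k" for i
    using step[of "i - 1"] p0 \<open>a \<in> S\<close> that by (cases i) (auto simp: edges_within_def)
  have shortcut: False if "i + 1 < j" "j \<le> k" "p i \<sim> p j" for i j
  proof -
    define q where "q l = (if l \<le> i then p l else p (l + (j - i - 1)))" for l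
    have "walk q (k - (j - i - 1))"
      unfolding walk_def
    proof (intro conjI allI impI)
      show "q 0 = a" by (simp add: q_def p0)
      show "q (k - (j - i - 1)) = b" using that pk by (auto simp: q_def)
      fix l assume l: "l < k - (j - i - 1)"
      consider "l < i" | "l = i" | "l > i" by linarith
      then show "(q l, q (Suc l)) \<in> edges_within S"
      proof cases
        case 1 then show ?thesis using step[of l] that by (simp add: q_def)
      next
        case 2
        have "Suc i + (j - i - 1) = j" using that by simp
        then show ?thesis
          using 2 that inS[of i] inS[of j] by (simp add: q_def edges_within_def)
      next
        case 3
        then have "l + (j - i - 1) < k" using l by simp
        from step[OF this] show ?thesis using 3 by (simp add: q_def)
      qed
    qed
    moreover have "k - (j - i - 1) < k" using that by simp
    ultimately show False using least by blast
  qed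
  have repeat: False if "i < j" "j \<le> k" "p i = p j" for i j
  proof -
    define q where "q l = (if l \<le> i then p l else p (l + (j - i)))" for l
    have "walk q (k - (j - i))"
      unfolding walk_def
    proof (intro conjI allI impI)
      show "q 0 = a" by (simp add: q_def p0)
      show "q (k - (j - i)) = b"
      proof (cases "j = k")
        case True
        then have "k - (j - i) = i" using that by simp
        then show ?thesis using that pk True by (simp add: q_def)
      qed (use that pk in \<open>auto simp: q_def\<close>)
      fix l assume l: "l < k - (j - i)"
      consider "l < i" | "l = i" | "l > i" by linarith
      then show "(q l, q (Suc l)) \<in> edges_within S"
      proof cases
        case 1 then show ?thesis using step[of l] that by (simp add: q_def)
      next
        case 2
        have "Suc i + (j - i) = Suc j" "j < k" using that l 2 by simp_all
        then show ?thesis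
          using 2 that step[of j] by (simp add: q_def)
      next
        case 3
        then have "l + (j - i) < k" using l by simp
        from step[OF this] show ?thesis using 3 by (simp add: q_def)
      qed
    qed
    moreover have "k - (j - i) < k" using that by simp
    ultimately show False using least by blast
  qed
  show thesis
  proof (rule that[of p k])
    fix i j assume ij: "i \<le> k" "j \<le> k"
    have consec: "p l \<sim> p (Suc l)" if "l < k" for l
      using step[OF that] by (simp add: edges_within_def)
    show "p i \<sim> p j \<longleftrightarrow> j = i + 1 \<or> i = j + 1"
    proof
      assume "p i \<sim> p j"
      moreover from this have "p j \<sim> p i" by (rule adj_sym)
      ultimately show "j = i + 1 \<or> i = j + 1"
        using shortcut[of i j] shortcut[of j i] ij adj_irrefl[of "p i"]
        by (cases i j rule: linorder_cases) (fastforce simp: not_less_eq)+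
    qed (use consec[of i] consec[of j] ij adj_sym in auto)
  next
    show "inj_on p {..k}"
      using repeat by (intro linorder_inj_onI) auto
  qed (use p0 pk inS in auto)
qed

text \<open>
  The vertices of a hole are indexed by all integers, periodically. Rotating a hole is then a shift of
  the index, and every adjacency along it is a divisibility statement that arithmetic decides. Length
  four is excluded.
\<close>
definition hole :: "int \<Rightarrow> (int \<Rightarrow> 'a) \<Rightarrow> bool" where
  "hole n c \<longleftrightarrow> 5 \<le> n \<and> (\<forall>i j. n dvd i - j \<longrightarrow> c i = c j) \<and>
     (\<forall>i j. c i \<sim> c j \<longleftrightarrow> n dvd i - j - 1 \<or> n dvd i - j + 1)"

text \<open>
  Vertices with incongruent indices are distinct: equal ones would have the same two neighbours, which
  forces the length to divide 4.
\<close>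
lemma holeD:
  assumes "hole n c"
  shows hole_length: "5 \<le> n"
    and hole_adj: "c i \<sim> c j \<longleftrightarrow> n dvd i - j - 1 \<or> n dvd i - j + 1"
    and hole_in: "c i \<in> U"
    and hole_eq: "c i = c j \<longleftrightarrow> n dvd i - j"
proof -
  show n: "5 \<le> n" and adj: "c i \<sim> c j \<longleftrightarrow> n dvd i - j - 1 \<or> n dvd i - j + 1" for i j
    using assms by (auto simp: hole_def)
  have "c i \<sim> c (i + 1)" using adj by simp
  then show "c i \<in> U" by (rule adj_in)
  show "c i = c j \<longleftrightarrow> n dvd i - j"
  proof
    assume eq: "c i = c j"
    have "c j \<sim> c (i + 1)" "c j \<sim> c (i - 1)"
      using adj[of i "i + 1"] adj[of i "i - 1"] eq by simp_all
    then have "n dvd j - i - 2 \<or> n dvd j - i" "n dvd j - i \<or> n dvd j - i + 2"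
      unfolding adj by (simp_all add: algebra_simps)
    moreover have "n dvd i - j" if "n dvd j - i"
      using that by (metis dvd_minus_iff minus_diff_eq)
    moreover have "\<not> (n dvd j - i - 2 \<and> n dvd j - i + 2)"
    proof
      assume "n dvd j - i - 2 \<and> n dvd j - i + 2"
      then have "n dvd (j - i + 2) - (j - i - 2)" by (blast intro: dvd_diff)
      then have "n dvd 4" by simp
      then show False using n zdvd_imp_le[of n 4] by simp
    qed
    ultimately show "n dvd i - j" by blast
  qed (use assms in \<open>auto simp: hole_def\<close>)
qed

text \<open>
  Decides all index conditions at distance at most three, uniformly in the length of the hole.
\<close>
lemma not_dvd_small: "5 \<le> n \<Longrightarrow> k \<noteq> 0 \<Longrightarrow> \<bar>k\<bar> < 5 \<Longrightarrow> \<not> n dvd k" for n k :: int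
  using dvd_imp_le_int[of k n] by auto

lemma hole_of_list:
  assumes len: "5 \<le> length xs"
    and adj_less: "\<And>i j. i < j \<Longrightarrow> j < length xs \<Longrightarrow>
      xs ! i \<sim> xs ! j \<longleftrightarrow> j = Suc i \<or> i = 0 \<and> Suc j = length xs"
  obtains c where "hole (int (length xs)) c" "\<And>i. i < length xs \<Longrightarrow> c (int i) = xs ! i"
proof -
  let ?n = "int (length xs)"
  define c where "c i = xs ! nat (i mod ?n)" for i
  have n: "?n > 0" using len by linarith
  have adj: "xs ! i \<sim> xs ! j \<longleftrightarrow> i = Suc j mod length xs \<or> j = Suc i mod length xs"
    if "i < length xs" "j < length xs" for i j
  proof (cases i j rule: linorder_cases)
    case less
    then show ?thesis using adj_less[OF less] that len by (auto simp: mod_Suc)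
  next
    case equal
    then show ?thesis using that len by (auto simp: mod_Suc)
  next
    case greater
    then show ?thesis
      using adj_less[OF greater] that len adj_commute[of "xs ! i"] by (auto simp: mod_Suc)
  qed
  have "hole ?n c"
    unfolding hole_def
  proof (intro conjI allI impI)
    show "5 \<le> ?n" using len by simp
    fix i j
    show "c i = c j" if "?n dvd i - j"
      using that by (metis c_def mod_eq_dvd_iff)
    define r s where "r = nat (i mod ?n)" and "s = nat (j mod ?n)"
    have rs: "r < length xs" "s < length xs" "int r = i mod ?n" "int s = j mod ?n"
      using n by (simp_all add: r_def s_def nat_less_iff)
    have aux: "p = Suc q mod length xs \<longleftrightarrow> ?n dvd k - l - 1"
      if "int p = k mod ?n" "int q = l mod ?n" for p q k l
    proof -
      have "p = Suc q mod length xs \<longleftrightarrow> int p = int (Suc q) mod ?n"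
        by (metis of_nat_eq_iff of_nat_mod)
      also have "\<dots> \<longleftrightarrow> k mod ?n = (l + 1) mod ?n"
        using that by (simp add: mod_simps add.commute)
      also have "\<dots> \<longleftrightarrow> ?n dvd k - l - 1"
        by (simp add: mod_eq_dvd_iff algebra_simps)
      finally show ?thesis .
    qed
    have "?n dvd j - i - 1 \<longleftrightarrow> ?n dvd i - j + 1"
      using dvd_minus_iff[of ?n "j - i - 1"] by (simp add: algebra_simps)
    then show "c i \<sim> c j \<longleftrightarrow> ?n dvd i - j - 1 \<or> ?n dvd i - j + 1"
      using adj[OF rs(1,2)] aux[OF rs(3,4)] aux[OF rs(4,3)] by (simp add: c_def r_def s_def)
  qed
  moreover have "c (int i) = xs ! i" if "i < length xs" for i
    using that by (simp add: c_def)
  ultimately show thesis by (rule that)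
qed

end

section \<open>Atoms: every vertex lies on a hole\<close>
locale C4_free_graph = sgraph +
  assumes no_C4: "\<lbrakk>a \<sim> b; b \<sim> c; c \<sim> d; d \<sim> a; \<not> a \<sim> c; \<not> b \<sim> d; a \<noteq> c; b \<noteq> d\<rbrakk> \<Longrightarrow> False"

text \<open>
  The condition on clique cutsets in the form in which it is used: deleting a clique leaves any two
  remaining vertices joined by a walk. The empty clique gives connectedness.
\<close>
locale atom = C4_free_graph +
  assumes inseparable: "\<lbrakk>cliq K; x \<in> U; y \<in> U; x \<notin> K; y \<notin> K\<rbrakk>
      \<Longrightarrow> (x, y) \<in> (edges_within (U - K))\<^sup>*"
    and no_universal: "\<lbrakk>cliq K; K \<noteq> {}\<rbrakk> \<Longrightarrow> \<exists>u\<in>K. \<exists>v\<in>U - K. \<not> u \<sim> v"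
begin

text \<open>
  \<open>M\<close> is the set of vertices other than \<open>v\<close> that \<open>v\<close> does not see, \<open>B\<close> a component of it, and \<open>K\<close>
  the neighbourhood of \<open>B\<close>. A walk from \<open>B\<close> that avoids \<open>K\<close> never leaves \<open>B\<close>, so \<open>K\<close> is not a clique.
\<close>
theorem every_vertex_in_hole:
  assumes v: "v \<in> U"
  obtains n c where "hole n c" "c 0 = v"
proof -
  have "cliq {v}" using v by (simp add: cliq_def)
  then obtain u where u: "u \<in> U" "u \<noteq> v" "v \<nsim> u" using no_universal[of "{v}"] by auto
  define M where "M = {x \<in> U. x \<noteq> v \<and> v \<nsim> x}"
  define B where "B = {x. (u, x) \<in> (edges_within M)\<^sup>*}"
  define K where "K = {a. v \<sim> a \<and> (\<exists>x\<in>B. a \<sim> x)}"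
  have BM: "B \<subseteq> M"
  proof
    fix x assume "x \<in> B"
    then have "(u, x) \<in> (edges_within M)\<^sup>*" by (simp add: B_def)
    then show "x \<in> M"
      by (induction rule: rtrancl_induct) (use u in \<open>auto simp: M_def edges_within_def\<close>)
  qed
  have uB: "u \<in> B" by (simp add: B_def)
  have "\<not> cliq K"
  proof
    assume K: "cliq K"
    have "u \<notin> K" "v \<notin> K" using u by (auto simp: K_def)
    then have "(u, v) \<in> (edges_within (U - K))\<^sup>*" using inseparable K u v by blast
    then have "v \<in> B"
    proof (induction rule: rtrancl_induct)
      case (step y z)
      then have yz: "y \<sim> z" "y \<in> B" "y \<in> M" "z \<in> U" "z \<notin> K"
        using BM by (auto simp: edges_within_def)
      have "z \<in> M"
        using yz adj_sym unfolding M_def K_def by blast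
      then have "(y, z) \<in> edges_within M" using yz by (simp add: edges_within_def)
      then show ?case using yz(2) unfolding B_def by (auto intro: rtrancl_into_rtrancl)
    qed (rule uB)
    then show False using BM by (auto simp: M_def)
  qed
  then obtain a b where ab: "a \<in> K" "b \<in> K" "a \<noteq> b" "a \<nsim> b"
    unfolding cliq_def using adj_in2 by (auto simp: K_def)
  obtain x y where xy: "x \<in> B" "y \<in> B" "a \<sim> x" "b \<sim> y" using ab by (auto simp: K_def)
  define S where "S = insert a (insert b M)"
  have "(x, y) \<in> (edges_within M)\<^sup>*"
    using xy edges_within_sym[of u x M] by (auto simp: B_def intro: rtrancl_trans)
  then have "(x, y) \<in> (edges_within S)\<^sup>*"
    by (rule rtrancl_mono[THEN subsetD, rotated]) (auto simp: edges_within_def S_def)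
  moreover have "(a, x) \<in> edges_within S" "(y, b) \<in> edges_within S"
    using xy BM adj_sym by (auto simp: edges_within_def S_def)
  ultimately have "(a, b) \<in> (edges_within S)\<^sup>*"
    by (meson converse_rtrancl_into_rtrancl rtrancl_into_rtrancl)
  moreover have "a \<in> S" by (simp add: S_def)
  ultimately obtain p and k :: nat where p: "p 0 = a" "p k = b" "\<And>i. i \<le> k \<Longrightarrow> p i \<in> S"
    "\<And>i j. i \<le> k \<Longrightarrow> j \<le> k \<Longrightarrow> p i \<sim> p j \<longleftrightarrow> j = i + 1 \<or> i = j + 1" "inj_on p {..k}"
    by (blast elim: shortest_path_is_induced)
  have va: "v \<sim> a" "v \<sim> b" using ab by (auto simp: K_def)
  have ends: "v \<sim> p i \<longleftrightarrow> i = 0 \<or> i = k" if "i \<le> k" for i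
  proof
    assume "v \<sim> p i"
    then have "p i = p 0 \<or> p i = p k" using p(1-3) that by (auto simp: S_def M_def)
    then show "i = 0 \<or> i = k" using p(5) that by (auto dest: inj_onD)
  qed (use p va in auto)
  have "k \<noteq> 0" using p(1,2) ab by metis
  moreover have "k \<noteq> 1"
  proof
    assume "k = 1"
    then show False using p(4)[of 0 1] p(1,2) ab by simp
  qed
  \<comment> \<open>A path of length two would close up with \<open>v\<close> to an induced 4-cycle.\<close>
  moreover have "k \<noteq> 2"
  proof
    assume "k = 2"
    then have "a \<sim> p 1" "p 1 \<sim> b" "v \<nsim> p 1"
      using p(1,2) p(4)[of 0 1] p(4)[of 1 2] ends[of 1] by simp_all
    moreover have "p 1 \<noteq> v" using p(3)[of 1] ab va \<open>k = 2\<close> by (auto simp: S_def M_def)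
    ultimately show False using no_C4[of v a "p 1" b] ab va adj_sym by blast
  qed
  ultimately have k: "k \<ge> 3" by linarith
  define xs where "xs = v # map p [0..<k + 1]"
  have len: "length xs = k + 2" by (simp add: xs_def)
  have nth: "xs ! i = (if i = 0 then v else p (i - 1))" if "i < k + 2" for i
    using that by (cases i) (auto simp: xs_def simp del: upt_Suc)
  have "xs ! i \<sim> xs ! j \<longleftrightarrow> j = Suc i \<or> i = 0 \<and> Suc j = length xs"
    if "i < j" "j < length xs" for i j
  proof (cases i)
    case 0
    then show ?thesis using ends[of "j - 1"] that by (auto simp: nth len)
  next
    case (Suc l)
    then show ?thesis using p(4)[of l "j - 1"] that by (auto simp: nth len)
  qed
  then obtain c where c: "hole (int (length xs)) c" "\<And>i. i < length xs \<Longrightarrow> c (int i) = xs ! i"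
    using hole_of_list[of xs] len k by auto
  show thesis
    by (rule that[OF c(1)]) (use c(2)[of 0] in \<open>simp add: xs_def\<close>)
qed

end

section \<open>No vertex is complete to a hole\<close>
context sgraph begin

lemma hole_dist:
  assumes c: "hole n c"
  shows hole_dist_1: "\<bar>i - j\<bar> = 1 \<Longrightarrow> c i \<sim> c j"
    and hole_dist_2_3: "2 \<le> \<bar>i - j\<bar> \<Longrightarrow> \<bar>i - j\<bar> \<le> 3 \<Longrightarrow> \<not> c i \<sim> c j"
    and hole_dist_neq: "1 \<le> \<bar>i - j\<bar> \<Longrightarrow> \<bar>i - j\<bar> \<le> 4 \<Longrightarrow> c i \<noteq> c j"
proof -
  note nd = not_dvd_small[OF hole_length[OF c]]
  show "c i \<sim> c j" if "\<bar>i - j\<bar> = 1"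
  proof -
    have "i - j = 1 \<or> i - j = -1" using that by linarith
    then show ?thesis by (auto simp: hole_adj[OF c])
  qed
  show "\<not> c i \<sim> c j" if "2 \<le> \<bar>i - j\<bar>" "\<bar>i - j\<bar> \<le> 3"
    using that nd[of "i - j - 1"] nd[of "i - j + 1"] by (simp add: hole_adj[OF c])
  show "c i \<noteq> c j" if "1 \<le> \<bar>i - j\<bar>" "\<bar>i - j\<bar> \<le> 4"
    using that nd[of "i - j"] by (simp add: hole_eq[OF c])
qed

text \<open>
  Induction once around a hole: a property of indices that passes to the successor reaches every
  vertex of the hole.
\<close>
lemma around_hole:
  assumes c: "hole n c" and "Q i" and step: "\<And>k. Q k \<Longrightarrow> Q (k + 1)"
  obtains k where "Q k" "c k = c j"
proof -
  have "Q (i + int m)" for m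
  proof (induction m)
    case (Suc m)
    then show ?case using step[of "i + int m"] by (simp add: algebra_simps)
  qed (simp add: assms)
  moreover have "0 \<le> (j - i) mod n" using hole_length[OF c] by simp
  then have "c (i + int (nat ((j - i) mod n))) = c j"
    unfolding hole_eq[OF c] by (simp add: mod_eq_dvd_iff[symmetric] mod_simps)
  ultimately show thesis using that by blast
qed

lemma hole_exit:
  assumes c: "hole n c" and "x \<sim> c i" "x \<nsim> c j"
  obtains k where "x \<sim> c k" "x \<nsim> c (k + 1)"
  using around_hole[OF c, of "\<lambda>k. x \<sim> c k" i j] assms by metis

end

context C4_free_graph begin

text \<open>
  Otherwise \<open>x\<close> and three consecutive hole vertices form an induced 4-cycle.
\<close>
lemma skip_on_hole:
  assumes c: "hole n c" and "x \<sim> c i" "x \<nsim> c (i + 1)" "x \<noteq> c (i + 1)"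
  shows "x \<nsim> c (i + 2)"
  using no_C4[of x "c i" "c (i + 1)" "c (i + 2)"] assms hole_dist[OF c] adj_sym by auto

lemma complete_to_hole_cliq:
  assumes c: "hole n c" shows "cliq {u. \<forall>i. u \<sim> c i}"
proof -
  have "u \<sim> v" if "\<forall>i. u \<sim> c i" "\<forall>i. v \<sim> c i" "u \<noteq> v" for u v
    using no_C4[of u "c 0" v "c 2"] that adj_sym hole_dist[OF c, of 0 2] by auto
  then show ?thesis using adj_in unfolding cliq_def by blast
qed

lemma nonneighbour_of_complete:
  assumes c: "hole n c" and u: "\<And>i. u \<sim> c i" and v: "v \<noteq> u" "v \<nsim> u" and "v \<sim> c i" "v \<sim> c j"
  shows "c i = c j \<or> c i \<sim> c j"
  using no_C4[of u "c i" v "c j"] assms adj_sym by metis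

end

context atom begin

text \<open>
  The part of the argument that bull and hammer share. The walk runs from the hole outside the clique
  \<open>K\<close> of complete vertices, towards a vertex \<open>z\<close> that some \<open>w\<close> in \<open>K\<close> does not see. The invariant says
  that the current vertex is a neighbour of \<open>w\<close>, and that so is each of its own neighbours except \<open>w\<close>. The
  hypothesis \<open>unattached\<close> starts the walk, and \<open>switch\<close> forbids the step \<open>q\<close> to \<open>x\<close> at which a
  nonneighbour \<open>y\<close> of \<open>w\<close> appears next to \<open>x\<close>, but not next to \<open>q\<close>.
\<close>
lemma no_vertex_complete_to_hole:
  assumes c: "hole n c"
    and unattached: "\<And>u v i. \<forall>i. u \<sim> c i \<Longrightarrow> v \<noteq> u \<Longrightarrow> v \<nsim> u \<Longrightarrow> v \<nsim> c i"
    and switch: "\<And>u q x y. \<lbrakk>\<forall>i. u \<sim> c i; q \<sim> u; x \<sim> u; q \<sim> x; x \<sim> y; \<not> q \<sim> y; \<not> u \<sim> y;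
      \<forall>i. y \<nsim> c i; \<not> (\<forall>i. q \<sim> c i); \<not> (\<forall>i. x \<sim> c i)\<rbrakk> \<Longrightarrow> False"
  shows "\<exists>i. u \<nsim> c i"
proof (rule ccontr)
  define K where "K = {u. \<forall>i. u \<sim> c i}"
  assume "\<not> (\<exists>i. u \<nsim> c i)"
  then have "K \<noteq> {}" by (auto simp: K_def)
  moreover have K: "cliq K" unfolding K_def by (rule complete_to_hole_cliq[OF c])
  ultimately obtain w z where wz: "w \<in> K" "z \<in> U" "z \<notin> K" "w \<nsim> z" using no_universal by blast
  have w: "\<forall>i. w \<sim> c i" using wz by (simp add: K_def)
  have "c 0 \<notin> K" unfolding K_def using adj_irrefl[of "c 0"] by blast
  then have "(c 0, z) \<in> (edges_within (U - K))\<^sup>*" 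
    using inseparable[OF K] wz hole_in[OF c] by blast
  then have "z \<sim> w \<and> (\<forall>y. y \<noteq> w \<longrightarrow> y \<nsim> w \<longrightarrow> z \<nsim> y)"
  proof (induction rule: rtrancl_induct)
    case base
    then show ?case using w unattached adj_sym by blast
  next
    case (step q x)
    then have q: "q \<sim> w" "\<And>y. y \<noteq> w \<Longrightarrow> y \<nsim> w \<Longrightarrow> q \<nsim> y"
      and qx: "q \<sim> x" "q \<notin> K" "x \<notin> K" by (auto simp: edges_within_def)
    have "x \<noteq> w" using qx wz by blast
    then have x: "x \<sim> w" using q(2) qx(1) by blast
    have "x \<nsim> y" if y: "y \<noteq> w" "y \<nsim> w" for y
      using switch[of w q x y] w q x qx y unattached[OF w y] adj_commute[of w y] by (auto simp: K_def)
    then show ?case using x by blast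
  qed
  then show False using wz adj_sym by blast
qed

end

section \<open>Hammer-free atoms are triangle-free\<close>
locale hammer_free_atom = atom +
  assumes no_hammer: "\<lbrakk>a \<sim> b; b \<sim> c; a \<sim> c; c \<sim> d; d \<sim> e; \<not> a \<sim> d; \<not> b \<sim> d;
    \<not> a \<sim> e; \<not> b \<sim> e; \<not> c \<sim> e\<rbrakk> \<Longrightarrow> False"
begin

lemma no_complete:
  assumes c: "hole n c" shows "\<exists>i. u \<nsim> c i"
proof (rule no_vertex_complete_to_hole[OF c])
  note [simp] = hole_dist[OF c]
  show "v \<nsim> c i" if u: "\<forall>i. u \<sim> c i" and v: "v \<noteq> u" "v \<nsim> u" for u v i
  proof
    assume vi: "v \<sim> c i"
    \<comment> \<open>The triangle \<open>u, c (i + 2), c (i + 3)\<close> has the tail \<open>c i, v\<close>.\<close>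
    have "v \<nsim> c (i + 2)" "v \<nsim> c (i + 3)"
      using nonneighbour_of_complete[OF c _ v vi] u by fastforce+
    then show False
      using no_hammer[of "c (i + 2)" "c (i + 3)" u "c i" v] u v vi adj_sym by auto
  qed
  show False if u: "\<forall>i. u \<sim> c i" and y: "x \<sim> u" "x \<sim> y" "\<not> u \<sim> y" "\<forall>i. y \<nsim> c i"
    and x: "\<not> (\<forall>i. x \<sim> c i)" for u q x y
  proof -
    \<comment> \<open>The triangle is \<open>u\<close> with two consecutive hole vertices that \<open>x\<close> misses; its tail is \<open>x, y\<close>.
    Two such vertices exist, because \<open>x\<close> cannot see both hole neighbours of a vertex that it misses.\<close>
    obtain j where j: "x \<nsim> c j" using x by blast
    have "x \<noteq> c i" for i using y adj_sym by blast
    then have "x \<nsim> c (j + 1) \<or> x \<nsim> c (j - 1)"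
      using skip_on_hole[OF c, of x "j - 1"] j by (auto simp: add.commute)
    then obtain k where "x \<nsim> c k" "x \<nsim> c (k + 1)" using j by (metis diff_add_cancel)
    then show False
      using no_hammer[of "c k" "c (k + 1)" u x y] u y adj_sym by auto
  qed
qed

text \<open>
  If \<open>u\<close> sees two consecutive hole vertices but misses the next one, then it misses the one after that as
  well, and the two missed vertices are the tail of a hammer. So \<open>u\<close> would be complete to the hole.
\<close>
lemma no_consecutive:
  assumes c: "hole n c" shows "\<not> (u \<sim> c i \<and> u \<sim> c (i + 1))"
proof
  note [simp] = hole_dist[OF c]
  assume u: "u \<sim> c i \<and> u \<sim> c (i + 1)"
  have step: "u \<sim> c (k + 2)" if "u \<sim> c k" "u \<sim> c (k + 1)" for k
  proof (rule ccontr)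
    assume n2: "u \<nsim> c (k + 2)"
    have "u \<noteq> c (k + 2)" using that by auto
    then have "u \<nsim> c (k + 3)" using skip_on_hole[OF c, of u "k + 1"] that n2 by (simp add: algebra_simps)
    then show False
      using no_hammer[of u "c k" "c (k + 1)" "c (k + 2)" "c (k + 3)"] n2 that by auto
  qed
  obtain j where "u \<nsim> c j" using no_complete[OF c] by blast
  then show False
    using around_hole[OF c, of "\<lambda>k. u \<sim> c k \<and> u \<sim> c (k + 1)" i j] u step
    by (metis add.assoc one_add_one)
qed

text \<open>
  A hole through one vertex of the triangle provides the tail: neither of the other two vertices sees
  the next two vertices of the hole.
\<close>
theorem triangle_free: "\<lbrakk>x \<sim> y; y \<sim> z; x \<sim> z\<rbrakk> \<Longrightarrow> False"
proof -
  assume xyz: "x \<sim> y" "y \<sim> z" "x \<sim> z"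
  obtain n c where c: "hole n c" "c 0 = x" using every_vertex_in_hole adj_in xyz(1) by metis
  note [simp] = hole_dist[OF c(1)]
  have adj0: "y \<sim> c 0" "z \<sim> c 0" using xyz c adj_sym by auto
  then have far1: "y \<nsim> c 1" "z \<nsim> c 1" using no_consecutive[OF c(1), of _ 0] by auto
  moreover have "y \<noteq> c 1" "z \<noteq> c 1" using far1 xyz adj_sym by auto
  ultimately have "y \<nsim> c 2" "z \<nsim> c 2" using skip_on_hole[OF c(1), of _ 0] adj0 by auto
  then show False using no_hammer[of y z "c 0" "c 1" "c 2"] xyz far1 adj0 by auto
qed

end

section \<open>Twin-free bull-free atoms are triangle-free\<close>
locale bull_free_atom = atom +
  assumes no_bull: "\<lbrakk>a \<sim> b; b \<sim> c; a \<sim> c; a \<sim> d; b \<sim> e; \<not> b \<sim> d; \<not> c \<sim> d;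
    \<not> a \<sim> e; \<not> c \<sim> e; \<not> d \<sim> e\<rbrakk> \<Longrightarrow> False"
begin

lemma no_complete:
  assumes c: "hole n c" shows "\<exists>i. u \<nsim> c i"
proof (rule no_vertex_complete_to_hole[OF c])
  note [simp] = hole_dist[OF c]
  show "v \<nsim> c i" if u: "\<forall>i. u \<sim> c i" and v: "v \<noteq> u" "v \<nsim> u" for u v i
  proof
    assume vi: "v \<sim> c i"
    \<comment> \<open>On the hole \<open>v\<close> sees only \<open>c i\<close> and at most one neighbour of it, so on one side there
    is room for a bull with triangle \<open>c i, u, c (i - 1)\<close> or \<open>c i, u, c (i + 1)\<close>.\<close>
    note near = nonneighbour_of_complete[OF c _ v]
    have "v \<nsim> c (i + 2)" "v \<nsim> c (i + 3)"
      using near[OF _ vi] u by fastforce+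
    moreover have "v \<nsim> c (i + 1) \<or> v \<nsim> c (i - 1)"
      using near[of "i + 1" "i - 1"] u by auto
    ultimately show False
      using no_bull[of "c i" u "c (i - 1)" v "c (i + 2)"] no_bull[of "c i" u "c (i + 1)" v "c (i + 3)"]
        u v vi adj_sym by auto
  qed
  show False if u: "\<forall>i. u \<sim> c i" and y: "q \<sim> u" "x \<sim> u" "q \<sim> x" "x \<sim> y" "\<not> q \<sim> y" "\<not> u \<sim> y"
      "\<forall>i. y \<nsim> c i"
    and incomplete: "\<not> (\<forall>i. q \<sim> c i)" "\<not> (\<forall>i. x \<sim> c i)" for u q x y
  proof (cases "\<exists>i. x \<sim> c i")
    case True
    \<comment> \<open>Bull with triangle \<open>x, u, c i\<close> and pendant vertices \<open>y\<close> at \<open>x\<close> and \<open>c (i + 2)\<close> at \<open>u\<close>.\<close>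
    then obtain i where i: "x \<sim> c i" "x \<nsim> c (i + 1)" using hole_exit[OF c] incomplete(2) by metis
    have "x \<noteq> c (i + 1)" using y adj_sym by blast
    then have "x \<nsim> c (i + 2)" using skip_on_hole[OF c] i by blast
    then show False using no_bull[of x u "c i" y "c (i + 2)"] u y i adj_sym by auto
  next
    case False
    \<comment> \<open>Here \<open>x\<close> misses the whole hole, and \<open>q\<close> serves as the third vertex of the triangle.\<close>
    obtain j where "q \<nsim> c j" using incomplete(1) by blast
    then show False using no_bull[of x u q y "c j"] False u y adj_sym by auto
  qed
qed

end

text \<open>
  Adjacent vertices have different closed neighbourhoods.
\<close>
locale twinless_bull_free_atom = bull_free_atom +
  assumes twinless: "u \<sim> v \<Longrightarrow> \<exists>w. w \<noteq> u \<and> w \<noteq> v \<and> (w \<sim> u) \<noteq> (w \<sim> v)"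
begin

text \<open>
  Here \<open>r', r, p, s, s'\<close> are five consecutive vertices of a hole (\<open>r'\<close> and \<open>s'\<close> may be
  adjacent), and \<open>q\<close> sees precisely the middle three of them. A vertex \<open>w\<close> that sees just one of \<open>p\<close> and \<open>q\<close> must see \<open>r\<close>: otherwise the
  triangle \<open>p, q, r\<close> with \<open>w\<close> and \<open>r'\<close> is a bull, or \<open>w\<close> sees \<open>r'\<close> and closes a 4-cycle. Likewise \<open>w\<close> sees
  \<open>s\<close>, and then \<open>w\<close>, \<open>r\<close>, \<open>s\<close> and the vertex that \<open>w\<close> misses form a 4-cycle.
\<close>
lemma clones_are_twins:
  assumes pq: "p \<sim> q"
    and r: "r \<sim> p" "r \<sim> q" "r \<sim> r'" "\<not> r' \<sim> p" "\<not> r' \<sim> q"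
    and s: "s \<sim> p" "s \<sim> q" "s \<sim> s'" "\<not> s' \<sim> p" "\<not> s' \<sim> q"
    and rs: "r \<noteq> s" "\<not> r \<sim> s"
  shows False
proof -
  have key: "w \<sim> t" if w: "w \<sim> p" "\<not> w \<sim> q" "w \<noteq> q" and pq: "p \<sim> q"
    and t: "t \<sim> p" "t \<sim> q" "t \<sim> t'" "\<not> t' \<sim> p" "\<not> t' \<sim> q"  for w t t' p q
  proof (rule ccontr)
    assume wt: "\<not> w \<sim> t"
    have "w \<sim> t'"
      using no_bull[of p t q w t'] wt that adj_sym by blast
    then show False
      using no_C4[of w p t t'] wt that adj_sym by blast
  qed
  have two: False if w: "w \<sim> p" "\<not> w \<sim> q" "w \<noteq> q" "p \<sim> q"
    and r: "r \<sim> p" "r \<sim> q" "r \<sim> r'" "\<not> r' \<sim> p" "\<not> r' \<sim> q"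
    and s: "s \<sim> p" "s \<sim> q" "s \<sim> s'" "\<not> s' \<sim> p" "\<not> s' \<sim> q" for w p q
    using key[OF w r] key[OF w s] no_C4[of w r q s] rs that adj_sym by blast
  obtain w where "w \<noteq> p" "w \<noteq> q" "(w \<sim> p) \<noteq> (w \<sim> q)" using twinless[OF pq] by blast
  then show False
    using two[of w p q] two[of w q p] assms adj_sym by blast
qed

text \<open>
  A bull-free graph forces a vertex that sees \<open>c k\<close> and \<open>c (k + 1)\<close> but not \<open>c (k + 2)\<close> to see
  \<open>c (k - 1)\<close> and to miss \<open>c (k - 2)\<close>, which makes it a twin of \<open>c k\<close>.
\<close>
lemma no_consecutive:
  assumes c: "hole n c" shows "\<not> (u \<sim> c i \<and> u \<sim> c (i + 1))"
proof
  note [simp] = hole_dist[OF c]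
  assume u: "u \<sim> c i \<and> u \<sim> c (i + 1)"
  have step: "u \<sim> c (k + 2)" if k: "u \<sim> c k" "u \<sim> c (k + 1)" for k
  proof (rule ccontr)
    assume n2: "u \<nsim> c (k + 2)"
    have "u \<noteq> c (k + 2)" using k by auto
    then have n3: "u \<nsim> c (k + 3)"
      using skip_on_hole[OF c, of u "k + 1"] k n2 by (simp add: algebra_simps)
    have left: "u \<sim> c (k - 1)"
      using no_bull[of "c (k + 1)" "c k" u "c (k + 2)" "c (k - 1)"] k n2 adj_sym by auto
    have "u \<nsim> c (k - 2)"
    proof
      assume l2: "u \<sim> c (k - 2)"
      have "c (k + 2) \<nsim> c (k - 2)"
      proof
        \<comment> \<open>In a hole of length five \<open>c (k - 2)\<close> is \<open>c (k + 3)\<close>, which \<open>u\<close> misses.\<close>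
        assume "c (k + 2) \<sim> c (k - 2)"
        then have "n dvd 3 \<or> n dvd 5" by (simp add: hole_adj[OF c])
        then have "n dvd 5" using not_dvd_small[OF hole_length[OF c], of 3] by simp
        then have "c (k + 3) = c (k - 2)" by (simp add: hole_eq[OF c])
        then show False using n3 l2 by simp
      qed
      then show False
        using no_bull[of "c (k + 1)" u "c k" "c (k + 2)" "c (k - 2)"] k n2 l2 adj_sym by auto
    qed
    then show False
      using clones_are_twins[of u "c k" "c (k + 1)" "c (k + 2)" "c (k - 1)" "c (k - 2)"]
        k left n2 adj_sym by auto
  qed
  obtain j where "u \<nsim> c j" using no_complete[OF c] by blast
  then show False
    using around_hole[OF c, of "\<lambda>k. u \<sim> c k \<and> u \<sim> c (k + 1)" i j] u step
    by (metis add.assoc one_add_one)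
qed

text \<open>
  Both hole neighbours of \<open>c 0\<close> can serve as a pendant vertex at \<open>c 0\<close> of the triangle \<open>c 0, y, z\<close>; so \<open>w\<close>
  sees both of them, which closes a 4-cycle.
\<close>
lemma same_outer_neighbours:
  assumes c: "hole n c" and yz: "y \<sim> c 0" "z \<sim> c 0" "y \<sim> z" and w: "w \<sim> y" "w \<noteq> c 0" "w \<nsim> c 0"
  shows "w \<sim> z"
proof (rule ccontr)
  note [simp] = hole_dist[OF c]
  assume wz: "w \<nsim> z"
  have "y \<nsim> c 1" "z \<nsim> c 1" "y \<nsim> c (-1)" "z \<nsim> c (-1)"
    using no_consecutive[OF c, of _ 0] no_consecutive[OF c, of _ "-1"] yz by auto
  then have "w \<sim> c 1" "w \<sim> c (-1)"
    using no_bull[of y "c 0" z w "c 1"] no_bull[of y "c 0" z w "c (-1)"] yz w wz adj_sym by auto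
  then show False
    using no_C4[of "c 0" "c 1" w "c (-1)"] w adj_sym by auto
qed

text \<open>
  Let \<open>x, y, z\<close> be a triangle and let \<open>w\<close> distinguish \<open>y\<close> from \<open>z\<close>. Then \<open>w\<close> is a neighbour of \<open>x\<close>.
  Adjacent neighbours of \<open>x\<close> agree on the vertices that \<open>x\<close> does not see; such a vertex next to \<open>y\<close> would
  also see \<open>z\<close> and \<open>w\<close> and close a 4-cycle with \<open>x\<close>. So nothing beyond the neighbours of
  \<open>x\<close> can be reached from \<open>y\<close> without passing through \<open>x\<close>, and \<open>{x}\<close> is a clique cutset.
\<close>
theorem triangle_free: "\<lbrakk>x \<sim> y; y \<sim> z; x \<sim> z\<rbrakk> \<Longrightarrow> False"
proof -
  assume xyz: "x \<sim> y" "y \<sim> z" "x \<sim> z"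
  obtain n c where c: "hole n c" "c 0 = x" using every_vertex_in_hole adj_in xyz(1) by metis
  note [simp] = hole_dist[OF c(1)]
  note outer = same_outer_neighbours[OF c(1), unfolded c(2)]
  have key: False if yz: "y \<sim> z" "y \<sim> x" "z \<sim> x" and w: "w \<noteq> y" "w \<noteq> z" "w \<sim> y" "w \<nsim> z" for y z w
  proof -
    have "w \<noteq> x" using w yz adj_sym by blast
    then have wx: "w \<sim> x" using outer[of y z w] yz w adj_sym by blast
    define P where "P v \<longleftrightarrow> v \<sim> x \<and> v \<noteq> c 1 \<and> (\<forall>p. p \<sim> v \<longrightarrow> p = x \<or> p \<sim> x)" for v
    have ne1: "v \<noteq> c 1" if "v \<sim> v'" "v' \<sim> x" for v v'
      using that no_consecutive[OF c(1), of v' 0] c(2) adj_sym by auto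
    have "p = x \<or> p \<sim> x" if p: "p \<sim> y" for p
    proof (rule ccontr)
      assume px: "\<not> (p = x \<or> p \<sim> x)"
      then have "p \<sim> z" "p \<sim> w" using outer[of y z p] outer[of y w p] yz w wx p adj_sym by blast+
      then show False using no_C4[of x w p z] px w wx yz adj_sym by blast
    qed
    then have Py: "P y" using yz ne1[of y z] by (auto simp: P_def)
    have "cliq {x}" using adj_in xyz by (simp add: cliq_def)
    moreover have "y \<in> U" "y \<notin> {x}" "c 1 \<in> U" "c 1 \<notin> {x}"
      using yz adj_in c hole_in[OF c(1)] hole_dist_neq[OF c(1), of 1 0] by auto
    ultimately have "(y, c 1) \<in> (edges_within (U - {x}))\<^sup>*" by (intro inseparable)
    then have "P (c 1)"
    proof (induction rule: rtrancl_induct)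
      case (step v v')
      then have v: "v \<sim> x" "v \<noteq> c 1" "v \<sim> v'" "v' \<noteq> x" "\<And>p. p \<sim> v \<Longrightarrow> p = x \<or> p \<sim> x"
        by (auto simp: P_def edges_within_def)
      then have "v' \<sim> x" using adj_sym by blast
      moreover have "p = x \<or> p \<sim> x" if "p \<sim> v'" for p
        using outer[of v' v p] that v adj_sym calculation by blast
      ultimately show ?case using ne1[of v' v] v adj_sym by (auto simp: P_def)
    qed (rule Py)
    then show False by (simp add: P_def)
  qed
  obtain w where "w \<noteq> y" "w \<noteq> z" "(w \<sim> y) \<noteq> (w \<sim> z)" using twinless[OF xyz(2)] by blast
  then show False using key[of y z w] key[of z y w] xyz adj_sym by blast
qed

end

section \<open>Triangle-free atoms without long induced paths\<close>
context sgraph begin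

definition copy_of :: "vertex pair_pre_digraph \<Rightarrow> bool" where
  "copy_of F \<longleftrightarrow> (\<exists>f. bij_betw f (pverts F) U \<and>
     (\<forall>x\<in>pverts F. \<forall>y\<in>pverts F. f x \<sim> f y \<longleftrightarrow> (x, y) \<in> parcs F))"

lemma hole5I:
  assumes "a \<sim> b" "b \<sim> c" "c \<sim> d" "d \<sim> e" "e \<sim> a"
    "a \<nsim> c" "a \<nsim> d" "b \<nsim> d" "b \<nsim> e" "c \<nsim> e"
  shows "\<exists>h. hole 5 h"
proof -
  let ?xs = "[a, b, c, d, e]"
  have adj: "?xs ! i \<sim> ?xs ! j \<longleftrightarrow> j = Suc i \<or> i = 0 \<and> Suc j = length ?xs"
    if "i < j" "j < length ?xs" for i j
  proof -
    have "j \<in> {1, 2, 3, 4}" using that by auto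
    then show ?thesis using that assms adj_sym[OF assms(5)] by (auto simp: less_Suc_eq numeral_eq_Suc)
  qed
  show ?thesis by (rule hole_of_list[of ?xs, OF _ adj]) auto
qed

lemma hole7I:
  assumes "a \<sim> b" "b \<sim> c" "c \<sim> d" "d \<sim> e" "e \<sim> f" "f \<sim> g" "g \<sim> a"
    "a \<nsim> c" "a \<nsim> d" "a \<nsim> e" "a \<nsim> f" "b \<nsim> d" "b \<nsim> e" "b \<nsim> f" "b \<nsim> g"
    "c \<nsim> e" "c \<nsim> f" "c \<nsim> g" "d \<nsim> f" "d \<nsim> g" "e \<nsim> g"
  shows "\<exists>h. hole 7 h"
proof -
  let ?xs = "[a, b, c, d, e, f, g]"
  have adj: "?xs ! i \<sim> ?xs ! j \<longleftrightarrow> j = Suc i \<or> i = 0 \<and> Suc j = length ?xs"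
    if "i < j" "j < length ?xs" for i j
  proof -
    have "j \<in> {1, 2, 3, 4, 5, 6}" using that by auto
    then show ?thesis using that assms adj_sym[OF assms(7)] by (auto simp: less_Suc_eq numeral_eq_Suc)
  qed
  show ?thesis by (rule hole_of_list[of ?xs, OF _ adj]) auto
qed

end

locale thin_atom = atom +
  assumes no_triangle: "\<lbrakk>x \<sim> y; y \<sim> z; x \<sim> z\<rbrakk> \<Longrightarrow> False"
    and no_P7: "\<lbrakk>p1 \<sim> p2; p2 \<sim> p3; p3 \<sim> p4; p4 \<sim> p5; p5 \<sim> p6; p6 \<sim> p7;
      \<not> p1 \<sim> p3; \<not> p1 \<sim> p4; \<not> p1 \<sim> p5; \<not> p1 \<sim> p6; \<not> p1 \<sim> p7;
      \<not> p2 \<sim> p4; \<not> p2 \<sim> p5; \<not> p2 \<sim> p6; \<not> p2 \<sim> p7; \<not> p3 \<sim> p5; \<not> p3 \<sim> p6; \<not> p3 \<sim> p7;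
      \<not> p4 \<sim> p6; \<not> p4 \<sim> p7; \<not> p5 \<sim> p7\<rbrakk> \<Longrightarrow> False"
begin

lemma hole_length_le_7:
  assumes c: "hole n c" shows "n \<in> {5, 6, 7}"
proof (rule ccontr)
  assume "n \<notin> {5, 6, 7}"
  then have n: "8 \<le> n" using hole_length[OF c] by auto
  have nd: "\<not> n dvd k" if "k \<noteq> 0" "\<bar>k\<bar> < 8" for k
    using dvd_imp_le_int[of k n] that n by auto
  show False
    by (rule no_P7[of "c 0" "c 1" "c 2" "c 3" "c 4" "c 5" "c 6"])
      (simp_all add: hole_adj[OF c] nd del: dvd_minus_iff)
qed

text \<open>
  Outside vertices see only hole vertices at pairwise distance at least three.
\<close>
lemma off_hole:
  assumes c: "hole n c" and x: "x \<notin> range c" "x \<sim> c i"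
  shows "x \<nsim> c (i + 1)" "x \<nsim> c (i - 1)" "x \<nsim> c (i + 2)" "x \<nsim> c (i - 2)"
proof -
  show *: "x \<nsim> c (i + 1)" "x \<nsim> c (i - 1)"
    using no_triangle[OF x(2), of "c (i + 1)"] no_triangle[OF x(2), of "c (i - 1)"]
      hole_dist_1[OF c] by auto
  show "x \<nsim> c (i + 2)" using skip_on_hole[OF c x(2)] * x(1) by auto
  show "x \<nsim> c (i - 2)"
    using skip_on_hole[OF c, of x "i - 2"] * x by (auto simp: algebra_simps)
qed

lemma boundary_edge:
  assumes "x \<in> S" "S \<subseteq> U" "y \<in> U" "y \<notin> S"
  obtains s t where "s \<in> S" "t \<in> U" "t \<notin> S" "s \<sim> t"
proof -
  have "(x, y) \<in> (edges_within (U - {}))\<^sup>*"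
    using assms by (intro inseparable) (auto simp: cliq_def)
  then have "y \<in> S \<or> (\<exists>s\<in>S. \<exists>t\<in>U - S. s \<sim> t)"
    by (induction rule: rtrancl_induct) (use assms in \<open>auto simp: edges_within_def\<close>)
  then show thesis using that assms(4) by blast
qed

lemma another_neighbour:
  assumes "a \<sim> b" "z \<in> U" "z \<noteq> a" "z \<noteq> b"
  obtains b' where "a \<sim> b'" "b' \<noteq> b"
proof -
  have "b \<in> U" "a \<in> U" "a \<noteq> b" using assms(1) adj_in adj_sym adj_irrefl by blast+
  then have "(a, z) \<in> (edges_within (U - {b}))\<^sup>*"
    using assms by (intro inseparable) (auto simp: cliq_def)
  then show thesis using assms(3) that by (cases rule: converse_rtranclE) (auto simp: edges_within_def)
qed

end

section \<open>The case of a pentagon without heptagons\<close>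
locale pentagon = thin_atom +
  fixes c :: "int \<Rightarrow> 'a"
  assumes hole5: "hole 5 c" and no_hole7: "\<not> hole 7 h"
begin

lemmas hole5_simps [simp] = hole_adj[OF hole5] hole_eq[OF hole5] hole_in[OF hole5]

text \<open>
  \<open>c i\<close> is the only neighbour of \<open>a\<close> on the pentagon, the foot of \<open>a\<close>.
\<close>
definition At :: "int \<Rightarrow> 'a \<Rightarrow> bool" where
  "At i a \<longleftrightarrow> (\<forall>j. a \<sim> c j \<longleftrightarrow> 5 dvd j - i)"

lemma AtD: assumes "At i a" shows "a \<sim> c j \<longleftrightarrow> 5 dvd j - i" "c j \<sim> a \<longleftrightarrow> 5 dvd j - i"
  using assms adj_commute unfolding At_def by blast+

lemma At_in: "At i a \<Longrightarrow> a \<in> U"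
  by (metis AtD(1) adj_in diff_self dvd_0_right)

lemma At_cong: assumes "5 dvd i - j" shows "At i a \<longleftrightarrow> At j a"
proof -
  have "5 dvd k - i \<longleftrightarrow> 5 dvd k - j" for k using assms by presburger
  then show ?thesis by (simp add: At_def)
qed

lemma residues5: "5 dvd j - i \<or> 5 dvd j - (i + 1) \<or> 5 dvd j - (i - 1) \<or> 5 dvd j - (i + 2) \<or> 5 dvd j - (i - 2)"
  for i j :: int
  by presburger

lemma attached: assumes "x \<notin> range c" "x \<sim> c i" shows "At i x"
  unfolding At_def
proof
  fix j
  show "x \<sim> c j \<longleftrightarrow> 5 dvd j - i"
    using residues5[of j i] off_hole[OF hole5 assms] assms(2)
    by (metis hole5_simps(2))
qed

lemma At_not_on: assumes "At i a" shows "a \<noteq> c j"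
proof
  assume "a = c j"
  then have "5 dvd (j + 1) - i" "5 dvd (j - 1) - i" using AtD(1)[OF assms, of "j + 1"] AtD(1)[OF assms, of "j - 1"] by simp_all
  then show False by presburger
qed

text \<open>
  Feet at distance zero or one would give a triangle or a 4-cycle.
\<close>
lemma At_At:
  assumes "At i a" "At j b" "a \<sim> b" shows "5 dvd j - (i + 2) \<or> 5 dvd j - (i - 2)"
proof (rule ccontr)
  assume "\<not> ?thesis"
  then consider "5 dvd j - i" | "5 dvd j - (i + 1)" | "5 dvd j - (i - 1)" using residues5[of j i] by blast
  then show False
  proof cases
    case 1
    then show False using no_triangle[of a b "c i"] assms AtD
      by (metis At_cong diff_self dvd_0_right)
  next
    case 2
    then have "At (i + 1) b" using At_cong assms by blast
    then show False using no_C4[of a b "c (i + 1)" "c i"] assms(1,3) 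
      by (simp add: AtD At_not_on)
  next
    case 3
    then have "At (i - 1) b" using At_cong assms by blast
    then show False using no_C4[of a b "c (i - 1)" "c i"] assms(1,3) 
      by (simp add: AtD At_not_on)
  qed
qed

lemma At_unique:
  assumes "At j b" "At j b'" "a \<sim> b" "a \<sim> b'" "At i a" shows "b = b'"
proof (rule ccontr)
  assume "b \<noteq> b'"
  moreover have "b \<nsim> b'" using At_At[OF assms(1,2)] by auto
  moreover have "a \<nsim> c j" using no_triangle[of a b "c j"] assms AtD by auto
  ultimately show False
    using no_C4[of a b "c j" b'] assms by (simp add: AtD At_not_on adj_commute[of _ a])
qed

text \<open>
  Otherwise some vertex \<open>w\<close> off the pentagon misses it but sees an attached vertex \<open>a\<close>. Since \<open>a\<close> is
  not a cut vertex, \<open>w\<close> has a second neighbour \<open>b\<close>. If \<open>b\<close> is attached, the feet of \<open>a\<close> and \<open>b\<close>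
  decide which of the forbidden configurations appears: a 4-cycle, a \<open>P\<^sub>7\<close> around the pentagon, or a
  heptagon. If \<open>b\<close> is not attached, there is a \<open>P\<^sub>7\<close>.
\<close>
lemma all_attached: assumes "x \<in> U" "x \<notin> range c" obtains i where "At i x"
proof (rule ccontr)
  define W where "W = {w \<in> U. w \<notin> range c \<and> (\<forall>i. w \<nsim> c i)}"
  assume "\<not> thesis"
  then have "x \<in> W" using attached assms that by (auto simp: W_def)
  moreover have "c 0 \<in> U" "c 0 \<notin> W" by (auto simp: W_def)
  ultimately obtain w a where wa: "w \<in> W" "a \<in> U" "a \<notin> W" "w \<sim> a"
    using boundary_edge[of x W "c 0"] by (auto simp: W_def)
  have w: "w \<nsim> c i" "c i \<nsim> w" "w \<noteq> c i" for i using wa adj_sym by (auto simp: W_def)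
  obtain i where i: "At i a"
    using wa attached[of a] w unfolding W_def by blast
  obtain b where b: "w \<sim> b" "b \<noteq> a"
    using another_neighbour[OF wa(4), of "c 0"] w At_not_on[OF i] by auto metis
  have ab: "a \<nsim> b" "b \<nsim> a" using no_triangle wa(4) b(1) adj_sym by blast+
  have s: "b \<sim> w" "w \<sim> a" "a \<sim> w" using wa(4) b(1) adj_sym by auto
  show False
  proof (cases "b \<in> W")
    case True
    then have "b \<nsim> c i" for i by (auto simp: W_def)
    then show False
      using no_P7[of b w a "c i" "c (i + 1)" "c (i + 2)" "c (i + 3)"] i w ab s by (simp add: AtD)
  next
    case False
    then obtain j where j: "At j b" using attached[of b] w b adj_in2[OF b(1)] unfolding W_def by blast
    consider "At i b" | "At (i + 1) b" | "At (i - 1) b" | "At (i + 2) b" | "At (i - 2) b"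
      using residues5[of j i] j At_cong by blast
    then show False
    proof cases
      case 1
      then show ?thesis using no_C4[of w a "c i" b] i w b ab s by (simp add: AtD)
    next
      case 2
      then show ?thesis
        using no_P7[of b w a "c i" "c (i - 1)" "c (i - 2)" "c (i - 3)"] i w ab s by (simp add: AtD)
    next
      case 3
      then show ?thesis
        using no_P7[of b w a "c i" "c (i + 1)" "c (i + 2)" "c (i + 3)"] i w ab s by (simp add: AtD)
    next
      case 4
      then show ?thesis
        using hole7I[of w a "c i" "c (i - 1)" "c (i - 2)" "c (i - 3)" b] i w ab s no_hole7 by (simp add: AtD)
    next
      case 5
      then show ?thesis
        using hole7I[of w a "c i" "c (i + 1)" "c (i + 2)" "c (i + 3)" b] i w ab s no_hole7 by (simp add: AtD)
    qed
  qed
qed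

text \<open>
  The edges that avoid the pentagon, sorted by the middle vertex of the path of length two between
  their feet. Each of them completes the pentagon to one ear of length three.
\<close>
definition Ear :: "int \<Rightarrow> 'a \<Rightarrow> 'a \<Rightarrow> bool" where
  "Ear m a b \<longleftrightarrow> At (m - 1) a \<and> At (m + 1) b \<and> a \<sim> b"

lemma Ear_cong: assumes "5 dvd i - j" shows "Ear i = Ear j"
proof -
  have "At (i - 1) = At (j - 1)" "At (i + 1) = At (j + 1)" 
    using At_cong[of "i - 1" "j - 1"] At_cong[of "i + 1" "j + 1"] assms by (auto intro!: ext)
  then show ?thesis by (intro ext) (simp add: Ear_def)
qed

text \<open>
  The foot of \<open>a\<close> is not a cut vertex, so \<open>a\<close> has another neighbour.
\<close>
lemma in_Ear: assumes "At i a" obtains b where "Ear (i + 1) a b" | b where "Ear (i - 1) b a"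
proof -
  have "a \<sim> c i" using assms by (simp add: AtD)
  moreover have "c (i + 1) \<noteq> a" "c (i + 1) \<noteq> c i" using At_not_on[OF assms] by auto
  ultimately obtain b where b: "a \<sim> b" "b \<noteq> c i"
    using another_neighbour[of a "c i" "c (i + 1)"] by auto
  have "b \<noteq> c k" for k
  proof
    assume "b = c k"
    then have "5 dvd k - i" using b assms by (simp add: AtD)
    then show False using b \<open>b = c k\<close> by simp
  qed
  then obtain j where j: "At j b" using all_attached[of b] adj_in2[OF b(1)] by blast
  then have "At (i + 2) b \<or> At (i - 2) b" using At_At[OF assms j b(1)] At_cong by blast
  then show thesis using that assms b adj_sym by (auto simp: Ear_def add.commute)
qed

text \<open>
  Without the edge from \<open>a\<close> to \<open>b'\<close>, the path \<open>b, a, c (m - 1), c m, a', b', c (m + 2)\<close> is induced.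
\<close>
lemma consecutive_ears:
  assumes "Ear m a b" "Ear (m + 1) a' b'" shows "Ear (m + 3) b' a"
proof -
  have At: "At (m - 1) a" "At (m + 1) b" "At m a'" "At (m + 2) b'" using assms by (auto simp: Ear_def add.commute)
  have e: "a \<sim> b" "a' \<sim> b'" "b \<sim> a" using assms adj_sym by (auto simp: Ear_def)
  have n: "b \<nsim> a'" "a \<nsim> a'" "b \<nsim> b'" using At_At[of _ b _ a'] At_At[of _ a _ a'] At_At[of _ b _ b'] At by fastforce+
  have "a \<sim> b'"
  proof (rule ccontr)
    assume "a \<nsim> b'"
    then show False
      using no_P7[of b a "c (m - 1)" "c m" a' b' "c (m + 2)"] At e n by (simp add: AtD)
  qed
  moreover have "At (m + 4) a" using At(1) At_cong[of "m - 1" "m + 4"] by simp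
  ultimately show ?thesis using At adj_sym by (simp add: Ear_def add.commute)
qed

text \<open>
  Otherwise \<open>a, b, c (m + 1), b', d, c (m + 3), c (m + 4)\<close> is a heptagon.
\<close>
lemma ears_share:
  assumes "Ear m a b" "Ear (m + 2) b' d" shows "b = b'"
proof (rule ccontr)
  assume "b \<noteq> b'"
  have At: "At (m - 1) a" "At (m + 1) b" "At (m + 1) b'" "At (m + 3) d" using assms by (auto simp: Ear_def add.commute)
  have e: "a \<sim> b" "b \<sim> a" "b' \<sim> d" using assms adj_sym by (auto simp: Ear_def)
  have "a \<nsim> b'" "b \<nsim> d" using At_unique[of _ b b' a] At_unique[of _ b b' d] At e \<open>b \<noteq> b'\<close> adj_sym by blast+
  moreover have "a \<nsim> d" "b \<nsim> b'" using At_At[of _ a _ d] At_At[of _ b _ b'] At by fastforce+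
  ultimately show False
    using hole7I[of a b "c (m + 1)" b' d "c (m + 3)" "c (m + 4)"] At e no_hole7 by (simp add: AtD)
qed

end

context sgraph begin

lemma copy_ofI:
  assumes "f ` pverts F = U" "inj_on f (pverts F)"
    and "\<forall>x\<in>pverts F. \<forall>y\<in>pverts F. f x \<sim> f y \<longleftrightarrow> (x, y) \<in> parcs F"
  shows "copy_of F"
  using assms by (auto simp: copy_of_def bij_betw_def)

text \<open>
  Supplies the parameter \<open>t\<close> and the vertices \<open>y\<^sub>j\<close> and \<open>z\<^sub>j\<close> of the two infinite
  subfamilies.
\<close>
lemma enumerate_matching:
  assumes M: "M \<subseteq> U" "M \<noteq> {}"
    and ex: "\<And>a. a \<in> M \<Longrightarrow> \<exists>b\<in>N. a \<sim> b"
      "\<And>b. b \<in> N \<Longrightarrow> \<exists>a\<in>M. a \<sim> b"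
    and unique: "\<And>a b b'. \<lbrakk>a \<in> M; b \<in> N; b' \<in> N; a \<sim> b; a \<sim> b'\<rbrakk> \<Longrightarrow> b = b'"
      "\<And>a a' b. \<lbrakk>a \<in> M; a' \<in> M; b \<in> N; a \<sim> b; a' \<sim> b\<rbrakk> \<Longrightarrow> a = a'"
  obtains t y z where "1 \<le> t" "y ` {1..t::nat} = M" "z ` {1..t} = N"
    "\<forall>i\<in>{1..t}. \<forall>j\<in>{1..t}. y i \<sim> z j \<longleftrightarrow> i = j"
    "inj_on y {1..t}" "inj_on z {1..t}"
proof -
  have fin: "finite M" using M finite_U finite_subset by blast
  obtain y where y: "bij_betw y {1..card M} M" using ex_bij_betw_nat_finite_1[OF fin] by blast
  have inj_y: "inj_on y {1..card M}" and im_y: "y ` {1..card M} = M"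
    using y unfolding bij_betw_def by blast+
  have "\<forall>a\<in>M. \<exists>b. b \<in> N \<and> a \<sim> b" using ex(1) by blast
  then obtain g where g: "\<And>a. a \<in> M \<Longrightarrow> g a \<in> N \<and> a \<sim> g a" by metis
  define z where "z i = g (y i)" for i
  have yA: "y i \<in> M" if "i \<in> {1..card M}" for i using im_y that by (metis imageI)
  have yz: "y i \<sim> z j \<longleftrightarrow> i = j" if "i \<in> {1..card M}" "j \<in> {1..card M}" for i j
    using g[OF yA[OF that(2)]] g[OF yA[OF that(1)]] unique(2)[of "y i" "y j" "z j"]
      yA that inj_onD[OF inj_y, of i j] unfolding z_def by blast
  show thesis
  proof (rule that[of "card M" y z])
    show "1 \<le> card M" using M(2) fin by (simp add: Suc_le_eq card_gt_0_iff)
    show "z ` {1..card M} = N"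
    proof
      show "N \<subseteq> z ` {1..card M}"
      proof
        fix b assume b: "b \<in> N"
        then obtain a where a: "a \<in> M" "a \<sim> b" using ex(2) by blast
        then obtain i where "i \<in> {1..card M}" "y i = a" using im_y by (metis imageE)
        then show "b \<in> z ` {1..card M}" using unique(1)[of a b "g a"] a b g by (auto simp: z_def)
      qed
    qed (use g yA in \<open>auto simp: z_def\<close>)
    show "inj_on z {1..card M}"
      using yz by (metis inj_onI)
  qed (use inj_y im_y yz in auto)
qed

end

text \<open>
  A map from the named vertices, given by one function for each kind of name.
\<close>
definition place :: "(nat \<Rightarrow> 'a) \<Rightarrow> (nat \<Rightarrow> 'a) \<Rightarrow> (nat \<Rightarrow> 'a) \<Rightarrow> (nat \<Rightarrow> 'a) \<Rightarrow> vertex \<Rightarrow> 'a" where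
  "place x a y z v = (case v of V i \<Rightarrow> x i | A i \<Rightarrow> a i | Y i \<Rightarrow> y i | Z i \<Rightarrow> z i)"

lemma place_simps [simp]:
  "place x a y z (V i) = x i" "place x a y z (A i) = a i"
  "place x a y z (Y i) = y i" "place x a y z (Z i) = z i"
  by (simp_all add: place_def)

lemma pverts_graph_of [simp]: "pverts (graph_of S E) = S"
  by (simp add: graph_of_def)

lemma parcs_graph_of [simp]: "(x, y) \<in> parcs (graph_of S E) \<longleftrightarrow> (x, y) \<in> E \<or> (y, x) \<in> E"
  by (simp add: graph_of_def)

lemma interval_sets:
  "{1..<5::nat} = {1, 2, 3, 4}" "{1..<6::nat} = {1, 2, 3, 4, 5}" "{1..<7::nat} = {1, 2, 3, 4, 5, 6}"
  "{1..5::nat} = {1, 2, 3, 4, 5}" "{1..6::nat} = {1, 2, 3, 4, 5, 6}"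
  by auto

text \<open>
  Stated with \<open>Suc 0\<close>, the form to which the simplifier rewrites the lower bound 1.
\<close>
lemma V_intervals:
  "V ` {Suc 0..5} = {V 1, V 2, V 3, V 4, V 5}"
  "V ` {Suc 0..6} = {V 1, V 2, V 3, V 4, V 5, V 6}"
  "A ` {Suc 0..5} = {A 1, A 2, A 3, A 4, A 5}"
  "(\<lambda>i. (A i, V i)) ` {Suc 0..5} = {(A 1, V 1), (A 2, V 2), (A 3, V 3), (A 4, V 4), (A 5, V 5)}"
  unfolding One_nat_def[symmetric] interval_sets by simp_all

lemma small_cycle_edges:
  "cycle_edges 5 = {(V 5, V 1), (V 1, V 2), (V 2, V 3), (V 3, V 4), (V 4, V 5)}"
  "cycle_edges 6 = {(V 6, V 1), (V 1, V 2), (V 2, V 3), (V 3, V 4), (V 4, V 5), (V 5, V 6)}"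
  "cycle_edges 7 = {(V 7, V 1), (V 1, V 2), (V 2, V 3), (V 3, V 4), (V 4, V 5), (V 5, V 6), (V 6, V 7)}"
  unfolding cycle_edges_def path_edges_def interval_sets by (simp_all add: numeral_eq_Suc)

lemmas V_intervals_1 = V_intervals[folded One_nat_def]

lemmas F_unfold = cycle_graph_def V_intervals small_cycle_edges

lemma F2_arcs:
  "(V i, V j) \<in> parcs (F2 t) \<longleftrightarrow> (V i, V j) \<in> parcs F1"
  "(V i, Y j) \<in> parcs (F2 t) \<longleftrightarrow> i = 1 \<and> j \<in> {1..t}" "(Y j, V i) \<in> parcs (F2 t) \<longleftrightarrow> i = 1 \<and> j \<in> {1..t}"
  "(V i, Z j) \<in> parcs (F2 t) \<longleftrightarrow> i = 3 \<and> j \<in> {1..t}" "(Z j, V i) \<in> parcs (F2 t) \<longleftrightarrow> i = 3 \<and> j \<in> {1..t}"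
  "(Y i, Z j) \<in> parcs (F2 t) \<longleftrightarrow> i = j \<and> j \<in> {1..t}" "(Z j, Y i) \<in> parcs (F2 t) \<longleftrightarrow> i = j \<and> j \<in> {1..t}"
  "(Y i, Y j) \<notin> parcs (F2 t)" "(Z i, Z j) \<notin> parcs (F2 t)"
  unfolding F2_def F1_def cycle_graph_def parcs_graph_of small_cycle_edges by auto

lemma F2_verts: "pverts (F2 t) = V ` {1..5} \<union> Y ` {1..t} \<union> Z ` {1..t}"
  by (simp add: F2_def)

context pentagon begin

lemma hole_is_F1: "\<forall>i\<in>{1..5}. \<forall>j\<in>{1..5}. c (k + int i) \<sim> c (k + int j) \<longleftrightarrow> (V i, V j) \<in> parcs F1"
  by (simp add: interval_sets F1_def F_unfold del: One_nat_def)

lemma At_inj: "At i a \<Longrightarrow> At j a \<Longrightarrow> 5 dvd i - j"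
  using AtD(1)[of i a i] AtD(1)[of j a i] by simp

lemma range_pentagon: "range c = {c (k + 1), c (k + 2), c (k + 3), c (k + 4), c (k + 5)}"
proof -
  have "c j \<in> {c (k + 1), c (k + 2), c (k + 3), c (k + 4), c (k + 5)}" for j
    using residues5[of j k] by (simp add: dvd_diff_commute) presburger
  then show ?thesis by blast
qed

lemma Ear_At: "Ear m a b \<Longrightarrow> 5 dvd m - k \<Longrightarrow> At (k - 1) a \<and> At (k + 1) b"
  using Ear_cong[of m k] by (simp add: Ear_def)

text \<open>
  Two ears in the same position leave no room for ears in any other position. An ear in a consecutive
  position would have an end joined to both of them, although the edges between attached vertices with
  given feet form a matching; an ear at distance two would share one
  vertex with both of them, although these are disjoint.
\<close>
lemma parallel_ears:
  assumes "Ear m a b" "Ear m a' b'" "a \<noteq> a'" "Ear k p q" shows "5 dvd k - m"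
proof (rule ccontr)
  assume "\<not> 5 dvd k - m"
  then consider "5 dvd k - (m + 1)" | "5 dvd (k + 1) - m" | "5 dvd k - (m + 2)" | "5 dvd (k + 2) - m"
    using residues5[of k m] by (auto simp: algebra_simps)
  then show False
  proof cases
    case 1
    then have pq: "Ear (m + 1) p q" using Ear_cong[of k "m + 1"] assms(4) by simp
    then have "q \<sim> a" "q \<sim> a'" "At (m - 1) a" "At (m - 1) a'" "At (m + 2) q"
      using consecutive_ears[OF assms(1) pq] consecutive_ears[OF assms(2) pq] assms(1,2)
      by (auto simp: Ear_def add.commute)
    then show False using At_unique assms(3) by blast
  next
    case 2
    then have m: "Ear (k + 1) a b" "Ear (k + 1) a' b'"
      using Ear_cong[of "k + 1" m] assms(1,2) by simp_all
    then have "b \<sim> p" "b' \<sim> p"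
      using consecutive_ears[OF assms(4) m(1)] consecutive_ears[OF assms(4) m(2)]
      by (simp_all add: Ear_def)
    moreover have At: "At (k + 2) b" "At (k + 2) b'" "At (k - 1) p"
      "At k a" "At k a'" "a \<sim> b" "a' \<sim> b'"
      using m assms(4) by (auto simp: Ear_def add.commute)
    ultimately have "b = b'" using At_unique[of "k + 2" b b' p "k - 1"] adj_sym by blast
    then show False using At_unique[of k a a' b "k + 2"] At adj_sym assms(3) by blast
  next
    case 3
    then have "Ear (m + 2) p q" using Ear_cong[of k "m + 2"] assms(4) by simp
    then have "b = p" "b' = p" using ears_share assms by blast+
    then show False using assms At_unique[of "m - 1" a a' b "m + 1"] adj_sym by (auto simp: Ear_def)
  next
    case 4
    then have "Ear (k + 2) a b" "Ear (k + 2) a' b'"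
      using Ear_cong[of "k + 2" m] assms(1,2) by simp_all
    then have "q = a" "q = a'" using ears_share assms by blast+
    then show False using assms(3) by simp
  qed
qed

lemma At_single:
  assumes two: "Ear m a b" "Ear k p q" "\<not> 5 dvd k - m" and x: "At i x" "At i x'"
  shows "x = x'"
proof (rule ccontr)
  assume ne: "x \<noteq> x'"
  have no_par: "d = d'" if "Ear l d e" "Ear l d' e'" for l d e d' e'
  proof (rule ccontr)
    assume "d \<noteq> d'"
    then have "5 dvd m - l" "5 dvd k - l" using parallel_ears that two by blast+
    then show False using two(3) by presburger
  qed
  consider b b' where "Ear (i + 1) x b" "Ear (i + 1) x' b'"
    | b b' where "Ear (i - 1) b x" "Ear (i - 1) b' x'"
    | b b' where "Ear (i + 1) x b" "Ear (i - 1) b' x'"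
    | b b' where "Ear (i - 1) b x" "Ear (i + 1) x' b'"
    using in_Ear[OF x(1)] in_Ear[OF x(2)] by metis
  then show False
  proof cases
    case 1
    then show ?thesis using no_par ne by blast
  next
    case 2
    then have "b = b'" using no_par by blast
    then show ?thesis using 2 At_unique[of i x x' b "i - 2"] ne by (auto simp: Ear_def)
  next
    case 3
    then show ?thesis using ears_share[of "i - 1" b' x' x b] ne by (simp add: add.commute)
  next
    case 4
    then show ?thesis using ears_share[of "i - 1" b x x' b'] ne by (simp add: add.commute)
  qed
qed

lemma copy_F1: assumes "\<And>i a. \<not> At i a" shows "copy_of F1"
proof -
  have "x \<in> range c" if "x \<in> U" for x using all_attached[OF that] assms by blast
  then have U: "U = range c" by auto
  show ?thesis
    by (rule copy_ofI[where f = "place (\<lambda>i. c (int i)) undefined undefined undefined"])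
      (simp_all add: U F1_def F_unfold range_pentagon[of 0])
qed

text \<open>
  All ears are in one position, so the graph consists of paths of length three, and one of length two,
  between the same two ends.
\<close>
lemma copy_F2:
  assumes ear: "Ear m a b" and only: "\<And>k p q. Ear k p q \<Longrightarrow> 5 dvd k - m"
  shows "\<exists>t\<ge>1. copy_of (F2 t)"
proof -
  define k where "k = m - 2"
  let ?A = "{a. At (k + 1) a}" and ?B = "{b. At (k + 3) b}"
  have Ear_k: "Ear m p q \<longleftrightarrow> At (k + 1) p \<and> At (k + 3) q \<and> p \<sim> q" for p q
    by (simp add: Ear_def k_def add.commute)
  have "?A \<subseteq> U" "?A \<noteq> {}" using At_in ear Ear_k by auto
  moreover have "\<exists>b\<in>?B. a \<sim> b" if "a \<in> ?A" for a
  proof -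
    have a: "At (m - 1) a" using that by (simp add: k_def)
    show ?thesis using in_Ear[OF a]
    proof cases
      case (2 b)
      then have "5 dvd (m - 2) - m" using only by fastforce
      then show ?thesis by simp
    qed (auto simp: Ear_k)
  qed
  moreover have "\<exists>a\<in>?A. a \<sim> b" if "b \<in> ?B" for b
  proof -
    have b: "At (m + 1) b" using that by (simp add: k_def add.commute)
    show ?thesis using in_Ear[OF b]
    proof cases
      case (1 a)
      then have "5 dvd (m + 2) - m" using only by fastforce
      then show ?thesis by simp
    qed (auto simp: Ear_k)
  qed
  moreover have "b = b'" if "a \<in> ?A" "b \<in> ?B" "b' \<in> ?B" "a \<sim> b" "a \<sim> b'" for a b b'
    using that At_unique by blast
  moreover have "a = a'" if "a \<in> ?A" "a' \<in> ?A" "b \<in> ?B" "a \<sim> b" "a' \<sim> b" for a a' b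
    using that At_unique[of _ a a' b] adj_sym by blast
  ultimately obtain t y z where t: "1 \<le> t" and yA: "y ` {1..t::nat} = ?A" and zB: "z ` {1..t} = ?B"
    and yz: "\<forall>i\<in>{1..t}. \<forall>j\<in>{1..t}. y i \<sim> z j \<longleftrightarrow> i = j"
    and inj: "inj_on y {1..t}" "inj_on z {1..t}"
    by (rule enumerate_matching[of ?A ?B]) blast
  have y: "At (k + 1) (y i)" and z: "At (k + 3) (z i)" if "i \<in> {1..t}" for i
    using imageI[OF that, of y] imageI[OF that, of z] unfolding yA zB by simp_all
  have cover: "x \<in> range c \<or> x \<in> y ` {1..t} \<or> x \<in> z ` {1..t}" if "x \<in> U" for x
  proof (cases "x \<in> range c")
    case False
    then obtain i where i: "At i x" using all_attached[OF \<open>x \<in> U\<close>] by blast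
    show ?thesis using in_Ear[OF i]
    proof cases
      case (1 b)
      then have "Ear m x b" using only[OF 1] Ear_cong[of "i + 1" m] by simp
      then have "x \<in> y ` {1..t}" unfolding yA using Ear_k by simp
      then show ?thesis by simp
    next
      case (2 b)
      then have "Ear m b x" using only[OF 2] Ear_cong[of "i - 1" m] by simp
      then have "x \<in> z ` {1..t}" unfolding zB using Ear_k by simp
      then show ?thesis by simp
    qed
  qed simp
  have nonadj: "y i \<nsim> y j" "z i \<nsim> z j" if "i \<in> {1..t}" "j \<in> {1..t}" for i j
    using At_At[OF y y] At_At[OF z z] that by fastforce+
  have ne: "y i \<noteq> z j" "z j \<noteq> y i" if "i \<in> {1..t}" "j \<in> {1..t}" for i j
    using At_inj[of "k + 1" "y i" "k + 3"] y[OF that(1)] z[OF that(2)] by auto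
  have "copy_of (F2 t)"
  proof (rule copy_ofI[where f = "place (\<lambda>i. c (k + int i)) undefined y z"])
    have U: "U = range c \<union> y ` {1..t} \<union> z ` {1..t}"
      using cover At_in[OF y] At_in[OF z] by auto
    show "place (\<lambda>i. c (k + int i)) undefined y z ` pverts (F2 t) = U"
      unfolding U range_pentagon[of k]
      by (simp add: F2_def F_unfold V_intervals_1 image_Un image_image del: One_nat_def)
    show "inj_on (place (\<lambda>i. c (k + int i)) undefined y z) (pverts (F2 t))"
      by (simp add: inj_on_eq_iff[OF inj(1)] inj_on_eq_iff[OF inj(2)] F2_def F_unfold V_intervals_1
          inj_on_def ball_Un ne At_not_on[OF y] At_not_on[OF z] At_not_on[OF y, symmetric] At_not_on[OF z, symmetric] del: One_nat_def)
    have zy: "z i \<sim> y j \<longleftrightarrow> i = j" if "i \<in> {1..t}" "j \<in> {1..t}" for i j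
      using yz[rule_format, OF that(2,1)] adj_commute[of "z i" "y j"] by auto
    have feet: "y j \<sim> c (k + int i) \<longleftrightarrow> i = 1" "z j \<sim> c (k + int i) \<longleftrightarrow> i = 3"
      if "i \<in> {1..5}" "j \<in> {1..t}" for i j
    proof -
      have "i = 1 \<or> i = 2 \<or> i = 3 \<or> i = 4 \<or> i = 5" using that(1) by auto
      then show "y j \<sim> c (k + int i) \<longleftrightarrow> i = 1" "z j \<sim> c (k + int i) \<longleftrightarrow> i = 3"
        by (elim disjE; simp add: AtD(1)[OF y[OF that(2)]] AtD(1)[OF z[OF that(2)]])+
    qed
    have feet': "c (k + int i) \<sim> y j \<longleftrightarrow> i = 1" "c (k + int i) \<sim> z j \<longleftrightarrow> i = 3"
      if "i \<in> {1..5}" "j \<in> {1..t}" for i j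
      using feet[OF that] adj_commute[of "c (k + int i)" "y j"] adj_commute[of "c (k + int i)" "z j"]
      by blast+
    show "\<forall>u\<in>pverts (F2 t). \<forall>v\<in>pverts (F2 t). place (\<lambda>i. c (k + int i)) undefined y z u
        \<sim> place (\<lambda>i. c (k + int i)) undefined y z v \<longleftrightarrow> (u, v) \<in> parcs (F2 t)"
      unfolding F2_verts ball_Un ball_simps
      by (simp add: F2_arcs feet feet' nonadj yz zy hole_is_F1[rule_format, of _ _ k] del: One_nat_def hole5_simps) auto
  qed
  then show ?thesis using t by blast
qed

lemma cover_by_ears:
  assumes "x \<in> U" "x \<notin> range c"
  obtains m p q where "Ear m p q" "x = p \<or> x = q"
  using all_attached[OF assms] in_Ear by metis

lemma copy_F3:
  assumes ears: "Ear k a4 a1" "Ear (k + 2) a1 a3"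
    and only: "\<And>m p q. Ear m p q \<Longrightarrow> 5 dvd m - k \<or> 5 dvd m - (k + 2)"
  shows "copy_of F3"
proof -
  have At: "At (k - 1) a4" "At (k + 1) a1" "At (k + 3) a3" and e: "a4 \<sim> a1" "a1 \<sim> a4" "a1 \<sim> a3" "a3 \<sim> a1"
    using ears adj_sym by (auto simp: Ear_def add.commute)
  have single: "x = x'" if "At i x" "At i x'" for i x x'
    using At_single[OF ears _ that] by simp
  have n: "a3 \<nsim> a4" "a4 \<nsim> a3" using At_At[OF At(3,1)] adj_sym by auto
  have ne: "a1 \<noteq> a3" "a3 \<noteq> a4" "a1 \<noteq> a4" using e At_inj[OF At(3), of "k - 1"] At(1) by auto
  note on = At[THEN AtD(1)] At[THEN AtD(2)] At[THEN At_not_on] At[THEN At_not_on, symmetric]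
  have cover: "x \<in> range c \<union> {a1, a3, a4}" if x: "x \<in> U" for x
  proof (cases "x \<in> range c")
    case False
    from x False obtain m p q where m: "Ear m p q" "x = p \<or> x = q" by (rule cover_by_ears)
    show ?thesis using only[OF m(1)]
    proof
      assume "5 dvd m - k"
      then show ?thesis using Ear_At[OF m(1)] m(2) single At by blast
    next
      assume "5 dvd m - (k + 2)"
      then have "At (k + 1) p \<and> At (k + 3) q" using Ear_At[OF m(1), of "k + 2"] by (simp add: add.commute)
      then show ?thesis using m(2) single At by blast
    qed
  qed simp
  have U: "U = range c \<union> {a1, a3, a4}" using cover At At_in by auto
  show ?thesis
    by (rule copy_ofI[where f = "place (\<lambda>i. c (k + int i))
        (\<lambda>i. if i = 1 then a1 else if i = 3 then a3 else a4) undefined undefined"])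
      (use e n ne in \<open>simp_all add: U F3_def F_unfold range_pentagon[of k] on insert_commute\<close>)
qed

lemma copy_F4:
  assumes ears: "Ear k a4 a1" "Ear (k + 2) a1 a3" "Ear (k + 4) a3 a5"
    and only: "\<And>m p q. Ear m p q \<Longrightarrow> 5 dvd m - k \<or> 5 dvd m - (k + 2) \<or> 5 dvd m - (k + 4)"
  shows "copy_of F4"
proof -
  have At: "At (k - 1) a4" "At (k + 1) a1" "At (k + 3) a3" "At (k + 5) a5"
    and e: "a4 \<sim> a1" "a1 \<sim> a4" "a1 \<sim> a3" "a3 \<sim> a1" "a3 \<sim> a5" "a5 \<sim> a3"
    using ears adj_sym by (auto simp: Ear_def add.commute)
  have single: "x = x'" if "At i x" "At i x'" for i x x'
    using At_single[OF ears(1,2) _ that] by simp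
  have n: "a3 \<nsim> a4" "a4 \<nsim> a3" "a4 \<nsim> a5" "a5 \<nsim> a4" "a1 \<nsim> a5" "a5 \<nsim> a1"
    using At_At[OF At(3,1)] At_At[OF At(1,4)] At_At[OF At(2,4)] adj_sym by auto
  have ne: "a1 \<noteq> a3" "a3 \<noteq> a4" "a1 \<noteq> a4" "a1 \<noteq> a5" "a3 \<noteq> a5" "a4 \<noteq> a5" using e n by auto
  note on = At[THEN AtD(1)] At[THEN AtD(2)] At[THEN At_not_on] At[THEN At_not_on, symmetric]
  have cover: "x \<in> range c \<union> {a1, a3, a4, a5}" if x: "x \<in> U" for x
  proof (cases "x \<in> range c")
    case False
    from x False obtain m p q where m: "Ear m p q" "x = p \<or> x = q" by (rule cover_by_ears)
    show ?thesis using only[OF m(1)]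
    proof (elim disjE)
      assume "5 dvd m - k"
      then show ?thesis using Ear_At[OF m(1)] m(2) single At by blast
    next
      assume "5 dvd m - (k + 2)"
      then have "At (k + 1) p \<and> At (k + 3) q" using Ear_At[OF m(1), of "k + 2"] by (simp add: add.commute)
      then show ?thesis using m(2) single At by blast
    next
      assume "5 dvd m - (k + 4)"
      then have "At (k + 3) p \<and> At (k + 5) q" using Ear_At[OF m(1), of "k + 4"] by (simp add: add.commute)
      then show ?thesis using m(2) single At by blast
    qed
  qed simp
  have U: "U = range c \<union> {a1, a3, a4, a5}" using cover At At_in by auto
  show ?thesis
    by (rule copy_ofI[where f = "place (\<lambda>i. c (k + int i))
        (\<lambda>i. if i = 1 then a1 else if i = 3 then a3 else if i = 4 then a4 else a5) undefined undefined"])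
      (use e n ne in \<open>simp_all add: U F4_def F_unfold range_pentagon[of k] on insert_commute\<close>)
qed

lemma copy_F5:
  assumes all: "\<And>m. \<exists>a b. Ear m a b"
  shows "copy_of F5"
proof -
  obtain p q p' q' where "Ear 0 p q" "Ear 1 p' q'" using all by metis
  then have single: "x = x'" if "At i x" "At i x'" for i x x'
    using At_single[of 0 p q 1 p' q'] that by auto
  have "\<exists>x. At i x" for i using all[of "i + 1"] by (auto simp: Ear_def)
  then obtain a where a: "\<And>i. At i (a i)" by metis
  have cong: "a l = a l'" if "5 dvd l - l'" for l l'
    using single[OF a[of l], of "a l'"] a[of l'] At_cong[OF that] by blast
  have adj_a: "a i \<sim> a j \<longleftrightarrow> 5 dvd j - (i + 2) \<or> 5 dvd j - (i - 2)" for i j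
  proof
    have step: "a l \<sim> a (l + 2)" for l
      using all[of "l + 1"] single[OF a] by (fastforce simp: Ear_def add.commute)
    show "a i \<sim> a j" if "5 dvd j - (i + 2) \<or> 5 dvd j - (i - 2)"
      using that cong[of j "i + 2"] cong[of j "i - 2"] step[of i] step[of "i - 2"] adj_sym by auto
  qed (use At_At a in blast)
  have eq_a: "a i = a j \<longleftrightarrow> 5 dvd j - i" for i j
    using cong[of j i] At_inj[OF a[of j], of i] a[of i] by metis
  have cover: "x \<in> range c \<union> a ` {1..5}" if x: "x \<in> U" for x
  proof (cases "x \<in> range c")
    case False
    then obtain i where i: "At i x" using all_attached[OF x] by blast
    have "5 dvd i - ((i - 1) mod 5 + 1)"
      using dvd_minus_mod[of 5 "i - 1"] by (simp add: algebra_simps)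
    then have "x = a ((i - 1) mod 5 + 1)" using single[OF i] a At_cong by blast
    moreover have "(i - 1) mod 5 + 1 \<in> {1..5}" by auto
    ultimately show ?thesis by blast
  qed simp
  have five: "{1..5::int} = {1, 2, 3, 4, 5}" by auto
  have "x \<in> range c \<union> {a 1, a 2, a 3, a 4, a 5}" if "x \<in> U" for x
    using cover[OF that] unfolding five by simp
  then have U: "U = range c \<union> {a 1, a 2, a 3, a 4, a 5}" using At_in[OF a] by auto
  show ?thesis
    by (rule copy_ofI[where f = "place (\<lambda>i. c (int i)) (\<lambda>i. a (int i)) undefined undefined"])
      (simp_all add: U F5_def F_unfold range_pentagon[of 0] AtD[OF a] adj_a eq_a At_not_on[OF a]
        At_not_on[OF a, symmetric])
qed

text \<open>
  \<open>P m\<close> says that there is an ear in position \<open>m\<close>. Ears in positions \<open>i\<close> and \<open>i + 1\<close> imply one in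
  position \<open>i + 3\<close>. Up to rotation, the sets of occupied positions closed under this rule are the empty
  set, one position, two positions at distance two, \<open>{i, i + 1, i + 3}\<close>, and all five, which is the
  Petersen graph. With at least two positions, every vertex of the pentagon is the foot of at most one vertex.
\<close>
theorem pentagon_classification: "\<exists>F\<in>family_F. copy_of F"
proof -
  define P where "P m \<longleftrightarrow> (\<exists>a b. Ear m a b)" for m
  have P_cong: "P i = P j" if "5 dvd i - j" for i j
    using Ear_cong[OF that] by (simp add: P_def)
  have P_step: "P (i + 3)" if "P i" "P (i + 1)" for i
    using that consecutive_ears unfolding P_def by blast
  consider "\<And>m. \<not> P m"
    | m where "P m" "\<And>k. P k \<Longrightarrow> 5 dvd k - m"
    | m k where "P m" "P k" "\<not> 5 dvd k - m"
    by blast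
  then show ?thesis
  proof cases
    case 1
    have "\<not> At i a" for i a
      using 1 in_Ear[of i a] unfolding P_def by metis
    then show ?thesis using copy_F1 by (auto simp: family_F_def)
  next
    case 2
    then show ?thesis
      using copy_F2[of m] unfolding P_def family_F_def by blast
  next
    case 3
    show ?thesis
    proof (cases "\<exists>i. P i \<and> P (i + 1)")
      case True
      then obtain i where i: "P i" "P (i + 1)" by blast
      then have i3: "P (i + 3)" by (rule P_step)
      have i24: "P (i + 2)" if "P (i + 4)"
        using P_step[of "i + 4"] that i P_cong[of "i + 5" i] P_cong[of "i + 7" "i + 2"]
        by (simp add: add.assoc)
      show ?thesis
      proof (cases "P (i + 2)")
        case True
        then have "P (i + 4)" using P_step[of "i + 1"] i by (simp add: add.assoc)
        then have "P l" for l
          using residues5[of l i] True i i3 P_cong[of l] P_cong[of "i - 1" "i + 4"]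
            P_cong[of "i - 2" "i + 3"] by auto
        then show ?thesis using copy_F5 unfolding P_def family_F_def by blast
      next
        case False
        define k where "k = i + 1"
        obtain a4 a1 where e1: "Ear k a4 a1" using i(2) by (auto simp: P_def k_def)
        have "P (k + 2)" using i3 by (simp add: k_def add.assoc)
        then obtain a1' a3 where e2: "Ear (k + 2) a1' a3" by (auto simp: P_def)
        have "P (k + 4)" using i(1) P_cong[of "k + 4" i] by (simp add: k_def)
        then obtain a3' a5 where e3: "Ear (k + 4) a3' a5" by (auto simp: P_def)
        have "a1 = a1'" using ears_share[OF e1 e2] .
        moreover have "a3 = a3'" using ears_share[of "k + 2" a1' a3 a3' a5] e2 e3 by (simp add: add.assoc)
        moreover have "5 dvd l - k \<or> 5 dvd l - (k + 2) \<or> 5 dvd l - (k + 4)" if "Ear l p q" for l p q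
        proof -
          have "P l" using that P_def by blast
          then have "\<not> 5 dvd l - (i + 2)" "\<not> 5 dvd l - (i - 1)"
            using False i24 P_cong[of l "i + 2"] P_cong[of l "i - 1"] P_cong[of "i - 1" "i + 4"] by auto
          then show ?thesis using residues5[of l i] unfolding k_def by presburger
        qed
        ultimately show ?thesis using copy_F4[of k a4 a1 a3 a5] e1 e2 e3 by (auto simp: family_F_def)
      qed
    next
      case False
      have "P (m + 2) \<or> P (m - 2)"
        using residues5[of k m] 3 False P_cong[of k "m + 1"] P_cong[of k "m - 1"]
          P_cong[of k "m + 2"] P_cong[of k "m - 2"] by (metis diff_add_cancel)
      then obtain k where k: "P k" "P (k + 2)" using 3(1) by (metis diff_add_cancel)
      obtain a4 a1 where e1: "Ear k a4 a1" using k(1) by (auto simp: P_def)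
      obtain a1' a3 where e2: "Ear (k + 2) a1' a3" using k(2) by (auto simp: P_def)
      have "a1 = a1'" using ears_share[OF e1 e2] .
      moreover have "5 dvd l - k \<or> 5 dvd l - (k + 2)" if "Ear l p q" for l p q
      proof -
        have l: "P l" using that P_def by blast
        have "\<not> P (k + 1)" using False k(1) by blast
        moreover have "\<not> P (k - 1)" using False k(1) by (metis diff_add_cancel)
        moreover have "\<not> P (k + 3)" using False k(2) by (metis add.assoc one_plus_numeral numeral_plus_one semiring_norm(5))
        ultimately have "\<not> 5 dvd l - (k + 1)" "\<not> 5 dvd l - (k - 1)" "\<not> 5 dvd l - (k - 2)"
          using l P_cong[of l "k + 1"] P_cong[of l "k - 1"] P_cong[of l "k - 2"] P_cong[of "k - 2" "k + 3"] by auto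
        then show ?thesis using residues5[of l k] by blast
      qed
      ultimately show ?thesis using copy_F3[of k a4 a1 a3] e1 e2 by (auto simp: family_F_def)
    qed
  qed
qed

end

section \<open>The case of a hexagon without pentagons\<close>
lemma F0'_arcs:
  "(V i, V j) \<in> parcs (F0' t) \<longleftrightarrow> (V i, V j) \<in> parcs F0"
  "(V i, Y j) \<in> parcs (F0' t) \<longleftrightarrow> i = 1 \<and> j \<in> {1..t}" "(Y j, V i) \<in> parcs (F0' t) \<longleftrightarrow> i = 1 \<and> j \<in> {1..t}"
  "(V i, Z j) \<in> parcs (F0' t) \<longleftrightarrow> i = 4 \<and> j \<in> {1..t}" "(Z j, V i) \<in> parcs (F0' t) \<longleftrightarrow> i = 4 \<and> j \<in> {1..t}"
  "(Y i, Z j) \<in> parcs (F0' t) \<longleftrightarrow> i = j \<and> j \<in> {1..t}" "(Z j, Y i) \<in> parcs (F0' t) \<longleftrightarrow> i = j \<and> j \<in> {1..t}"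
  "(Y i, Y j) \<notin> parcs (F0' t)" "(Z i, Z j) \<notin> parcs (F0' t)"
  unfolding F0'_def F0_def cycle_graph_def parcs_graph_of small_cycle_edges by auto

lemma F0'_verts: "pverts (F0' t) = V ` {1..6} \<union> Y ` {1..t} \<union> Z ` {1..t}"
  by (simp add: F0'_def)

locale hexagon = thin_atom +
  fixes c :: "int \<Rightarrow> 'a"
  assumes hole6: "hole 6 c" and no_hole5: "\<not> hole 5 h"
begin

lemmas hole6_simps [simp] = hole_adj[OF hole6] hole_eq[OF hole6] hole_in[OF hole6]

text \<open>
  The foot of \<open>a\<close> is \<open>c i\<close>. An outside vertex with two neighbours on the hexagon would see opposite
  vertices and create a pentagon.
\<close>
definition At :: "int \<Rightarrow> 'a \<Rightarrow> bool" where
  "At i a \<longleftrightarrow> (\<forall>j. a \<sim> c j \<longleftrightarrow> 6 dvd j - i)"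

lemma AtD: assumes "At i a" shows "a \<sim> c j \<longleftrightarrow> 6 dvd j - i" "c j \<sim> a \<longleftrightarrow> 6 dvd j - i"
  using assms adj_commute unfolding At_def by blast+

lemma At_in: "At i a \<Longrightarrow> a \<in> U"
  by (metis AtD(1) adj_in diff_self dvd_0_right)

lemma At_inj: "At i a \<Longrightarrow> At j a \<Longrightarrow> 6 dvd i - j"
  using AtD(1)[of i a i] AtD(1)[of j a i] by simp

lemma At_cong: assumes "6 dvd i - j" shows "At i a \<longleftrightarrow> At j a"
proof -
  have "6 dvd k - i \<longleftrightarrow> 6 dvd k - j" for k using assms by presburger
  then show ?thesis by (simp add: At_def)
qed

lemma residues6: "6 dvd j - i \<or> 6 dvd j - (i + 1) \<or> 6 dvd j - (i - 1) \<or> 6 dvd j - (i + 2)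
    \<or> 6 dvd j - (i - 2) \<or> 6 dvd j - (i + 3)"
  for i j :: int
  by presburger

lemma range_hexagon:
  "range c = {c (k + 1), c (k + 2), c (k + 3), c (k + 4), c (k + 5), c (k + 6)}"
proof -
  have "c j \<in> {c (k + 1), c (k + 2), c (k + 3), c (k + 4), c (k + 5), c (k + 6)}" for j
    using residues6[of j k] by simp presburger
  then show ?thesis by blast
qed

lemma attached: assumes "x \<notin> range c" "x \<sim> c i" shows "At i x"
  unfolding At_def
proof
  fix j
  note off = off_hole[OF hole6 assms]
  have "x \<nsim> c (i + 3)"
  proof
    assume "x \<sim> c (i + 3)"
    then show False
      using hole5I[of x "c i" "c (i + 1)" "c (i + 2)" "c (i + 3)"] assms off no_hole5 adj_sym by simp
  qed
  then show "x \<sim> c j \<longleftrightarrow> 6 dvd j - i"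
    using residues6[of j i] off assms(2) by (metis hole6_simps(2))
qed

lemma At_not_on: assumes "At i a" shows "a \<noteq> c j"
proof
  assume "a = c j"
  then have "6 dvd (j + 1) - i" "6 dvd (j - 1) - i"
    using AtD(1)[OF assms, of "j + 1"] AtD(1)[OF assms, of "j - 1"] by simp_all
  then show False by presburger
qed

lemma At_At:
  assumes "At i a" "At j b" "a \<sim> b" shows "6 dvd j - (i + 3)"
proof (rule ccontr)
  assume "\<not> ?thesis"
  then consider "6 dvd j - i" | "6 dvd j - (i + 1)" | "6 dvd j - (i - 1)"
    | "6 dvd j - (i + 2)" | "6 dvd j - (i - 2)" using residues6[of j i] by blast
  then show False
  proof cases
    case 1
    then have "At i b" using At_cong assms by blast
    then show False using no_triangle[of a b "c i"] assms(1,3) by (simp add: AtD)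
  next
    case 2
    then have "At (i + 1) b" using At_cong assms by blast
    then show False using no_C4[of a b "c (i + 1)" "c i"] assms(1,3)
      by (simp add: AtD At_not_on)
  next
    case 3
    then have "At (i - 1) b" using At_cong assms by blast
    then show False using no_C4[of a b "c (i - 1)" "c i"] assms(1,3)
      by (simp add: AtD At_not_on)
  next
    case 4
    then have "At (i + 2) b" using At_cong assms by blast
    then show False using hole5I[of a b "c (i + 2)" "c (i + 1)" "c i"] assms(1,3) no_hole5
      by (simp add: AtD)
  next
    case 5
    then have "At (i - 2) b" using At_cong assms by blast
    then show False using hole5I[of a b "c (i - 2)" "c (i - 1)" "c i"] assms(1,3) no_hole5
      by (simp add: AtD)
  qed
qed

lemma At_unique:
  assumes "At j b" "At j b'" "a \<sim> b" "a \<sim> b'" "At i a" shows "b = b'"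
proof (rule ccontr)
  assume "b \<noteq> b'"
  moreover have "b \<nsim> b'" using At_At[OF assms(1,2)] by auto
  moreover have "a \<nsim> c j" using no_triangle[of a b "c j"] assms AtD by auto
  ultimately show False
    using no_C4[of a b "c j" b'] assms by (simp add: AtD At_not_on adj_commute[of _ a])
qed

text \<open>
  An unattached vertex next to an attached one extends the way around the hexagon to a \<open>P\<^sub>7\<close>.
\<close>
lemma all_attached: assumes "x \<in> U" "x \<notin> range c" obtains i where "At i x"
proof (rule ccontr)
  define W where "W = {w \<in> U. w \<notin> range c \<and> (\<forall>i. w \<nsim> c i)}"
  assume "\<not> thesis"
  then have "x \<in> W" using attached assms that by (auto simp: W_def)
  moreover have "c 0 \<in> U" "c 0 \<notin> W" by (auto simp: W_def)
  ultimately obtain w a where wa: "w \<in> W" "a \<in> U" "a \<notin> W" "w \<sim> a"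
    using boundary_edge[of x W "c 0"] by (auto simp: W_def)
  have w: "w \<nsim> c i" for i using wa adj_sym by (auto simp: W_def)
  obtain i where i: "At i a"
    using wa attached[of a] w unfolding W_def by blast
  show False
    using no_P7[of w a "c i" "c (i + 1)" "c (i + 2)" "c (i + 3)" "c (i + 4)"] i w wa(4)
    by (simp add: AtD)
qed

text \<open>
  The foot of \<open>a\<close> is not a cut vertex.
\<close>
lemma partner: assumes "At i a" obtains b where "At (i + 3) b" "a \<sim> b"
proof -
  have "a \<sim> c i" using assms by (simp add: AtD)
  moreover have "c (i + 1) \<noteq> a" "c (i + 1) \<noteq> c i" using At_not_on[OF assms] by auto
  ultimately obtain b where b: "a \<sim> b" "b \<noteq> c i"
    using another_neighbour[of a "c i" "c (i + 1)"] by auto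
  have "b \<noteq> c k" for k
  proof
    assume "b = c k"
    then have "6 dvd k - i" using b assms by (simp add: AtD)
    then show False using b \<open>b = c k\<close> by simp
  qed
  then obtain j where j: "At j b" using all_attached[of b] adj_in2[OF b(1)] by blast
  then have "At (i + 3) b" using At_At[OF assms j b(1)] At_cong by blast
  then show thesis using that b by blast
qed

text \<open>
  With partners \<open>b\<close> and \<open>b'\<close>, the path \<open>b, a, c i, c (i + 1), a', b', c (i + 4)\<close> is induced.
\<close>
lemma consecutive_feet: assumes "At i a" "At (i + 1) a'" shows False
proof -
  obtain b where b: "At (i + 3) b" "a \<sim> b" using partner[OF assms(1)] .
  obtain b' where b': "At (i + 1 + 3) b'" "a' \<sim> b'" using partner[OF assms(2)] .
  have n: "a \<nsim> a'" "a \<nsim> b'" "b \<nsim> a'" "b \<nsim> b'"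
    using At_At[OF assms] At_At[OF assms(1) b'(1)] At_At[OF b(1) assms(2)] At_At[OF b(1) b'(1)] by auto
  show False
    using no_P7[of b a "c i" "c (i + 1)" a' b' "c (i + 4)"] assms b b' n adj_sym[OF b(2)]
    by (simp add: AtD)
qed

text \<open>
  Every foot comes with the opposite foot, so any other pair of feet would bring two consecutive feet.
\<close>
lemma opposite_feet: assumes "At i a" "At j b" shows "6 dvd j - i \<or> 6 dvd j - (i + 3)"
proof (rule ccontr)
  assume "\<not> ?thesis"
  then consider "6 dvd j - (i + 1)" | "6 dvd j - (i - 1)"
    | "6 dvd j - (i + 2)" | "6 dvd j - (i - 2)" using residues6[of j i] by blast
  then show False
  proof cases
    case 1
    then show ?thesis using consecutive_feet assms At_cong by blast
  next
    case 2
    then have "At (i - 1) b" using assms At_cong by blast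
    then show ?thesis using consecutive_feet[of "i - 1" b a] assms by simp
  next
    case 3
    then have "At (i + 2) b" using assms At_cong by blast
    moreover obtain d where "At (i + 3) d" using partner[OF assms(1)] by blast
    ultimately show ?thesis using consecutive_feet[of "i + 2" b d] by (simp add: add.assoc)
  next
    case 4
    then have "At (i - 2) b" using assms At_cong by blast
    moreover obtain d where "At (i + 3) d" using partner[OF assms(1)] by blast
    then have "At (i - 3) d" using At_cong[of "i + 3" "i - 3"] by simp
    ultimately show ?thesis using consecutive_feet[of "i - 3" d b] by (simp add: add.assoc)
  qed
qed

lemma hole_is_F0: "\<forall>i\<in>{1..6}. \<forall>j\<in>{1..6}. c (k + int i) \<sim> c (k + int j) \<longleftrightarrow> (V i, V j) \<in> parcs F0"
  by (simp add: interval_sets F0_def F_unfold del: One_nat_def)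

lemma copy_F0: assumes "\<And>i a. \<not> At i a" shows "copy_of F0"
proof -
  have "x \<in> range c" if "x \<in> U" for x using all_attached[OF that] assms by blast
  then have U: "U = range c" by auto
  show ?thesis
    by (rule copy_ofI[where f = "place (\<lambda>i. c (int i)) undefined undefined undefined"])
      (simp_all add: U F0_def F_unfold range_hexagon[of 0])
qed

lemma copy_F0':
  assumes m: "At m x0"
  shows "\<exists>t\<ge>1. copy_of (F0' t)"
proof -
  define k where "k = m - 1"
  let ?A = "{a. At (k + 1) a}" and ?B = "{b. At (k + 4) b}"
  have partner4: "\<exists>b. At (k + 4) b \<and> a \<sim> b" if "At (k + 1) a" for a
    using partner[OF that] by (auto simp: add.assoc)
  have partner1: "\<exists>a. At (k + 1) a \<and> a \<sim> b" if "At (k + 4) b" for b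
  proof -
    obtain a where "At (k + 4 + 3) a" "b \<sim> a" using partner[OF \<open>At (k + 4) b\<close>] .
    then show ?thesis using At_cong[of "k + 4 + 3" "k + 1"] adj_sym by auto
  qed
  have "?A \<subseteq> U" "?A \<noteq> {}" using At_in m by (auto simp: k_def)
  moreover have "\<exists>b\<in>?B. a \<sim> b" if "a \<in> ?A" for a
    using that partner4 by blast
  moreover have "\<exists>a\<in>?A. a \<sim> b" if "b \<in> ?B" for b
    using that partner1 by blast
  moreover have "b = b'" if "a \<in> ?A" "b \<in> ?B" "b' \<in> ?B" "a \<sim> b" "a \<sim> b'" for a b b'
    using that At_unique by blast
  moreover have "a = a'" if "a \<in> ?A" "a' \<in> ?A" "b \<in> ?B" "a \<sim> b" "a' \<sim> b" for a a' b
    using that At_unique[of _ a a' b] adj_sym by blast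
  ultimately obtain t y z where t: "1 \<le> t" and yA: "y ` {1..t::nat} = ?A" and zB: "z ` {1..t} = ?B"
    and yz: "\<forall>i\<in>{1..t}. \<forall>j\<in>{1..t}. y i \<sim> z j \<longleftrightarrow> i = j"
    and inj: "inj_on y {1..t}" "inj_on z {1..t}"
    by (rule enumerate_matching[of ?A ?B]) blast
  have y: "At (k + 1) (y i)" and z: "At (k + 4) (z i)" if "i \<in> {1..t}" for i
    using imageI[OF that, of y] imageI[OF that, of z] unfolding yA zB by simp_all
  have cover: "x \<in> range c \<or> x \<in> y ` {1..t} \<or> x \<in> z ` {1..t}" if "x \<in> U" for x
  proof (cases "x \<in> range c")
    case False
    then obtain i where i: "At i x" using all_attached[OF \<open>x \<in> U\<close>] by blast
    have "At (k + 1) x \<or> At (k + 4) x"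
      using opposite_feet[OF m i] At_cong[of i "k + 1" x] At_cong[of i "k + 4" x] i by (auto simp: k_def add.commute)
    then show ?thesis unfolding yA zB by simp
  qed simp
  have nonadj: "y i \<nsim> y j" "z i \<nsim> z j" if "i \<in> {1..t}" "j \<in> {1..t}" for i j
    using At_At[OF y y] At_At[OF z z] that by fastforce+
  have ne: "y i \<noteq> z j" "z j \<noteq> y i" if "i \<in> {1..t}" "j \<in> {1..t}" for i j
    using At_inj[of "k + 1" "y i" "k + 4"] y[OF that(1)] z[OF that(2)] by auto
  have "copy_of (F0' t)"
  proof (rule copy_ofI[where f = "place (\<lambda>i. c (k + int i)) undefined y z"])
    have U: "U = range c \<union> y ` {1..t} \<union> z ` {1..t}"
      using cover At_in[OF y] At_in[OF z] by auto
    show "place (\<lambda>i. c (k + int i)) undefined y z ` pverts (F0' t) = U"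
      unfolding U range_hexagon[of k]
      by (simp add: F0'_def F_unfold V_intervals_1 image_Un image_image del: One_nat_def)
    show "inj_on (place (\<lambda>i. c (k + int i)) undefined y z) (pverts (F0' t))"
      by (simp add: inj_on_eq_iff[OF inj(1)] inj_on_eq_iff[OF inj(2)] F0'_def F_unfold V_intervals_1
          inj_on_def ball_Un ne At_not_on[OF y] At_not_on[OF z] At_not_on[OF y, symmetric] At_not_on[OF z, symmetric] del: One_nat_def)
    have zy: "z i \<sim> y j \<longleftrightarrow> i = j" if "i \<in> {1..t}" "j \<in> {1..t}" for i j
      using yz[rule_format, OF that(2,1)] adj_commute[of "z i" "y j"] by auto
    have feet: "y j \<sim> c (k + int i) \<longleftrightarrow> i = 1" "z j \<sim> c (k + int i) \<longleftrightarrow> i = 4"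
      if "i \<in> {1..6}" "j \<in> {1..t}" for i j
    proof -
      have "i = 1 \<or> i = 2 \<or> i = 3 \<or> i = 4 \<or> i = 5 \<or> i = 6" using that(1) by auto
      then show "y j \<sim> c (k + int i) \<longleftrightarrow> i = 1" "z j \<sim> c (k + int i) \<longleftrightarrow> i = 4"
        by (elim disjE; simp add: AtD(1)[OF y[OF that(2)]] AtD(1)[OF z[OF that(2)]])+
    qed
    have feet': "c (k + int i) \<sim> y j \<longleftrightarrow> i = 1" "c (k + int i) \<sim> z j \<longleftrightarrow> i = 4"
      if "i \<in> {1..6}" "j \<in> {1..t}" for i j
      using feet[OF that] adj_commute[of "c (k + int i)" "y j"] adj_commute[of "c (k + int i)" "z j"]
      by blast+
    show "\<forall>u\<in>pverts (F0' t). \<forall>v\<in>pverts (F0' t). place (\<lambda>i. c (k + int i)) undefined y z u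
        \<sim> place (\<lambda>i. c (k + int i)) undefined y z v \<longleftrightarrow> (u, v) \<in> parcs (F0' t)"
      unfolding F0'_verts ball_Un ball_simps
      by (simp add: F0'_arcs feet feet' nonadj yz zy hole_is_F0[rule_format, of _ _ k] del: One_nat_def hole6_simps) auto
  qed
  then show ?thesis using t by blast
qed

theorem hexagon_classification: "\<exists>F\<in>family_F. copy_of F"
proof (cases "\<exists>m a. At m a")
  case True
  then show ?thesis using copy_F0' unfolding family_F_def by blast
next
  case False
  then show ?thesis using copy_F0 by (auto simp: family_F_def)
qed

end

section \<open>The case of a heptagon\<close>
definition F12_pairs :: "(nat \<times> nat) set" where
  "F12_pairs = {(7, 1), (1, 2), (2, 3), (3, 4), (4, 5), (5, 6), (6, 7), (8, 2), (8, 6), (9, 3), (9, 7),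
       (10, 8), (10, 9), (11, 3), (11, 6)}"

lemma F12_arcs: "(V i, V j) \<in> parcs F12 \<longleftrightarrow> (i, j) \<in> F12_pairs \<or> (j, i) \<in> F12_pairs"
  unfolding F12_def F12_pairs_def parcs_graph_of small_cycle_edges by auto

lemma F12_is_induced: "F12 = F12_induced {1..11}"
proof -
  have "parcs F12 \<subseteq> V ` {1..11} \<times> V ` {1..11}"
    unfolding F12_def graph_of_def small_cycle_edges by auto
  moreover have "pverts F12 = V ` {1..11}" by (simp add: F12_def)
  ultimately show ?thesis unfolding F12_induced_def by (metis inf.absorb1 pair_pre_digraph.surjective old.unit.exhaust)
qed

lemma index_sets:
  "{1..7::nat} = {1, 2, 3, 4, 5, 6, 7}" "{1..8::nat} = {1, 2, 3, 4, 5, 6, 7, 8}"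
  "{1..9::nat} = {1, 2, 3, 4, 5, 6, 7, 8, 9}" "{1..10::nat} = {1, 2, 3, 4, 5, 6, 7, 8, 9, 10}"
  "{1..11::nat} = {1, 2, 3, 4, 5, 6, 7, 8, 9, 10, 11}"
  by (auto, presburger+)

context sgraph begin

lemma copy_of_F12_induced:
  assumes "x ` I = U" "inj_on x I"
    and "\<forall>i\<in>I. \<forall>j\<in>I. x i \<sim> x j \<longleftrightarrow> (i, j) \<in> F12_pairs \<or> (j, i) \<in> F12_pairs"
  shows "copy_of (F12_induced I)"
proof (rule copy_ofI[where f = "place x undefined undefined undefined"])
  show "place x undefined undefined undefined ` pverts (F12_induced I) = U"
    using assms(1) by (simp add: F12_induced_def image_image)
  show "inj_on (place x undefined undefined undefined) (pverts (F12_induced I))"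
    using assms(2) by (auto simp: F12_induced_def inj_on_def)
  show "\<forall>u\<in>pverts (F12_induced I). \<forall>v\<in>pverts (F12_induced I). place x undefined undefined undefined u
      \<sim> place x undefined undefined undefined v \<longleftrightarrow> (u, v) \<in> parcs (F12_induced I)"
    using assms(3) by (simp add: F12_induced_def F12_arcs)
qed

end

locale heptagon = thin_atom +
  fixes c :: "int \<Rightarrow> 'a"
  assumes hole7: "hole 7 c"
begin

lemmas hole7_simps [simp] = hole_adj[OF hole7] hole_eq[OF hole7] hole_in[OF hole7]

text \<open>
  \<open>a\<close> sees exactly the two vertices at distance two from \<open>c m\<close>, which are at distance three from each
  other.
\<close>
definition At :: "int \<Rightarrow> 'a \<Rightarrow> bool" where
  "At m a \<longleftrightarrow> (\<forall>j. a \<sim> c j \<longleftrightarrow> 7 dvd j - (m + 2) \<or> 7 dvd j - (m - 2))"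

lemma AtD:
  assumes "At m a"
  shows "a \<sim> c j \<longleftrightarrow> 7 dvd j - (m + 2) \<or> 7 dvd j - (m - 2)"
    "c j \<sim> a \<longleftrightarrow> 7 dvd j - (m + 2) \<or> 7 dvd j - (m - 2)"
  using assms adj_commute unfolding At_def by blast+

lemma At_in: "At i a \<Longrightarrow> a \<in> U"
  by (metis AtD(1) adj_in diff_self dvd_0_right)

lemma At_cong: assumes "7 dvd i - j" shows "At i a \<longleftrightarrow> At j a"
proof -
  have "7 dvd k - (i + 2) \<longleftrightarrow> 7 dvd k - (j + 2)" "7 dvd k - (i - 2) \<longleftrightarrow> 7 dvd k - (j - 2)" for k
    using assms by presburger+
  then show ?thesis by (simp add: At_def)
qed

lemma At_inj: assumes "At i a" "At j a" shows "7 dvd i - j"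
proof -
  have "7 dvd k - (i + 2) \<or> 7 dvd k - (i - 2) \<longleftrightarrow> 7 dvd k - (j + 2) \<or> 7 dvd k - (j - 2)" for k
    using AtD(1)[OF assms(1), of k] AtD(1)[OF assms(2), of k] by blast
  from this[of "i + 2"] this[of "i - 2"] show ?thesis by presburger
qed

lemma residues7: "7 dvd j - i \<or> 7 dvd j - (i + 1) \<or> 7 dvd j - (i - 1) \<or> 7 dvd j - (i + 2)
    \<or> 7 dvd j - (i - 2) \<or> 7 dvd j - (i + 3) \<or> 7 dvd j - (i - 3)"
  for i j :: int
  by presburger

lemma range_heptagon:
  "range c = {c (k + 1), c (k + 2), c (k + 3), c (k + 4), c (k + 5), c (k + 6), c (k + 7)}"
proof -
  have "c j \<in> {c (k + 1), c (k + 2), c (k + 3), c (k + 4), c (k + 5), c (k + 6), c (k + 7)}" for j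
    using residues7[of j k] by simp presburger
  then show ?thesis by blast
qed

lemma At_not_on: assumes "At i a" shows "a \<noteq> c j"
proof
  assume "a = c j"
  then have "7 dvd (j + 1) - (i + 2) \<or> 7 dvd (j + 1) - (i - 2)"
    "7 dvd (j - 1) - (i + 2) \<or> 7 dvd (j - 1) - (i - 2)"
    using AtD(1)[OF assms, of "j + 1"] AtD(1)[OF assms, of "j - 1"] by simp_all
  then show False by presburger
qed

text \<open>
  A single neighbour on the heptagon would give a \<open>P\<^sub>7\<close>.
\<close>
lemma attached: assumes "x \<notin> range c" "x \<sim> c i" shows "\<exists>m. At m x"
proof -
  note off = off_hole[OF hole7 assms]
  have "x \<sim> c (i + 3) \<or> x \<sim> c (i - 3)"
  proof (rule ccontr)
    assume n: "\<not> ?thesis"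
    have "c (i + 4) = c (i - 3)" "c (i + 5) = c (i - 2)" by simp_all
    then have "x \<nsim> c (i + 4)" "x \<nsim> c (i + 5)" using off n by metis+
    then show False
      using no_P7[of x "c i" "c (i + 1)" "c (i + 2)" "c (i + 3)" "c (i + 4)" "c (i + 5)"]
        assms off n by simp
  qed
  then show ?thesis
  proof
    assume p: "x \<sim> c (i + 3)"
    have "c (i + 3 + 1) = c (i - 3)" by simp
    then have n: "x \<nsim> c (i - 3)" using off_hole(1)[OF hole7 assms(1) p] by metis
    have "x \<sim> c j \<longleftrightarrow> 7 dvd j - i \<or> 7 dvd j - (i + 3)" for j
      using residues7[of j i] off n p assms(2) by (metis hole7_simps(2))
    moreover have "7 dvd j - (i + 3) \<longleftrightarrow> 7 dvd j - (i - 2 - 2)" for j by presburger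
    ultimately have "At (i - 2) x" by (simp add: At_def)
    then show ?thesis ..
  next
    assume p: "x \<sim> c (i - 3)"
    have "c (i - 3 - 1) = c (i + 3)" by simp
    then have n: "x \<nsim> c (i + 3)" using off_hole(2)[OF hole7 assms(1) p] by metis
    have "x \<sim> c j \<longleftrightarrow> 7 dvd j - i \<or> 7 dvd j - (i - 3)" for j
      using residues7[of j i] off n p assms(2) by (metis hole7_simps(2))
    moreover have "7 dvd j - (i - 3) \<longleftrightarrow> 7 dvd j - (i + 2 + 2)" for j by presburger
    ultimately have "At (i + 2) x" unfolding At_def by auto
    then show ?thesis ..
  qed
qed

lemma At_single: assumes "At m a" "At m b" shows "a = b"
proof (rule ccontr)
  assume "a \<noteq> b"
  moreover have "a \<nsim> b" using no_triangle[of a b "c (m + 2)"] assms by (auto simp: AtD)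
  ultimately show False
    using no_C4[of a "c (m + 2)" b "c (m - 2)"] assms by (simp add: AtD)
qed

lemma At_nonadj: assumes "At i a" "At j b" shows "a \<nsim> b"
proof
  assume ab: "a \<sim> b"
  have key: False if "At i a" "At (i + 1) b \<or> At (i + 2) b \<or> At (i + 3) b" "a \<sim> b" for i a b
    using that(2)
  proof (elim disjE)
    assume b: "At (i + 1) b"
    then show False using no_C4[of a b "c (i - 1)" "c (i - 2)"] that(1,3) by (simp add: AtD At_not_on)
  next
    assume b: "At (i + 2) b"
    then show False using no_C4[of a b "c (i + 4)" "c (i + 5)"] that(1,3) by (simp add: AtD At_not_on)
  next
    assume b: "At (i + 3) b"
    then show False using no_triangle[of a b "c (i + 5)"] that(1,3) by (simp add: AtD)
  qed
  consider "At i b" | "At (i + 1) b \<or> At (i + 2) b \<or> At (i + 3) b"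
    | "At (j + 1) a \<or> At (j + 2) a \<or> At (j + 3) a"
  proof -
    have "7 dvd j - (i - 1) \<longleftrightarrow> 7 dvd i - (j + 1)" "7 dvd j - (i - 2) \<longleftrightarrow> 7 dvd i - (j + 2)"
      "7 dvd j - (i - 3) \<longleftrightarrow> 7 dvd i - (j + 3)" by presburger+
    then show thesis
      using that residues7[of j i] assms At_cong[of j i b] At_cong[of j "i + 1" b]
        At_cong[of j "i + 2" b] At_cong[of j "i + 3" b] At_cong[of i "j + 1" a]
        At_cong[of i "j + 2" a] At_cong[of i "j + 3" a] by blast
  qed
  then show False
  proof cases
    case 1
    then show False using At_single assms(1) ab by fastforce
  qed (use key assms ab adj_sym in blast)+
qed

text \<open>
  The path \<open>b, c i, c (i - 1), c (i - 2), a, c (i + 2), c (i + 3)\<close> would be induced.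
\<close>
lemma At_two_apart: assumes "At i a" "At (i + 2) b" shows False
proof -
  have "a \<nsim> b" "b \<nsim> a" using At_nonadj assms by blast+
  then show False
    using no_P7[of b "c i" "c (i - 1)" "c (i - 2)" a "c (i + 2)" "c (i + 3)"] assms
    by (simp add: AtD)
qed

text \<open>
  \<open>W\<close> consists of the vertices that miss the heptagon. Let \<open>w\<close> in \<open>W\<close> see an attached vertex \<open>a\<close>.
  By \<open>sep\<close>, any other neighbour \<open>b\<close> of \<open>w\<close> is attached one position away from \<open>a\<close>: if \<open>b\<close> missed the
  heptagon there would be a \<open>P\<^sub>7\<close>, positions two apart do not coexist, and positions three apart share
  a neighbour and would close a 4-cycle. Hence no vertex of \<open>W\<close> is at a greater distance from the heptagon (\<open>W2\<close>
  is empty). As \<open>a\<close> is not a cut vertex, a second neighbour exists, and there is no room for a third.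
\<close>
lemma far_vertex:
  assumes x: "x \<in> U" "x \<notin> range c" and far: "\<not> (\<exists>m. At m x)"
  shows "\<exists>m a b. At m a \<and> At (m + 1) b \<and> x \<sim> a \<and> x \<sim> b \<and> (\<forall>z. x \<sim> z \<longrightarrow> z = a \<or> z = b)"
proof -
  define W where "W = {w \<in> U. w \<notin> range c \<and> (\<forall>i. w \<nsim> c i)}"
  define W2 where "W2 = {w \<in> W. \<forall>m a. At m a \<longrightarrow> w \<nsim> a}"
  have W_iff: "w \<in> W \<longleftrightarrow> w \<notin> range c \<and> \<not> (\<exists>m. At m w)" if "w \<in> U" for w
  proof -
    have "w \<notin> W" if "At m w" for m
      using AtD(1)[OF that, of "m + 2"] by (auto simp: W_def)
    then show ?thesis using attached[of w] that by (auto simp: W_def)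
  qed
  have sep: "b = a \<or> (\<exists>m'. At m' b \<and> (7 dvd m' - (m + 1) \<or> 7 dvd m' - (m - 1)))"
    if w: "w \<in> W" "w \<sim> a" "At m a" "w \<sim> b" for w a b m
  proof (rule disjCI)
    assume no: "\<not> (\<exists>m'. At m' b \<and> (7 dvd m' - (m + 1) \<or> 7 dvd m' - (m - 1)))"
    show "b = a"
    proof (rule ccontr)
      assume ne: "b \<noteq> a"
      have wc: "w \<nsim> c i" "c i \<nsim> w" "w \<noteq> c i" for i using w(1) adj_sym by (auto simp: W_def)
      have s: "b \<sim> w" "a \<sim> w" using w adj_sym by blast+
      have ab: "a \<nsim> b" "b \<nsim> a" using no_triangle w s by blast+
      have bU: "b \<in> U" "b \<notin> range c" using adj_in s(1) wc w(4) by auto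
      show False
      proof (cases "b \<in> W")
        case True
        then have "b \<nsim> c i" for i by (auto simp: W_def)
        then show False
          using no_P7[of b w a "c (m + 2)" "c (m + 1)" "c m" "c (m - 1)"] w(2,3) wc ab s by (simp add: AtD)
      next
        case False
        then obtain l where l: "At l b" using W_iff bU by blast
        then consider "At m b" | "At (m + 2) b" | "At (m - 2) b" | "At (m + 3) b" | "At (m - 3) b"
          using residues7[of l m] no At_cong by blast
        then show False
        proof cases
          case 1
          then show False using At_single w(3) ne by blast
        next
          case 2
          then show False using At_two_apart w(3) by blast
        next
          case 3
          then show False using At_two_apart[of "m - 2" b a] w(3) by simp
        next
          case 4
          then show False using no_C4[of w a "c (m - 2)" b] w(2,3) ne wc s ab by (simp add: AtD)
        next
          case 5
          then show False using no_C4[of w a "c (m + 2)" b] w(2,3) ne wc s ab by (simp add: AtD)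
        qed
      qed
    qed
  qed
  have W2_empty: "W2 = {}"
  proof (rule ccontr)
    assume "W2 \<noteq> {}"
    then obtain w where "w \<in> W2" by blast
    moreover have "W2 \<subseteq> U" "c 0 \<in> U" "c 0 \<notin> W2" by (auto simp: W2_def W_def)
    ultimately obtain b w where bw: "b \<in> W2" "w \<in> U" "w \<notin> W2" "b \<sim> w"
      using boundary_edge[of w W2 "c 0"] by blast
    have "w \<notin> range c" using bw by (auto simp: W2_def W_def)
    moreover have "\<not> At m w" for m using bw by (auto simp: W2_def)
    ultimately have w: "w \<in> W" using W_iff bw(2) by blast
    then obtain m a where a: "At m a" "w \<sim> a" using bw(3) by (auto simp: W2_def)
    have "w \<sim> b" using bw adj_sym by blast
    then consider "b = a" | m' where "At m' b" using sep[OF w a(2,1)] by blast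
    then have "\<exists>m. At m b" using a by blast
    then show False using bw(1) W_iff by (auto simp: W2_def W_def)
  qed
  have xW: "x \<in> W" using W_iff x far by blast
  then have "x \<notin> W2" using W2_empty by simp
  then obtain m a where a: "At m a" "x \<sim> a" using xW by (auto simp: W2_def)
  note sep_a = sep[OF xW a(2,1)]
  have "c 0 \<noteq> x" "c 0 \<noteq> a" using x At_not_on[OF a(1)] by auto
  then obtain b where b: "x \<sim> b" "b \<noteq> a" using another_neighbour[OF a(2), of "c 0"] by auto
  then obtain l where l: "At l b" "7 dvd l - (m + 1) \<or> 7 dvd l - (m - 1)" using sep_a[of b] by blast
  have fin: "z = a \<or> z = b" if xz: "x \<sim> z" for z
  proof (rule ccontr)
    assume nz: "\<not> ?thesis"
    obtain k where k: "At k z" "7 dvd k - (m + 1) \<or> 7 dvd k - (m - 1)" using sep_a[OF xz] nz by blast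
    obtain k' where k': "At k' z" "7 dvd k' - (l + 1) \<or> 7 dvd k' - (l - 1)"
      using sep[OF xW b(1) l(1) xz] nz by blast
    have "7 dvd k - k'" using At_inj k k' by blast
    then show False using k(2) k'(2) l(2) by presburger
  qed
  from l(2) show ?thesis
  proof
    assume "7 dvd l - (m + 1)"
    then have "At (m + 1) b" using l At_cong by blast
    then show ?thesis using a b fin by blast
  next
    assume "7 dvd l - (m - 1)"
    then have "At (m - 1) b" using l At_cong by blast
    moreover have "At (m - 1 + 1) a" using a by simp
    ultimately show ?thesis using a b fin by blast
  qed
qed

text \<open>
  The numbering \<open>x\<^sub>1, \<dots>, x\<^sub>1\<^sub>1\<close> of the largest graph of this case, with the heptagon rotated so that \<open>x\<^sub>i\<close>
  is \<open>c (k + i)\<close>. Then \<open>x\<^sub>8\<close>, \<open>x\<^sub>9\<close> and \<open>x\<^sub>1\<^sub>1\<close> are in the positions \<open>k + 4\<close>, \<open>k + 5\<close> and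
  \<open>k + 1\<close>.
\<close>
definition label :: "int \<Rightarrow> 'a \<Rightarrow> 'a \<Rightarrow> 'a \<Rightarrow> 'a \<Rightarrow> nat \<Rightarrow> 'a" where
  "label k t8 t9 w t11 i = (if i \<le> 7 then c (k + int i) else if i = 8 then t8
     else if i = 9 then t9 else if i = 10 then w else t11)"

lemma cover7:
  assumes "x \<in> U"
  shows "x \<in> range c \<or> (\<exists>m. At m x) \<or>
    (\<exists>m a b. At m a \<and> At (m + 1) b \<and> x \<sim> a \<and> x \<sim> b \<and> (\<forall>z. x \<sim> z \<longrightarrow> z = a \<or> z = b))"
  using far_vertex[OF assms] by blast

lemma copy_F6: assumes "\<And>m a. \<not> At m a" shows "copy_of F6"
proof -
  have "x \<in> range c" if "x \<in> U" for x using cover7[OF that] assms by blast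
  then have U: "U = range c" by auto
  show ?thesis
    unfolding F6_def
    by (rule copy_of_F12_induced[where x = "label 0 undefined undefined undefined undefined"])
      (simp_all add: U index_sets range_heptagon[of 0] label_def F12_pairs_def del: One_nat_def)
qed

lemma copy_F7:
  assumes t8: "At (k + 4) t8" and only: "\<And>m a. At m a \<Longrightarrow> 7 dvd m - (k + 4)"
  shows "copy_of F7"
proof -
  have "x \<in> range c \<union> {t8}" if "x \<in> U" for x
    using cover7[OF that]
  proof (elim disjE exE)
    fix m assume m: "At m x"
    then have "At (k + 4) x" using only At_cong by blast
    then show ?thesis using At_single t8 by blast
  next
    fix m a b
    assume *: "At m a \<and> At (m + 1) b \<and> x \<sim> a \<and> x \<sim> b \<and> (\<forall>z. x \<sim> z \<longrightarrow> z = a \<or> z = b)"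
    have "7 dvd m - (k + 4)" "7 dvd (m + 1) - (k + 4)" using only * by blast+
    then have False by presburger
    then show ?thesis ..
  qed simp
  then have U: "U = range c \<union> {t8}" using At_in[OF t8] by auto
  show ?thesis
    unfolding F7_def
    by (rule copy_of_F12_induced[where x = "label k t8 undefined undefined undefined"])
      (simp_all add: U index_sets range_heptagon[of k] label_def F12_pairs_def AtD[OF t8]
        At_not_on[OF t8] At_not_on[OF t8, symmetric] insert_commute del: One_nat_def)
qed

lemma copy_F10:
  assumes t: "At (k + 5) t9" "At (k + 1) t11"
    and only: "\<And>m a. At m a \<Longrightarrow> 7 dvd m - (k + 5) \<or> 7 dvd m - (k + 1)"
  shows "copy_of F10"
proof -
  have n: "t9 \<nsim> t11" "t11 \<nsim> t9" using At_nonadj t by blast+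
  have ne: "t9 \<noteq> t11" using At_inj[OF t(1), of "k + 1"] t(2) by auto
  note on = AtD[OF t(1)] AtD[OF t(2)] At_not_on[OF t(1)] At_not_on[OF t(2)]
    At_not_on[OF t(1), symmetric] At_not_on[OF t(2), symmetric]
  have "x \<in> range c \<union> {t9, t11}" if "x \<in> U" for x
    using cover7[OF that]
  proof (elim disjE exE)
    fix m assume m: "At m x"
    then have "At (k + 5) x \<or> At (k + 1) x" using only At_cong by blast
    then show ?thesis using At_single t by blast
  next
    fix m a b
    assume *: "At m a \<and> At (m + 1) b \<and> x \<sim> a \<and> x \<sim> b \<and> (\<forall>z. x \<sim> z \<longrightarrow> z = a \<or> z = b)"
    have "7 dvd m - (k + 5) \<or> 7 dvd m - (k + 1)" "7 dvd (m + 1) - (k + 5) \<or> 7 dvd (m + 1) - (k + 1)"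
      using only * by blast+
    then have False by presburger
    then show ?thesis ..
  qed simp
  then have U: "U = range c \<union> {t9, t11}" using t At_in by auto
  show ?thesis
    unfolding F10_def
    by (rule copy_of_F12_induced[where x = "label k undefined t9 undefined t11"])
      (use n ne in \<open>simp_all add: U index_sets range_heptagon[of k] label_def F12_pairs_def on
        insert_commute del: One_nat_def\<close>)
qed

text \<open>
  The two outcomes differ in the presence of a vertex off the heptagon that misses it. It sees
  \<open>t8\<close> and \<open>t9\<close>, so two such vertices would close a 4-cycle.
\<close>
lemma copy_F8_F9:
  assumes t: "At (k + 4) t8" "At (k + 5) t9"
    and only: "\<And>m a. At m a \<Longrightarrow> 7 dvd m - (k + 4) \<or> 7 dvd m - (k + 5)"
  shows "copy_of F8 \<or> copy_of F9"
proof -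
  have n: "t8 \<nsim> t9" "t9 \<nsim> t8" using At_nonadj t by blast+
  have ne: "t8 \<noteq> t9" using At_inj[OF t(1), of "k + 5"] t(2) by auto
  note on = AtD[OF t(1)] AtD[OF t(2)] At_not_on[OF t(1)] At_not_on[OF t(2)]
    At_not_on[OF t(1), symmetric] At_not_on[OF t(2), symmetric]
  have cover: "x \<in> range c \<union> {t8, t9} \<or> (x \<sim> t8 \<and> x \<sim> t9 \<and> (\<forall>z. x \<sim> z \<longrightarrow> z = t8 \<or> z = t9))"
    if "x \<in> U" for x
    using cover7[OF that]
  proof (elim disjE exE)
    fix m assume m: "At m x"
    then have "At (k + 4) x \<or> At (k + 5) x" using only At_cong by blast
    then show ?thesis using At_single t by blast
  next
    fix m a b
    assume *: "At m a \<and> At (m + 1) b \<and> x \<sim> a \<and> x \<sim> b \<and> (\<forall>z. x \<sim> z \<longrightarrow> z = a \<or> z = b)"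
    have "7 dvd m - (k + 4) \<or> 7 dvd m - (k + 5)" "7 dvd (m + 1) - (k + 4) \<or> 7 dvd (m + 1) - (k + 5)"
      using only * by blast+
    then have "7 dvd m - (k + 4)" "7 dvd (m + 1) - (k + 5)" by presburger+
    then have "At (k + 4) a" "At (k + 5) b" using * At_cong by blast+
    then have "a = t8" "b = t9" using At_single t by blast+
    then show ?thesis using * by blast
  qed simp
  show ?thesis
  proof (cases "U = range c \<union> {t8, t9}")
    case True
    have "copy_of F8"
      unfolding F8_def
      by (rule copy_of_F12_induced[where x = "label k t8 t9 undefined undefined"])
        (use n ne in \<open>simp_all add: True index_sets range_heptagon[of k] label_def F12_pairs_def on
          insert_commute del: One_nat_def\<close>)
    then show ?thesis ..
  next
    case False
    then obtain w where w: "w \<in> U" "w \<notin> range c \<union> {t8, t9}" using t At_in by auto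
    then have wne: "w \<noteq> t8" "w \<noteq> t9" "t8 \<noteq> w" "t9 \<noteq> w" by auto
    from w have wt: "w \<sim> t8" "w \<sim> t9" "t8 \<sim> w" "t9 \<sim> w" and wz: "\<And>z. w \<sim> z \<Longrightarrow> z = t8 \<or> z = t9"
      using cover adj_sym by blast+
    have wc: "w \<nsim> c i" "c i \<nsim> w" "w \<noteq> c i" "c i \<noteq> w" for i
      using wz on(5-8) w(2) adj_sym by (metis, metis, auto)
    have "x \<in> range c \<union> {t8, t9, w}" if x: "x \<in> U" for x
    proof (rule ccontr)
      assume "\<not> ?thesis"
      then have "x \<sim> t8" "t9 \<sim> x" "x \<noteq> w" "x \<nsim> w"
        using cover[OF x] cover[OF w(1)] w(2) adj_sym by auto
      then show False using no_C4[of x t8 w t9] wt n ne by blast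
    qed
    then have U: "U = range c \<union> {t8, t9, w}" using t w At_in by auto
    have "copy_of F9"
      unfolding F9_def
      by (rule copy_of_F12_induced[where x = "label k t8 t9 w undefined"])
        (use n ne wt wne in \<open>simp_all add: U index_sets range_heptagon[of k] label_def F12_pairs_def on wc
          insert_commute del: One_nat_def\<close>)
    then show ?thesis ..
  qed
qed

lemma copy_F11_F12:
  assumes t: "At (k + 4) t8" "At (k + 5) t9" "At (k + 1) t11"
    and only: "\<And>m a. At m a \<Longrightarrow> 7 dvd m - (k + 4) \<or> 7 dvd m - (k + 5) \<or> 7 dvd m - (k + 1)"
  shows "copy_of F11 \<or> copy_of F12"
proof -
  have n: "t8 \<nsim> t9" "t9 \<nsim> t8" "t8 \<nsim> t11" "t11 \<nsim> t8" "t9 \<nsim> t11" "t11 \<nsim> t9"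
    using At_nonadj t by blast+
  have ne: "t8 \<noteq> t9" "t8 \<noteq> t11" "t9 \<noteq> t11"
    using At_inj[OF t(1), of "k + 5"] At_inj[OF t(1), of "k + 1"] At_inj[OF t(2), of "k + 1"] t by auto
  note on = AtD[OF t(1)] AtD[OF t(2)] AtD[OF t(3)] At_not_on[OF t(1)] At_not_on[OF t(2)]
    At_not_on[OF t(3)] At_not_on[OF t(1), symmetric] At_not_on[OF t(2), symmetric]
    At_not_on[OF t(3), symmetric]
  have cover: "x \<in> range c \<union> {t8, t9, t11} \<or>
      (x \<sim> t8 \<and> x \<sim> t9 \<and> (\<forall>z. x \<sim> z \<longrightarrow> z = t8 \<or> z = t9))"
    if "x \<in> U" for x
    using cover7[OF that]
  proof (elim disjE exE)
    fix m assume m: "At m x"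
    then have "At (k + 4) x \<or> At (k + 5) x \<or> At (k + 1) x" using only At_cong by blast
    then show ?thesis using At_single t by blast
  next
    fix m a b
    assume *: "At m a \<and> At (m + 1) b \<and> x \<sim> a \<and> x \<sim> b \<and> (\<forall>z. x \<sim> z \<longrightarrow> z = a \<or> z = b)"
    have "7 dvd m - (k + 4) \<or> 7 dvd m - (k + 5) \<or> 7 dvd m - (k + 1)"
      "7 dvd (m + 1) - (k + 4) \<or> 7 dvd (m + 1) - (k + 5) \<or> 7 dvd (m + 1) - (k + 1)"
      using only * by blast+
    then have "7 dvd m - (k + 4)" "7 dvd (m + 1) - (k + 5)" by presburger+
    then have "At (k + 4) a" "At (k + 5) b" using * At_cong by blast+
    then have "a = t8" "b = t9" using At_single t by blast+
    then show ?thesis using * by blast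
  qed simp
  show ?thesis
  proof (cases "U = range c \<union> {t8, t9, t11}")
    case True
    have "copy_of F11"
      unfolding F11_def
      by (rule copy_of_F12_induced[where x = "label k t8 t9 undefined t11"])
        (use n ne in \<open>simp_all add: True index_sets range_heptagon[of k] label_def F12_pairs_def on
          insert_commute del: One_nat_def\<close>)
    then show ?thesis ..
  next
    case False
    then obtain w where w: "w \<in> U" "w \<notin> range c \<union> {t8, t9, t11}" using t At_in by auto
    then have wne: "w \<noteq> t8" "w \<noteq> t9" "t8 \<noteq> w" "t9 \<noteq> w" "w \<noteq> t11" "t11 \<noteq> w" by auto
    from w have wt: "w \<sim> t8" "w \<sim> t9" "t8 \<sim> w" "t9 \<sim> w" and wz: "\<And>z. w \<sim> z \<Longrightarrow> z = t8 \<or> z = t9"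
      using cover adj_sym by blast+
    have wc: "w \<nsim> c i" "c i \<nsim> w" "w \<noteq> c i" "c i \<noteq> w" for i
      using wz on(10-12) w(2) adj_sym by (metis, metis, auto)
    have w11: "w \<nsim> t11" "t11 \<nsim> w" using wz ne adj_sym by metis+
    have "x \<in> range c \<union> {t8, t9, t11, w}" if x: "x \<in> U" for x
    proof (rule ccontr)
      assume "\<not> ?thesis"
      then have "x \<sim> t8" "t9 \<sim> x" "x \<noteq> w" "x \<nsim> w"
        using cover[OF x] cover[OF w(1)] w(2) adj_sym by auto
      then show False using no_C4[of x t8 w t9] wt n ne by blast
    qed
    then have U: "U = range c \<union> {t8, t9, t11, w}" using t w At_in by auto
    have "copy_of F12"
      unfolding F12_is_induced
      by (rule copy_of_F12_induced[where x = "label k t8 t9 w t11"])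
        (use n ne wt w11 wne in \<open>simp_all add: U index_sets range_heptagon[of k] label_def F12_pairs_def on wc
          insert_commute del: One_nat_def\<close>)
    then show ?thesis ..
  qed
qed

text \<open>
  \<open>P m\<close> says that position \<open>m\<close> is occupied. Occupied positions are not two apart, so any two of them
  differ by one or three. The multiples of two run through all residues modulo 7, so this asks for
  independent sets of a 7-cycle, of which there are five up to rotation and reflection; the cases
  distinguish them.
\<close>
theorem heptagon_classification: "\<exists>F\<in>family_F. copy_of F"
proof -
  define P where "P m \<longleftrightarrow> (\<exists>a. At m a)" for m
  have P_cong: "P i = P j" if "7 dvd i - j" for i j
    using At_cong[OF that] by (simp add: P_def)
  have no2: "\<not> (P i \<and> P (i + 2))" for i using At_two_apart by (auto simp: P_def)
  have no2': "\<not> (P i \<and> P (i - 2))" for i using no2[of "i - 2"] by auto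
  consider m where "P m" "P (m + 1)" "P (m - 3)"
    | m where "P m" "P (m + 1)" "\<not> P (m - 3)"
    | m where "P m" "P (m + 3)" "\<And>l. \<not> (P l \<and> P (l + 1))"
    | m where "P m" "\<And>l. \<not> (P l \<and> P (l + 1))" "\<And>l. \<not> (P l \<and> P (l + 3))"
    | "\<And>m. \<not> P m"
    by blast
  then show ?thesis
  proof cases
    case 1
    define k where "k = m - 4"
    obtain t8 t9 t11 where t: "At (k + 4) t8" "At (k + 5) t9" "At (k + 1) t11"
      using 1 by (auto simp: P_def k_def add.commute)
    have "7 dvd l - (k + 4) \<or> 7 dvd l - (k + 5) \<or> 7 dvd l - (k + 1)" if "At l a" for l a
    proof -
      have "P l" using that by (auto simp: P_def)
      then have "\<not> 7 dvd l - (m - 1)" "\<not> 7 dvd l - (m + 2)" "\<not> 7 dvd l - (m - 2)" "\<not> 7 dvd l - (m + 3)"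
        using 1 no2[of m] no2'[of m] no2[of "m + 1"] no2'[of "m + 1"]
          P_cong[of l "m - 1"] P_cong[of l "m + 2"] P_cong[of l "m - 2"] P_cong[of l "m + 3"]
        by (auto simp: algebra_simps)
      then show ?thesis using residues7[of l m] unfolding k_def by presburger
    qed
    then show ?thesis using copy_F11_F12[OF t] unfolding family_F_def by blast
  next
    case 2
    define k where "k = m - 4"
    obtain t8 t9 where t: "At (k + 4) t8" "At (k + 5) t9"
      using 2 by (auto simp: P_def k_def add.commute)
    have "7 dvd l - (k + 4) \<or> 7 dvd l - (k + 5)" if "At l a" for l a
    proof -
      have "P l" using that by (auto simp: P_def)
      then have "\<not> 7 dvd l - (m - 1)" "\<not> 7 dvd l - (m + 2)" "\<not> 7 dvd l - (m - 2)" "\<not> 7 dvd l - (m + 3)"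
        "\<not> 7 dvd l - (m - 3)"
        using 2 no2[of m] no2'[of m] no2[of "m + 1"] no2'[of "m + 1"]
          P_cong[of l "m - 1"] P_cong[of l "m + 2"] P_cong[of l "m - 2"] P_cong[of l "m + 3"]
          P_cong[of l "m - 3"]
        by (auto simp: algebra_simps)
      then show ?thesis using residues7[of l m] unfolding k_def by presburger
    qed
    then show ?thesis using copy_F8_F9[OF t] unfolding family_F_def by blast
  next
    case 3
    define k where "k = m - 5"
    have "P (k + 1)" using 3(2) P_cong[of "k + 1" "m + 3"] by (simp add: k_def)
    then obtain t9 t11 where t: "At (k + 5) t9" "At (k + 1) t11"
      using 3(1) by (auto simp: P_def k_def add.commute)
    have "7 dvd l - (k + 5) \<or> 7 dvd l - (k + 1)" if "At l a" for l a
    proof -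
      have "P l" using that by (auto simp: P_def)
      moreover have "\<not> P (m + 1)" "\<not> P (m - 1)" using 3(1) 3(3)[of m] 3(3)[of "m - 1"] by auto
      moreover have "\<not> P (m - 3)"
        using 3(2) 3(3)[of "m + 3"] P_cong[of "m + 4" "m - 3"] by (simp add: add.assoc)
      moreover have "\<not> P (m + 2)" "\<not> P (m - 2)" using 3(1) no2 no2' by blast+
      ultimately have "\<not> 7 dvd l - (m - 1)" "\<not> 7 dvd l - (m + 1)" "\<not> 7 dvd l - (m + 2)"
        "\<not> 7 dvd l - (m - 2)" "\<not> 7 dvd l - (m - 3)"
        using P_cong by blast+
      then show ?thesis using residues7[of l m] unfolding k_def by presburger
    qed
    then show ?thesis using copy_F10[OF t] unfolding family_F_def by blast
  next
    case 4
    define k where "k = m - 4"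
    obtain t8 where t: "At (k + 4) t8" using 4 by (auto simp: P_def k_def)
    have "7 dvd l - (k + 4)" if "At l a" for l a
    proof -
      have "P l" using that by (auto simp: P_def)
      moreover have "\<not> P (m + 1)" "\<not> P (m - 1)" using 4(1) 4(2)[of m] 4(2)[of "m - 1"] by auto
      moreover have "\<not> P (m + 3)" "\<not> P (m - 3)" using 4(1) 4(3)[of m] 4(3)[of "m - 3"] by auto
      moreover have "\<not> P (m + 2)" "\<not> P (m - 2)" using 4(1) no2 no2' by blast+
      ultimately have "\<not> 7 dvd l - (m - 1)" "\<not> 7 dvd l - (m + 1)" "\<not> 7 dvd l - (m + 2)"
        "\<not> 7 dvd l - (m - 2)" "\<not> 7 dvd l - (m - 3)" "\<not> 7 dvd l - (m + 3)"
        using P_cong by blast+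
      then show ?thesis using residues7[of l m] unfolding k_def by simp
    qed
    then show ?thesis using copy_F7[OF t] unfolding family_F_def by blast
  next
    case 5
    then show ?thesis using copy_F6 unfolding P_def family_F_def by blast
  qed
qed

end

context thin_atom begin

text \<open>
  The order of preference heptagon, pentagon, hexagon ensures that the case of a pentagon may exclude heptagons
  and the case of a hexagon may exclude pentagons.
\<close>
theorem classification: assumes "U \<noteq> {}" shows "\<exists>F\<in>family_F. copy_of F"
proof -
  obtain n c where c: "hole n c" using assms every_vertex_in_hole by blast
  consider c7 where "hole 7 c7" | c5 where "hole 5 c5" "\<And>h. \<not> hole 7 h" | "hole 6 c" "\<And>h. \<not> hole 5 h"
    using hole_length_le_7[OF c] c by blast
  then show ?thesis
  proof cases
    case 1
    then interpret heptagon U adj c7 by unfold_locales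
    show ?thesis by (rule heptagon_classification)
  next
    case 2
    then interpret pentagon U adj c5 by unfold_locales
    show ?thesis by (rule pentagon_classification)
  next
    case 3
    then interpret hexagon U adj c by unfold_locales
    show ?thesis by (rule hexagon_classification)
  qed
qed

end

section \<open>Contracting classes of true twins\<close>
context sgraph begin

definition closed_nbhd :: "'a \<Rightarrow> 'a set" where
  "closed_nbhd u = insert u {w. w \<sim> u}"

text \<open>
  A chosen vertex of the class of true twins of \<open>u\<close>.
\<close>
definition rep :: "'a \<Rightarrow> 'a" where
  "rep u = (SOME w. w \<in> U \<and> closed_nbhd w = closed_nbhd u)"

definition reps :: "'a set" where
  "reps = rep ` U"

definition radj :: "'a \<Rightarrow> 'a \<Rightarrow> bool" where
  "radj u v \<longleftrightarrow> u \<sim> v \<and> u \<in> reps \<and> v \<in> reps"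

lemma closed_nbhd_commute: "u \<in> closed_nbhd v \<longleftrightarrow> v \<in> closed_nbhd u"
  using adj_sym by (auto simp: closed_nbhd_def)

lemma rep: assumes "u \<in> U" shows rep_in: "rep u \<in> U" and nbhd_rep: "closed_nbhd (rep u) = closed_nbhd u"
proof -
  have "rep u \<in> U \<and> closed_nbhd (rep u) = closed_nbhd u"
    unfolding rep_def by (rule someI[of _ u]) (use assms in simp)
  then show "rep u \<in> U" "closed_nbhd (rep u) = closed_nbhd u" by simp_all
qed

lemma rep_eq_iff: "u \<in> U \<Longrightarrow> v \<in> U \<Longrightarrow> rep u = rep v \<longleftrightarrow> closed_nbhd u = closed_nbhd v"
  using nbhd_rep by (metis rep_def)

lemma reps_subset: "reps \<subseteq> U"
  using rep_in by (auto simp: reps_def)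

lemma rep_of_rep: "u \<in> reps \<Longrightarrow> rep u = u"
  using rep_in rep_eq_iff nbhd_rep by (auto simp: reps_def)

lemma adj_rep:
  assumes "u \<in> U" "v \<in> U" "rep u \<noteq> rep v" shows "rep u \<sim> rep v \<longleftrightarrow> u \<sim> v"
proof -
  have "u \<sim> v \<longleftrightarrow> u \<in> closed_nbhd v" using assms by (auto simp: closed_nbhd_def)
  also have "\<dots> \<longleftrightarrow> rep v \<in> closed_nbhd u"
    using nbhd_rep[OF assms(2)] closed_nbhd_commute by blast
  also have "\<dots> \<longleftrightarrow> rep u \<in> closed_nbhd (rep v)"
    using nbhd_rep[OF assms(1)] closed_nbhd_commute by blast
  also have "\<dots> \<longleftrightarrow> rep u \<sim> rep v" using assms by (auto simp: closed_nbhd_def)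
  finally show ?thesis ..
qed

lemma same_rep_adj:
  assumes "u \<in> U" "v \<in> U" "rep u = rep v" "u \<noteq> v" shows "u \<sim> v"
  using assms rep_eq_iff[of u v] by (auto simp: closed_nbhd_def)

lemma radj_sgraph: "sgraph reps radj"
  using finite_subset[OF reps_subset finite_U] adj_sym
  by unfold_locales (auto simp: radj_def)

lemma cliq_lift:
  assumes "sgraph.cliq reps radj K"
  shows "cliq {x \<in> U. rep x \<in> K}"
proof -
  interpret R: sgraph reps radj by (rule radj_sgraph)
  have K: "u \<sim> v" if "u \<in> K" "v \<in> K" "u \<noteq> v" for u v
    using assms that by (auto simp: R.cliq_def radj_def)
  have "u \<sim> v" if "u \<in> U" "v \<in> U" "rep u \<in> K" "rep v \<in> K" "u \<noteq> v" for u v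
    using that K[of "rep u" "rep v"] adj_rep[of u v] same_rep_adj[of u v] by blast
  then show ?thesis by (auto simp: cliq_def)
qed

end

context atom begin

text \<open>
  Cliques of representatives extend to cliques of the whole graph by adding all twins, and walks of the
  whole graph project to walks of representatives, so neither clique cutsets nor universal cliques
  appear.
\<close>
lemma reps_atom: "atom reps radj"
proof -
  interpret R: sgraph reps radj by (rule radj_sgraph)
  show ?thesis
  proof unfold_locales
    show False
      if "radj a b" "radj b c" "radj c d" "radj d a" "\<not> radj a c" "\<not> radj b d" "a \<noteq> c" "b \<noteq> d" for a b c d
      using no_C4[of a b c d] that by (auto simp: radj_def)
    fix K assume K: "R.cliq K"
    let ?K = "{x \<in> U. rep x \<in> K}"
    have K': "cliq ?K" by (rule cliq_lift[OF K])
    have KR: "K \<subseteq> reps" using K by (auto simp: R.cliq_def)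
    show "(x, y) \<in> (R.edges_within (reps - K))\<^sup>*" if x: "x \<in> reps" "y \<in> reps" "x \<notin> K" "y \<notin> K" for x y
    proof -
      have "(x, y) \<in> (edges_within (U - ?K))\<^sup>*"
        using x reps_subset rep_of_rep by (intro inseparable[OF K']) auto
      then have "(rep x, rep y) \<in> (R.edges_within (reps - K))\<^sup>*"
      proof (induction rule: rtrancl_induct)
        case (step y z)
        have yz: "y \<in> U" "z \<in> U" "rep y \<notin> K" "rep z \<notin> K" "y \<sim> z"
          using step(2) by (auto simp: edges_within_def)
        show ?case
        proof (cases "rep y = rep z")
          case False
          then have "(rep y, rep z) \<in> R.edges_within (reps - K)"
            using yz adj_rep[of y z] by (auto simp: R.edges_within_def radj_def reps_def)
          then show ?thesis using step.IH by (rule rtrancl_into_rtrancl[rotated])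
        qed (use step.IH in simp)
      qed simp
      then show ?thesis using x rep_of_rep by simp
    qed
    show "\<exists>u\<in>K. \<exists>v\<in>reps - K. \<not> radj u v" if ne: "K \<noteq> {}"
    proof -
      obtain k where "k \<in> K" using ne by blast
      then have "k \<in> ?K" using KR reps_subset rep_of_rep by auto
      then obtain u v where uv: "u \<in> ?K" "v \<in> U" "v \<notin> ?K" "u \<nsim> v" using no_universal[OF K'] by blast
      then have "rep u \<in> K" "rep v \<in> reps - K" "rep u \<nsim> rep v"
        using adj_rep[of u v] by (auto simp: reps_def) metis
      then show ?thesis by (auto simp: radj_def)
    qed
  qed
qed

end

text \<open>
  A vertex \<open>w\<close> that distinguishes two representatives can be replaced by its own representative.
\<close>
lemma (in bull_free_atom) reps_twinless: "twinless_bull_free_atom reps radj"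
proof -
  interpret R: atom reps radj by (rule reps_atom)
  show ?thesis
  proof unfold_locales
    show False
      if "radj a b" "radj b c" "radj a c" "radj a d" "radj b e" "\<not> radj b d" "\<not> radj c d"
        "\<not> radj a e" "\<not> radj c e" "\<not> radj d e" for a b c d e
      using no_bull[of a b c d e] that by (auto simp: radj_def)
    fix u v assume uv: "radj u v"
    then have r: "u \<in> U" "v \<in> U" "rep u = u" "rep v = v" "u \<noteq> v" "u \<sim> v"
      using reps_subset rep_of_rep by (auto simp: radj_def)
    then have "closed_nbhd u \<noteq> closed_nbhd v" using rep_eq_iff[of u v] by auto
    then obtain w where w: "(w \<in> closed_nbhd u) \<noteq> (w \<in> closed_nbhd v)" by blast
    then have wU: "w \<in> U" using adj_in r by (auto simp: closed_nbhd_def)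
    have "w \<noteq> u" "w \<noteq> v" using w r adj_sym by (auto simp: closed_nbhd_def)
    moreover have key: "rep w \<noteq> a" if "a \<sim> b" "(w \<in> closed_nbhd a) \<noteq> (w \<in> closed_nbhd b)" for a b
    proof
      assume "rep w = a"
      then have N: "closed_nbhd a = closed_nbhd w" using nbhd_rep[OF wU] by simp
      then have "w \<in> closed_nbhd a" by (simp add: closed_nbhd_def)
      moreover have "b \<in> closed_nbhd w" unfolding N[symmetric] using that(1) adj_sym by (simp add: closed_nbhd_def)
      ultimately show False using that(2) closed_nbhd_commute[of b w] by simp
    qed
    moreover have "rep w \<noteq> u" "rep w \<noteq> v" using key[of u v] key[of v u] w r(6) adj_sym by auto
    ultimately have "(rep w \<sim> u) \<noteq> (rep w \<sim> v)"
      using adj_rep[of w u] adj_rep[of w v] w wU r by (auto simp: closed_nbhd_def)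
    then show "\<exists>w. w \<noteq> u \<and> w \<noteq> v \<and> radj w u \<noteq> radj w v"
      using \<open>rep w \<noteq> u\<close> \<open>rep w \<noteq> v\<close> uv wU by (auto simp: radj_def reps_def)
  qed
qed

section \<open>From pair digraphs to adjacency relations\<close>
text \<open>
  The map goes from \<open>H\<close> to \<open>G\<close>, the direction in which copies of the named graphs are given.
\<close>
lemma graph_isoI:
  assumes "pair_wf_digraph G" "pair_wf_digraph H" and f: "bij_betw f (pverts H) (pverts G)"
    and iff: "\<And>u v. u \<in> pverts H \<Longrightarrow> v \<in> pverts H \<Longrightarrow> (f u, f v) \<in> parcs G \<longleftrightarrow> (u, v) \<in> parcs H"
  shows "graph_iso G H"
proof -
  interpret G: pair_wf_digraph G by fact
  interpret H: pair_wf_digraph H by fact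
  define g where "g = the_inv_into (pverts H) f"
  have gf: "g (f u) = u" if "u \<in> pverts H" for u
    using f that by (auto simp: g_def bij_betw_def the_inv_into_f_f)
  have fg: "f (g u) = u" "g u \<in> pverts H" if "u \<in> pverts G" for u
  proof -
    have "u \<in> f ` pverts H" using bij_betw_imp_surj_on[OF f] that by simp
    then obtain v where "v \<in> pverts H" "u = f v" by blast
    then show "f (g u) = u" "g u \<in> pverts H" using gf by simp_all
  qed
  define hom where "hom = \<lparr> iso_verts = g, iso_arcs = map_prod g g, iso_head = snd, iso_tail = fst \<rparr>"
  have inj: "inj_on g (pverts G)" by (metis fg(1) inj_onI)
  have "G.digraph_isomorphism hom"
    unfolding G.digraph_isomorphism_def
  proof (intro conjI ballI)
    show "inj_on (iso_verts hom) (pverts G)" using inj by (simp add: hom_def)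
    show "inj_on (iso_arcs hom) (parcs G)"
      using inj G.in_arcsD1 G.in_arcsD2 by (auto simp: hom_def inj_on_def)
  qed (use assms(1) in \<open>auto simp: hom_def wf_digraph_wp_iff\<close>)
  moreover have "with_proj H = app_iso hom (with_proj G)"
  proof -
    have "g ` pverts G = pverts H" using fg gf f by (force simp: bij_betw_def)
    moreover have "map_prod g g ` parcs G = parcs H"
    proof
      show "map_prod g g ` parcs G \<subseteq> parcs H"
        using iff fg G.in_arcsD1 G.in_arcsD2 by auto metis
      show "parcs H \<subseteq> map_prod g g ` parcs G"
      proof
        fix e assume "e \<in> parcs H"
        moreover obtain u v where e: "e = (u, v)" by (cases e)
        ultimately have "(f u, f v) \<in> parcs G" "u \<in> pverts H" "v \<in> pverts H"
          using iff H.in_arcsD1 H.in_arcsD2 by blast+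
        moreover from this have "e = map_prod g g (f u, f v)" using gf e by simp
        ultimately show "e \<in> map_prod g g ` parcs G" by blast
      qed
    qed
    ultimately show ?thesis by (simp add: app_iso_def with_proj_def hom_def)
  qed
  ultimately show ?thesis unfolding graph_iso_def digraph_iso_def by auto
qed

lemma graph_isoE:
  assumes "graph_iso G H"
  obtains f where "pair_wf_digraph G" "bij_betw f (pverts G) (pverts H)"
    "\<And>u v. u \<in> pverts G \<Longrightarrow> v \<in> pverts G \<Longrightarrow> (f u, f v) \<in> parcs H \<longleftrightarrow> (u, v) \<in> parcs G"
proof -
  obtain hom where hom: "pre_digraph.digraph_isomorphism (with_proj G) hom"
    and H: "with_proj H = app_iso hom (with_proj G)"
    using assms by (auto simp: graph_iso_def digraph_iso_def)
  then interpret pair_wf_digraph G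
    by (simp add: pre_digraph.digraph_isomorphism_def wf_digraph_wp_iff)
  let ?f = "iso_verts hom"
  have inj: "inj_on ?f (pverts G)"
    and ends: "\<And>e. e \<in> parcs G \<Longrightarrow> ?f (fst e) = iso_tail hom (iso_arcs hom e)"
      "\<And>e. e \<in> parcs G \<Longrightarrow> ?f (snd e) = iso_head hom (iso_arcs hom e)"
    using hom by (auto simp: digraph_isomorphism_def)
  have verts: "pverts H = ?f ` pverts G" and arcs: "parcs H = iso_arcs hom ` parcs G"
    and "fst = iso_tail hom" "snd = iso_head hom"
    using H by (auto simp: with_proj_def app_iso_def)
  then have e: "iso_arcs hom e = (?f (fst e), ?f (snd e))" if "e \<in> parcs G" for e
    using ends that by (simp add: prod_eq_iff)
  show thesis
  proof (rule that[of ?f])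
    show "pair_wf_digraph G" by unfold_locales
    show "bij_betw ?f (pverts G) (pverts H)" using inj verts by (simp add: bij_betw_def)
    show "(?f u, ?f v) \<in> parcs H \<longleftrightarrow> (u, v) \<in> parcs G" if uv: "u \<in> pverts G" "v \<in> pverts G" for u v
    proof
      assume "(?f u, ?f v) \<in> parcs H"
      then obtain a where a: "a \<in> parcs G" "(?f u, ?f v) = iso_arcs hom a" using arcs by auto
      then have "u = fst a" "v = snd a"
        using e[OF a(1)] inj uv arc_fst_in_verts arc_snd_in_verts by (auto dest: inj_onD)
      then show "(u, v) \<in> parcs G" using a by simp
    qed (use arcs e in force)
  qed
qed

lemma not_induced_free:
  assumes G: "pair_wf_digraph G" and H: "graph_iso H F"
    and f: "inj_on f (pverts F)" "f ` pverts F \<subseteq> pverts G"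
    and iff: "\<forall>u\<in>pverts F. \<forall>v\<in>pverts F. (f u, f v) \<in> parcs G \<longleftrightarrow> (u, v) \<in> parcs F"
  shows "\<not> induced_free H G"
proof -
  obtain h where wfH: "pair_wf_digraph H" and h: "bij_betw h (pverts H) (pverts F)"
    and h_iff: "\<And>u v. u \<in> pverts H \<Longrightarrow> v \<in> pverts H \<Longrightarrow> (h u, h v) \<in> parcs F \<longleftrightarrow> (u, v) \<in> parcs H"
    using H by (elim graph_isoE) blast
  let ?G = "\<lparr> pverts = f ` pverts F, parcs = parcs G \<inter> (f ` pverts F \<times> f ` pverts F) \<rparr>"
  have wf: "pair_wf_digraph ?G" by unfold_locales auto
  have "induced_subgraph (with_proj ?G) (with_proj G)"
    unfolding induced_subgraph_def subgraph_def
    using G wf f(2) by (auto simp: wf_digraph_wp_iff compatible_def)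
  moreover have "graph_iso ?G H"
  proof (rule graph_isoI[where f = "f \<circ> h"])
    show "bij_betw (f \<circ> h) (pverts H) (pverts ?G)"
      using bij_betw_trans[OF h inj_on_imp_bij_betw[OF f(1)]] by simp
    have "h u \<in> pverts F" if "u \<in> pverts H" for u using h that by (auto simp: bij_betw_def)
    then show "((f \<circ> h) u, (f \<circ> h) v) \<in> parcs ?G \<longleftrightarrow> (u, v) \<in> parcs H"
      if "u \<in> pverts H" "v \<in> pverts H" for u v
      using that iff h_iff by simp
  qed (use wf wfH in auto)
  ultimately show ?thesis unfolding induced_free_def by blast
qed

lemma graph_iso_refl: "pair_wf_digraph G \<Longrightarrow> graph_iso G G"
  by (rule graph_isoI[where f = id]) auto

lemma wf_graph_of: "E \<subseteq> S \<times> S \<Longrightarrow> pair_wf_digraph (graph_of S E)"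
  by unfold_locales (auto simp: graph_of_def)

lemma small_graphs:
  "cycle_graph 4 = graph_of {V 1, V 2, V 3, V 4} {(V 4, V 1), (V 1, V 2), (V 2, V 3), (V 3, V 4)}"
  "path_graph 7 = graph_of {V 1, V 2, V 3, V 4, V 5, V 6, V 7}
    {(V 1, V 2), (V 2, V 3), (V 3, V 4), (V 4, V 5), (V 5, V 6), (V 6, V 7)}"
  "bull = graph_of {V 1, V 2, V 3, V 4, V 5} {(V 3, V 1), (V 1, V 2), (V 2, V 3), (V 1, V 4), (V 2, V 5)}"
  "hammer = graph_of {V 1, V 2, V 3, V 4, V 5} {(V 3, V 1), (V 1, V 2), (V 2, V 3), (V 3, V 4), (V 4, V 5)}"
proof -
  have s: "{1..4::nat} = {1, 2, 3, 4}" "{1..<4::nat} = {1, 2, 3}" "{1..<3::nat} = {1, 2}" by auto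
  show "cycle_graph 4 = graph_of {V 1, V 2, V 3, V 4} {(V 4, V 1), (V 1, V 2), (V 2, V 3), (V 3, V 4)}"
    "path_graph 7 = graph_of {V 1, V 2, V 3, V 4, V 5, V 6, V 7}
      {(V 1, V 2), (V 2, V 3), (V 3, V 4), (V 4, V 5), (V 5, V 6), (V 6, V 7)}"
    "bull = graph_of {V 1, V 2, V 3, V 4, V 5} {(V 3, V 1), (V 1, V 2), (V 2, V 3), (V 1, V 4), (V 2, V 5)}"
    "hammer = graph_of {V 1, V 2, V 3, V 4, V 5} {(V 3, V 1), (V 1, V 2), (V 2, V 3), (V 3, V 4), (V 4, V 5)}"
    unfolding cycle_graph_def path_graph_def bull_def hammer_def cycle_edges_def path_edges_def s interval_sets index_sets
    by (simp_all add: insert_commute numeral_2_eq_2[symmetric])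
qed

text \<open>
  The vertices of the copy of \<open>F\<close> are listed in the order of their names.
\<close>
lemma pattern_not_induced_free:
  fixes xs :: "'a list"
  assumes "pair_wf_digraph G" "graph_iso H F" "distinct xs" "set xs \<subseteq> pverts G" and n: "length xs = n"
    and F: "pverts F = V ` {1..n}"
    and iff: "\<forall>i\<in>{1..n}. \<forall>j\<in>{1..n}. (xs ! (i - 1), xs ! (j - 1)) \<in> parcs G
      \<longleftrightarrow> (V i, V j) \<in> parcs F"
  shows "\<not> induced_free H G"
proof (rule not_induced_free[where f = "case_vertex (\<lambda>i. xs ! (i - 1)) undefined undefined undefined"])
  show "inj_on (case_vertex (\<lambda>i. xs ! (i - 1)) undefined undefined undefined) (pverts F)"
    using assms(3) n by (auto simp: F inj_on_def nth_eq_iff_index_eq)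
  show "case_vertex (\<lambda>i. xs ! (i - 1)) undefined undefined undefined ` pverts F \<subseteq> pverts G"
    using n by (auto simp: F intro!: subsetD[OF assms(4)] nth_mem)
qed (use assms(1,2) iff in \<open>auto simp: F\<close>)

lemma four_indices: "{1..4::nat} = {1, 2, 3, 4}"
  by auto

context pair_graph
begin

abbreviation adjacent (infix "\<sim>" 50) where "u \<sim> v \<equiv> (u, v) \<in> parcs G"

lemma sgraph_adjacent: "sgraph (pverts G) (\<lambda>u v. u \<sim> v)"
  using pair_finite_verts in_arcsD1 arcs_symmetric no_loops' by unfold_locales blast+

lemma nonadj_sym: "\<not> u \<sim> v \<Longrightarrow> \<not> v \<sim> u"
  using arcs_symmetric by blast

lemma C4_free:
  assumes free: "induced_free (cycle_graph 4) G"
    and pos: "a \<sim> b" "b \<sim> c" "c \<sim> d" "d \<sim> a"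
    and neg: "\<not> a \<sim> c" "\<not> b \<sim> d"
    and ne: "a \<noteq> c" "b \<noteq> d"
  shows False
proof -
  interpret sgraph "pverts G" "\<lambda>u v. u \<sim> v" by (rule sgraph_adjacent)
  have "pair_wf_digraph (cycle_graph 4)" unfolding small_graphs by (rule wf_graph_of) simp
  then have iso: "graph_iso (cycle_graph 4) (cycle_graph 4)" by (rule graph_iso_refl)
  have "distinct [a, b, c, d]" using pos neg ne pos[THEN adj_sym] neg[THEN nonadj_sym] by auto
  moreover have "set [a, b, c, d] \<subseteq> pverts G" using pos[THEN adj_in] pos[THEN adj_in2] by simp
  moreover have "\<forall>i\<in>{1..4}. \<forall>j\<in>{1..4}. [a, b, c, d] ! (i - 1) \<sim> [a, b, c, d] ! (j - 1)
      \<longleftrightarrow> (V i, V j) \<in> parcs (cycle_graph 4)"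
    unfolding four_indices small_graphs parcs_graph_of
    using pos neg pos[THEN adj_sym] neg[THEN nonadj_sym] by simp
  ultimately have "\<not> induced_free (cycle_graph 4) G"
    by (intro pattern_not_induced_free[OF pair_wf_digraph iso, of "[a, b, c, d]" 4])
      (simp_all add: small_graphs four_indices[unfolded One_nat_def])
  then show False using free by simp
qed

lemma P7_free:
  assumes free: "induced_free (path_graph 7) G"
    and pos: "p1 \<sim> p2" "p2 \<sim> p3" "p3 \<sim> p4" "p4 \<sim> p5" "p5 \<sim> p6" "p6 \<sim> p7"
    and neg: "\<not> p1 \<sim> p3" "\<not> p1 \<sim> p4" "\<not> p1 \<sim> p5"
      "\<not> p1 \<sim> p6" "\<not> p1 \<sim> p7" "\<not> p2 \<sim> p4" "\<not> p2 \<sim> p5"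
      "\<not> p2 \<sim> p6" "\<not> p2 \<sim> p7" "\<not> p3 \<sim> p5" "\<not> p3 \<sim> p6"
      "\<not> p3 \<sim> p7" "\<not> p4 \<sim> p6" "\<not> p4 \<sim> p7" "\<not> p5 \<sim> p7"
  shows False
proof -
  interpret sgraph "pverts G" "\<lambda>u v. u \<sim> v" by (rule sgraph_adjacent)
  have "pair_wf_digraph (path_graph 7)" unfolding small_graphs by (rule wf_graph_of) simp
  then have iso: "graph_iso (path_graph 7) (path_graph 7)" by (rule graph_iso_refl)
  have "distinct [p1, p2, p3, p4, p5, p6, p7]" using pos neg pos[THEN adj_sym] neg[THEN nonadj_sym] by auto
  moreover have "set [p1, p2, p3, p4, p5, p6, p7] \<subseteq> pverts G" using pos[THEN adj_in] pos[THEN adj_in2] by simp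
  moreover have "\<forall>i\<in>{1..7}. \<forall>j\<in>{1..7}. [p1, p2, p3, p4, p5, p6, p7] ! (i - 1) \<sim> [p1, p2, p3, p4, p5, p6, p7] ! (j - 1)
      \<longleftrightarrow> (V i, V j) \<in> parcs (path_graph 7)"
    unfolding index_sets(1) small_graphs parcs_graph_of
    using pos neg pos[THEN adj_sym] neg[THEN nonadj_sym] by simp
  ultimately have "\<not> induced_free (path_graph 7) G"
    by (intro pattern_not_induced_free[OF pair_wf_digraph iso, of "[p1, p2, p3, p4, p5, p6, p7]" 7])
      (simp_all add: small_graphs index_sets(1)[unfolded One_nat_def])
  then show False using free by simp
qed

lemma bull_free:
  assumes free: "induced_free H G"
    and iso: "graph_iso H bull"
    and pos: "a \<sim> b" "b \<sim> c" "a \<sim> c" "a \<sim> d" "b \<sim> e"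
    and neg: "\<not> b \<sim> d" "\<not> c \<sim> d" "\<not> a \<sim> e" "\<not> c \<sim> e"
      "\<not> d \<sim> e"
  shows False
proof -
  interpret sgraph "pverts G" "\<lambda>u v. u \<sim> v" by (rule sgraph_adjacent)
  have "distinct [a, b, c, d, e]" using pos neg pos[THEN adj_sym] neg[THEN nonadj_sym] by auto
  moreover have "set [a, b, c, d, e] \<subseteq> pverts G" using pos[THEN adj_in] pos[THEN adj_in2] by simp
  moreover have "\<forall>i\<in>{1..5}. \<forall>j\<in>{1..5}. [a, b, c, d, e] ! (i - 1) \<sim> [a, b, c, d, e] ! (j - 1)
      \<longleftrightarrow> (V i, V j) \<in> parcs bull"
    unfolding interval_sets(4) small_graphs parcs_graph_of
    using pos neg pos[THEN adj_sym] neg[THEN nonadj_sym] by simp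
  ultimately have "\<not> induced_free H G"
    by (intro pattern_not_induced_free[OF pair_wf_digraph iso, of "[a, b, c, d, e]" 5])
      (simp_all add: small_graphs interval_sets(4)[unfolded One_nat_def])
  then show False using free by simp
qed

lemma hammer_free:
  assumes free: "induced_free H G"
    and iso: "graph_iso H hammer"
    and pos: "a \<sim> b" "b \<sim> c" "a \<sim> c" "c \<sim> d" "d \<sim> e"
    and neg: "\<not> a \<sim> d" "\<not> b \<sim> d" "\<not> a \<sim> e" "\<not> b \<sim> e"
      "\<not> c \<sim> e"
  shows False
proof -
  interpret sgraph "pverts G" "\<lambda>u v. u \<sim> v" by (rule sgraph_adjacent)
  have "distinct [a, b, c, d, e]" using pos neg pos[THEN adj_sym] neg[THEN nonadj_sym] by auto
  moreover have "set [a, b, c, d, e] \<subseteq> pverts G" using pos[THEN adj_in] pos[THEN adj_in2] by simp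
  moreover have "\<forall>i\<in>{1..5}. \<forall>j\<in>{1..5}. [a, b, c, d, e] ! (i - 1) \<sim> [a, b, c, d, e] ! (j - 1)
      \<longleftrightarrow> (V i, V j) \<in> parcs hammer"
    unfolding interval_sets(4) small_graphs parcs_graph_of
    using pos neg pos[THEN adj_sym] neg[THEN nonadj_sym] by simp
  ultimately have "\<not> induced_free H G"
    by (intro pattern_not_induced_free[OF pair_wf_digraph iso, of "[a, b, c, d, e]" 5])
      (simp_all add: small_graphs interval_sets(4)[unfolded One_nat_def])
  then show False using free by simp
qed


lemma cliq_iff_clique: "sgraph.cliq (pverts G) (\<lambda>u v. u \<sim> v) K \<longleftrightarrow> clique G K"
  unfolding sgraph.cliq_def[OF sgraph_adjacent] clique_def ..

text \<open>
  Vertices not joined after deleting \<open>K\<close> lie in different strong components, while \<open>G\<close> has only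
  one component.
\<close>
lemma no_clique_cutset_imp_connected_minus_clique:
  assumes conn: "connected (with_proj G)" and no_cutset: "\<not> clique_cutset G K" and K: "clique G K"
    and xy: "x \<in> pverts G - K" "y \<in> pverts G - K"
  shows "(x, y) \<in> (sgraph.edges_within (\<lambda>u v. u \<sim> v) (pverts G - K))\<^sup>*"
proof (rule ccontr)
  interpret sgraph "pverts G" "\<lambda>u v. u \<sim> v" by (rule sgraph_adjacent)
  assume no_path: "(x, y) \<notin> (edges_within (pverts G - K))\<^sup>*"
  define S where "S = pverts G - K"
  interpret S: wf_digraph "with_proj G \<restriction> S" by (rule wellformed_induce_subgraph)
  have "finite (verts (with_proj G \<restriction> S))" "finite (arcs (with_proj G \<restriction> S))"
    using pair_finite_verts pair_finite_arcs by (auto simp: S_def)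
  then interpret S: fin_digraph "with_proj G \<restriction> S" by unfold_locales
  have "strongly_connected (with_proj G)"
    using conn by (intro symmetric_connected_imp_strongly_connected) (rule sym_arcs)
  then have "pre_digraph.sccs (with_proj G) = {with_proj G}" by (simp add: strongly_connected_eq_iff)
  then have one: "card (pre_digraph.sccs (with_proj G)) = 1" by simp
  have "(a, b) \<in> (edges_within S)\<^sup>*" if "a \<rightarrow>\<^sup>*\<^bsub>with_proj G \<restriction> S\<^esub> b" for a b
    using that unfolding reachable_def
  proof (induction rule: rtrancl_on_induct)
    case (step b d)
    then have "(b, d) \<in> edges_within S"
      by (auto simp: edges_within_def arcs_ends_conv)
    then show ?case using step.IH by (rule rtrancl_into_rtrancl[rotated])
  qed simp
  then have "\<not> x \<rightarrow>\<^sup>*\<^bsub>with_proj G \<restriction> S\<^esub> y" using no_path by (auto simp: S_def)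
  then have "y \<notin> S.scc_of x" by (simp add: S.scc_of_def)
  moreover have "x \<in> verts (with_proj G \<restriction> S)" "y \<in> verts (with_proj G \<restriction> S)" using xy by (simp_all add: S_def)
  then have "S.scc_of x \<in> S.sccs_verts" "S.scc_of y \<in> S.sccs_verts" "y \<in> S.scc_of y"
    by (auto intro: S.scc_of_in_sccs_verts S.in_scc_of_self)
  ultimately have "{S.scc_of x, S.scc_of y} \<subseteq> S.sccs_verts" "S.scc_of x \<noteq> S.scc_of y" by auto
  then have "2 \<le> card S.sccs_verts"
    using card_mono[OF S.finite_sccs_verts, of "{S.scc_of x, S.scc_of y}"] by simp
  then have "2 \<le> card (pre_digraph.sccs (with_proj G \<restriction> S))" by (simp add: S.card_sccs_verts)
  then show False using one no_cutset K unfolding clique_cutset_def S_def by simp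
qed

lemma atom_adjacent:
  assumes "connected (with_proj G)" "induced_free (cycle_graph 4) G"
    and "\<not> (\<exists>K. clique_cutset G K)" "\<not> (\<exists>K. universal_clique G K)"
  shows "atom (pverts G) (\<lambda>u v. u \<sim> v)"
proof -
  interpret sgraph "pverts G" "\<lambda>u v. u \<sim> v" by (rule sgraph_adjacent)
  show ?thesis
  proof unfold_locales
    show False if "a \<sim> b" "b \<sim> c" "c \<sim> d" "d \<sim> a" "\<not> a \<sim> c" "\<not> b \<sim> d" "a \<noteq> c" "b \<noteq> d" for a b c d
      by (rule C4_free[OF assms(2) that])
    fix K assume "cliq K"
    then have K: "clique G K" by (simp add: cliq_iff_clique)
    show "(x, y) \<in> (edges_within (pverts G - K))\<^sup>*"
      if "x \<in> pverts G" "y \<in> pverts G" "x \<notin> K" "y \<notin> K" for x y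
      using no_clique_cutset_imp_connected_minus_clique[OF assms(1) _ K] assms(3) that by blast
    show "\<exists>u\<in>K. \<exists>v\<in>pverts G - K. \<not> u \<sim> v" if "K \<noteq> {}"
      using assms(4) K that unfolding universal_clique_def by blast
  qed
qed

end

section \<open>The structure theorem\<close>
lemma pair_wf_digraph_family_F: "F \<in> family_F \<Longrightarrow> pair_wf_digraph F"
proof -
  have sub: "pair_wf_digraph (F12_induced I)" for I
    by unfold_locales (auto simp: F12_induced_def)
  have "pair_wf_digraph F0" "pair_wf_digraph F1" "pair_wf_digraph F3" "pair_wf_digraph F4" "pair_wf_digraph F5"
    "pair_wf_digraph (F0' t)" "pair_wf_digraph (F2 t)" for t
    unfolding F0_def F1_def F3_def F4_def F5_def F0'_def F2_def cycle_graph_def small_cycle_edges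
    by (rule wf_graph_of; auto)+
  then show "F \<in> family_F \<Longrightarrow> pair_wf_digraph F"
    unfolding family_F_def F6_def F7_def F8_def F9_def F10_def F11_def F12_is_induced using sub by blast
qed

theorem theorem1p4:
  fixes G :: "'a pair_pre_digraph" and H :: "'b pair_pre_digraph"
  assumes "graph_iso H bull \<or> graph_iso H hammer"
    and "pair_graph G"
    and "connected (with_proj G)"
    and "induced_free (cycle_graph 4) G"
    and "induced_free (path_graph 7) G"
    and "induced_free H G"
    and "\<not> (\<exists>K. clique_cutset G K)"
    and "\<not> (\<exists>K. universal_clique G K)"
  shows "(graph_iso H hammer \<longrightarrow> (\<exists>F\<in>family_F. graph_iso G F)) \<and>
         (graph_iso H bull \<longrightarrow> (\<exists>F\<in>family_F. nonempty_clique_blowup G F))"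
proof -
  interpret G: pair_graph G by fact
  let ?adj = "\<lambda>u v. (u, v) \<in> parcs G"
  interpret atom "pverts G" ?adj by (rule G.atom_adjacent[OF assms(3,4,7,8)])
  have nonempty: "pverts G \<noteq> {}" using assms(3) by (simp add: connected_conv)
  note P7 = G.P7_free[OF assms(5)]
  show ?thesis
  proof (intro conjI impI)
    assume hammer: "graph_iso H hammer"
    interpret hammer_free_atom "pverts G" ?adj
      by unfold_locales (rule G.hammer_free[OF assms(6) hammer])
    interpret thin_atom "pverts G" ?adj
      by unfold_locales (rule triangle_free P7; assumption)+
    obtain F f where F: "F \<in> family_F" "bij_betw f (pverts F) (pverts G)"
      "\<forall>x\<in>pverts F. \<forall>y\<in>pverts F. ?adj (f x) (f y) \<longleftrightarrow> (x, y) \<in> parcs F"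
      using classification[OF nonempty] by (auto simp: copy_of_def)
    have "graph_iso G F"
      by (rule graph_isoI[OF G.pair_wf_digraph pair_wf_digraph_family_F[OF F(1)] F(2)]) (use F(3) in blast)
    then show "\<exists>F\<in>family_F. graph_iso G F" using F(1) by blast
  next
    assume bull: "graph_iso H bull"
    interpret bull_free_atom "pverts G" ?adj
      by unfold_locales (rule G.bull_free[OF assms(6) bull])
    interpret R: twinless_bull_free_atom reps radj by (rule reps_twinless)
    interpret R: thin_atom reps radj
    proof unfold_locales
      show False if "radj x y" "radj y z" "radj x z" for x y z
        by (rule R.triangle_free[OF that])
      show False if "radj p1 p2" "radj p2 p3" "radj p3 p4" "radj p4 p5" "radj p5 p6" "radj p6 p7"
        "\<not> radj p1 p3" "\<not> radj p1 p4" "\<not> radj p1 p5" "\<not> radj p1 p6" "\<not> radj p1 p7"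
        "\<not> radj p2 p4" "\<not> radj p2 p5" "\<not> radj p2 p6" "\<not> radj p2 p7"
        "\<not> radj p3 p5" "\<not> radj p3 p6" "\<not> radj p3 p7"
        "\<not> radj p4 p6" "\<not> radj p4 p7" "\<not> radj p5 p7" for p1 p2 p3 p4 p5 p6 p7
        by (rule P7[of p1 p2 p3 p4 p5 p6 p7]) (use that in \<open>simp_all add: radj_def\<close>)
    qed
    have "reps \<noteq> {}" using nonempty by (simp add: reps_def)
    then obtain F f where F: "F \<in> family_F" and f: "bij_betw f (pverts F) reps"
      and f_adj: "\<And>x y. x \<in> pverts F \<Longrightarrow> y \<in> pverts F \<Longrightarrow> radj (f x) (f y) \<longleftrightarrow> (x, y) \<in> parcs F"
      using R.classification by (auto simp: R.copy_of_def)
    define part where "part x = {y \<in> pverts G. rep y = f x}" for x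
    have f_reps: "f x \<in> reps" if "x \<in> pverts F" for x
      using f that by (auto simp: bij_betw_def)
    have f_inj: "x = y" if "x \<in> pverts F" "y \<in> pverts F" "f x = f y" for x y
      using f that by (auto simp: bij_betw_def dest: inj_onD)
    have "clique_blowup_parts G F part"
      unfolding clique_blowup_parts_def
    proof (intro conjI ballI impI)
      show "(\<Union>v\<in>pverts F. part v) = pverts G"
      proof
        show "pverts G \<subseteq> (\<Union>v\<in>pverts F. part v)"
        proof
          fix y assume y: "y \<in> pverts G"
          then have "rep y \<in> f ` pverts F" using bij_betw_imp_surj_on[OF f] by (simp add: reps_def)
          then show "y \<in> (\<Union>v\<in>pverts F. part v)" using y by (auto simp: part_def)
        qed
      qed (auto simp: part_def)
      show "disjoint_family_on part (pverts F)"
        using f_inj by (auto simp: disjoint_family_on_def part_def)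
      show "clique G (part v)" if "v \<in> pverts F" for v
        using same_rep_adj by (auto simp: clique_def part_def)
      fix u v assume uv: "u \<in> pverts F" "v \<in> pverts F" "u \<noteq> v"
      have "?adj a b \<longleftrightarrow> (u, v) \<in> parcs F" if "a \<in> part u" "b \<in> part v" for a b
      proof -
        have "rep a = f u" "rep b = f v" "a \<in> pverts G" "b \<in> pverts G" using that by (auto simp: part_def)
        moreover from this have "rep a \<noteq> rep b" using f_inj uv by auto
        ultimately have "?adj a b \<longleftrightarrow> ?adj (f u) (f v)" using adj_rep[of a b] by simp
        also have "\<dots> \<longleftrightarrow> radj (f u) (f v)" using f_reps uv by (simp add: radj_def)
        finally show ?thesis using f_adj uv by simp
      qed
      then show "if (u, v) \<in> parcs F then part u \<times> part v \<subseteq> parcs G else part u \<times> part v \<inter> parcs G = {}"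
        by auto
    qed
    moreover have "part v \<noteq> {}" if "v \<in> pverts F" for v
      using f_reps[OF that] reps_subset rep_of_rep by (auto simp: part_def)
    ultimately show "\<exists>F\<in>family_F. nonempty_clique_blowup G F"
      using F unfolding nonempty_clique_blowup_def by blast
  qed
qed

end
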